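(* Let $(M,g)$ be a Kähler manifold of real dimension four with Levi-Civita connection $\nabla$, Ricci tensor $\mathrm{r}$ and scalar curvature $\mathrm{s}$, and let functions $\tau,\alpha,\sigma:M\to\mathbb{R}$ satisfy $$\alpha\nabla d\tau+\mathrm{r}=\sigma g,$$ where $\alpha$ is a $C^\infty$ function of $\tau$ and $\alpha\nabla d\tau\neq0$ on a dense subset of $M$. Set $Q=g(\nabla\tau,\nabla\tau)$ and $Y=\Delta\tau$, and suppose that $dQ\wedge d\tau\neq0$ everywhere in an open connected set $U\subseteq M$. Then the following hold. The function $\alpha$ of the variable $\tau$ and its derivative $\alpha'=d\alpha/d\tau$ satisfy, on $U$, the equation $$\alpha''+\alpha\alpha'=0,\quad\text{that is,}\quad 2\alpha'+\alpha^2=4\varepsilon\ \text{ with a constant }\varepsilon\in\mathbb{R}.$$ In addition, on $U$, the functions $\theta$ and $\kappa$ given by $$2\theta=\alpha\,\mathrm{s}+4\varepsilon Y\qquad\text{and}\qquad \kappa=\theta\psi+\alpha^{-1}Y-Q$$ are both constant, where $\psi$ is given by $4\varepsilon\psi=\tau-2/\alpha$ if $\varepsilon\neq0$, and by $3\psi=2/\alpha^3$ if $\varepsilon=0$. Furthermore, $\sigma$ and the function $F$ of the variable $\tau$ characterized by $$4\varepsilon F=\theta(2-\tau\alpha)+4\varepsilon\kappa\alpha\ \text{ if }\varepsilon\neq0,\qquad F=\kappa\alpha-\frac{2\theta}{3\alpha^2}\ \text{ if }\varepsilon=0,$$ satisfy on $U$ the conditions $$\text{a) } Y-Q\alpha=F,\qquad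 \text{b) } 2\sigma=-(Q\alpha'+F'),\qquad \text{c) } \Delta\alpha=F\alpha'=-F'',$$ where $(\ )'=d/d\tau$. Finally, up to affine modifications, the pair $(\alpha(\tau),\varepsilon)$ is one of the following five: $$(2,1),\quad (2/\tau,0),\quad (2\tanh\tau,1),\quad (2\coth\tau,1),\quad (2\cot\tau,-1).$$
   Context: All manifolds and metrics are of class $C^\infty$, and manifolds are connected. $\nabla\tau$ is the $g$-gradient, $\nabla d\tau$ the Hessian, and $\Delta$ the Laplacian (trace of the Hessian). "$\alpha$ is a $C^\infty$ function of $\tau$" means that $\alpha$ is the composite of $\tau$ with a $C^\infty$ function of a real variable; derivatives $\alpha',\alpha''$ with respect to that variable are also treated as functions on $M$. Expressions containing negative powers of $\alpha$ are understood at points where $\alpha\neq0$. An affine modification replaces $\tau$ and the function $\tau\mapsto\alpha(\tau)$ with $\hat\tau$ and $\hat\tau\mapsto\hat\alpha(\hat\tau)$ given by $\hat\tau=p+\tau/c$ and $\hat\alpha(\hat\tau)=c\,\alpha(c\hat\tau-cp)$, for real constants $c\neq0$ and $p$ (the equation $\alpha\nabla d\tau+\mathrm{r}=\sigma g$ remains satisfied after such a replacement); the constant paired with $\hat\alpha$ is the $\hat\varepsilon$ with $2\,d\hat\alpha/d\hat\tau+\hat\alpha^2=4\hat\varepsilon$. *)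

theory Defs
  imports "HOL-Analysis.Analysis"
begin

section \<open>Smooth functions\<close>

text \<open>Only used on open sets \<open>S\<close>, where \<open>at x\<close> and \<open>at x within S\<close> agree.\<close>

primrec k_smooth_on ::
  "nat \<Rightarrow> 'a::euclidean_space set \<Rightarrow> ('a \<Rightarrow> 'b::real_normed_vector) \<Rightarrow> bool" where
  "k_smooth_on 0 S f \<longleftrightarrow> continuous_on S f"
| "k_smooth_on (Suc k) S f \<longleftrightarrow>
     (\<forall>x\<in>S. f differentiable (at x)) \<and>
     (\<forall>v. k_smooth_on k S (\<lambda>x. frechet_derivative f (at x) v))"

definition smooth_on :: "'a::euclidean_space set \<Rightarrow> ('a \<Rightarrow> 'b::real_normed_vector) \<Rightarrow> bool" where
  "smooth_on S f \<longleftrightarrow> (\<forall>k. k_smooth_on k S f)"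


section \<open>Smooth manifolds\<close>

text \<open>A chart is a pair of its domain and its coordinate map; the values of the coordinate map
  outside the domain are irrelevant. An atlas need not be maximal.\<close>

type_synonym ('m, 'n) chart = "'m set \<times> ('m \<Rightarrow> real ^ 'n)"

abbreviation chart_dom :: "('m, 'n::finite) chart \<Rightarrow> 'm set" where
  "chart_dom c \<equiv> fst c"

abbreviation chart_map :: "('m, 'n::finite) chart \<Rightarrow> 'm \<Rightarrow> real ^ 'n" where
  "chart_map c \<equiv> snd c"

definition chart_inv :: "('m, 'n::finite) chart \<Rightarrow> real ^ 'n \<Rightarrow> 'm" where
  "chart_inv c = inv_into (chart_dom c) (chart_map c)"

definition is_chart :: "('m::topological_space, 'n::finite) chart \<Rightarrow> bool" where
  "is_chart c \<longleftrightarrow> open (chart_dom c) \<and> open (chart_map c ` chart_dom c) \<and>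
     homeomorphism (chart_dom c) (chart_map c ` chart_dom c) (chart_map c) (chart_inv c)"

definition carrier_of :: "('m, 'n::finite) chart set \<Rightarrow> 'm set" where
  "carrier_of A = (\<Union>c\<in>A. chart_dom c)"

definition smooth_manifold ::
  "('m::{t2_space, second_countable_topology}, 'n::finite) chart set \<Rightarrow> bool" where
  "smooth_manifold A \<longleftrightarrow>
     (\<forall>c\<in>A. is_chart c) \<and>
     (\<forall>c\<in>A. \<forall>d\<in>A. smooth_on (chart_map c ` (chart_dom c \<inter> chart_dom d))
                              (chart_map d \<circ> chart_inv c)) \<and>
     carrier_of A \<noteq> {} \<and> connected (carrier_of A)"

definition smooth_in_chart ::
  "('m, 'n::finite) chart \<Rightarrow> ('m \<Rightarrow> real) \<Rightarrow> bool" where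
  "smooth_in_chart c f \<longleftrightarrow> smooth_on (chart_map c ` chart_dom c) (f \<circ> chart_inv c)"

definition smooth_fun :: "('m, 'n::finite) chart set \<Rightarrow> ('m \<Rightarrow> real) \<Rightarrow> bool" where
  "smooth_fun A f \<longleftrightarrow> (\<forall>c\<in>A. smooth_in_chart c f)"

text \<open>The partial derivative of a function on the manifold in the direction of the \<open>i\<close>-th
  coordinate field of the chart \<open>c\<close>.\<close>

definition coord_deriv ::
  "('m, 'n::finite) chart \<Rightarrow> 'n \<Rightarrow> ('m \<Rightarrow> real) \<Rightarrow> 'm \<Rightarrow> real" where
  "coord_deriv c i f p = frechet_derivative (f \<circ> chart_inv c) (at (chart_map c p)) (axis i 1)"

definition differential ::
  "('m, 'n::finite) chart \<Rightarrow> ('m \<Rightarrow> real) \<Rightarrow> 'm \<Rightarrow> real ^ 'n" where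
  "differential c f p = (\<chi> i. coord_deriv c i f p)"

text \<open>Row index: coordinates of \<open>d\<close>; column index: coordinates of \<open>c\<close>.\<close>

definition jacobian_between ::
  "('m, 'n::finite) chart \<Rightarrow> ('m, 'n) chart \<Rightarrow> 'm \<Rightarrow> real ^ 'n ^ 'n" where
  "jacobian_between c d p = (\<chi> k i. coord_deriv c i (\<lambda>q. chart_map d q $ k) p)"


section \<open>Tensor fields of rank two\<close>

text \<open>A tensor field of rank two is the family of its matrices of components in all charts of the
  atlas, as functions of the point of the manifold.\<close>

type_synonym ('m, 'n) tensor2 = "('m, 'n) chart \<Rightarrow> 'm \<Rightarrow> real ^ 'n ^ 'n"

definition smooth_tensor2 :: "('m, 'n::finite) chart set \<Rightarrow> ('m, 'n) tensor2 \<Rightarrow> bool" where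
  "smooth_tensor2 A T \<longleftrightarrow> (\<forall>c\<in>A. \<forall>i j. smooth_in_chart c (\<lambda>p. T c p $ i $ j))"

definition bilinear_tensor :: "('m, 'n::finite) chart set \<Rightarrow> ('m, 'n) tensor2 \<Rightarrow> bool" where
  "bilinear_tensor A T \<longleftrightarrow>
     (\<forall>c\<in>A. \<forall>d\<in>A. \<forall>p\<in>chart_dom c \<inter> chart_dom d.
        T c p = transpose (jacobian_between c d p) ** T d p ** jacobian_between c d p)"

definition endomorphism_tensor :: "('m, 'n::finite) chart set \<Rightarrow> ('m, 'n) tensor2 \<Rightarrow> bool" where
  "endomorphism_tensor A T \<longleftrightarrow>
     (\<forall>c\<in>A. \<forall>d\<in>A. \<forall>p\<in>chart_dom c \<inter> chart_dom d.
        jacobian_between c d p ** T c p = T d p ** jacobian_between c d p)"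

text \<open>For tensors, being nonzero at a point does not depend on the chart.\<close>

definition nonzero_at ::
  "('m, 'n::finite) chart set \<Rightarrow> ('m, 'n) tensor2 \<Rightarrow> 'm \<Rightarrow> bool" where
  "nonzero_at A T p \<longleftrightarrow> (\<exists>c\<in>A. p \<in> chart_dom c \<and> T c p \<noteq> 0)"

text \<open>The value at \<open>p\<close> of a scalar computed in local coordinates. It is only applied to
  coordinate expressions that are invariant, so the choice of the chart is immaterial.\<close>

definition invariant_value ::
  "('m, 'n::finite) chart set \<Rightarrow> (('m, 'n) chart \<Rightarrow> 'm \<Rightarrow> real) \<Rightarrow> 'm \<Rightarrow> real" where
  "invariant_value A S p = S (SOME c. c \<in> A \<and> p \<in> chart_dom c) p"

definition wedge_differentials ::
  "('m \<Rightarrow> real) \<Rightarrow> ('m \<Rightarrow> real) \<Rightarrow> ('m, 'n::finite) tensor2" where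
  "wedge_differentials f h c p =
     (\<chi> i j. coord_deriv c i f p * coord_deriv c j h p - coord_deriv c j f p * coord_deriv c i h p)"


section \<open>Riemannian and Kaehler metrics\<close>

definition riemannian_metric ::
  "('m, 'n::finite) chart set \<Rightarrow> ('m, 'n) tensor2 \<Rightarrow> bool" where
  "riemannian_metric A g \<longleftrightarrow>
     smooth_tensor2 A g \<and> bilinear_tensor A g \<and>
     (\<forall>c\<in>A. \<forall>p\<in>chart_dom c.
        transpose (g c p) = g c p \<and> (\<forall>v. v \<noteq> 0 \<longrightarrow> v \<bullet> (g c p *v v) > 0))"

text \<open>\<open>christoffel g c k i j\<close> is \<open>\<Gamma>\<^sup>k\<^sub>i\<^sub>j\<close>, the \<open>k\<close>-th component of
  \<open>\<nabla>\<^sub>i \<partial>\<^sub>j\<close> for the Levi-Civita connection \<open>\<nabla>\<close> of \<open>g\<close>; see \<open>christoffel_symmetric\<close> and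
  \<open>christoffel_metric\<close> below.\<close>

definition christoffel ::
  "('m, 'n::finite) tensor2 \<Rightarrow> ('m, 'n) chart \<Rightarrow> 'n \<Rightarrow> 'n \<Rightarrow> 'n \<Rightarrow> 'm \<Rightarrow> real" where
  "christoffel g c k i j p =
     (\<Sum>l\<in>UNIV. matrix_inv (g c p) $ k $ l *
        (coord_deriv c i (\<lambda>q. g c q $ j $ l) p + coord_deriv c j (\<lambda>q. g c q $ i $ l) p
         - coord_deriv c l (\<lambda>q. g c q $ i $ j) p)) / 2"

definition gradient ::
  "('m, 'n::finite) tensor2 \<Rightarrow> ('m, 'n) chart \<Rightarrow> ('m \<Rightarrow> real) \<Rightarrow> 'm \<Rightarrow> real ^ 'n" where
  "gradient g c f p = matrix_inv (g c p) *v differential c f p"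

definition hessian :: "('m, 'n::finite) tensor2 \<Rightarrow> ('m \<Rightarrow> real) \<Rightarrow> ('m, 'n) tensor2" where
  "hessian g f c p =
     (\<chi> i j. coord_deriv c i (coord_deriv c j f) p
             - (\<Sum>k\<in>UNIV. christoffel g c k i j p * coord_deriv c k f p))"

text \<open>\<open>curvature g c l k i j\<close> is the \<open>l\<close>-th component of \<open>R(\<partial>\<^sub>i, \<partial>\<^sub>j) \<partial>\<^sub>k\<close>, where
  \<open>R(X, Y) = [\<nabla>\<^sub>X, \<nabla>\<^sub>Y] - \<nabla>\<^bsub>[X, Y]\<^esub>\<close>; the Ricci tensor is
  \<open>r(Y, Z) = tr (X \<mapsto> R(X, Y) Z)\<close>, which is positive on round spheres.\<close>

definition curvature ::
  "('m, 'n::finite) tensor2 \<Rightarrow> ('m, 'n) chart \<Rightarrow> 'n \<Rightarrow> 'n \<Rightarrow> 'n \<Rightarrow> 'n \<Rightarrow> 'm \<Rightarrow> real" where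
  "curvature g c l k i j p =
     coord_deriv c i (christoffel g c l j k) p - coord_deriv c j (christoffel g c l i k) p
     + (\<Sum>m\<in>UNIV. christoffel g c l i m p * christoffel g c m j k p
                   - christoffel g c l j m p * christoffel g c m i k p)"

definition ricci :: "('m, 'n::finite) tensor2 \<Rightarrow> ('m, 'n) tensor2" where
  "ricci g c p = (\<chi> j k. \<Sum>i\<in>UNIV. curvature g c i k i j p)"

definition metric_trace ::
  "('m, 'n::finite) chart set \<Rightarrow> ('m, 'n) tensor2 \<Rightarrow> ('m, 'n) tensor2 \<Rightarrow> 'm \<Rightarrow> real" where
  "metric_trace A g T = invariant_value A (\<lambda>c p. trace (matrix_inv (g c p) ** T c p))"

definition scalar_curvature ::
  "('m, 'n::finite) chart set \<Rightarrow> ('m, 'n) tensor2 \<Rightarrow> 'm \<Rightarrow> real" where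
  "scalar_curvature A g = metric_trace A g (ricci g)"

definition laplacian ::
  "('m, 'n::finite) chart set \<Rightarrow> ('m, 'n) tensor2 \<Rightarrow> ('m \<Rightarrow> real) \<Rightarrow> 'm \<Rightarrow> real" where
  "laplacian A g f = metric_trace A g (hessian g f)"

definition grad_norm_sq ::
  "('m, 'n::finite) chart set \<Rightarrow> ('m, 'n) tensor2 \<Rightarrow> ('m \<Rightarrow> real) \<Rightarrow> 'm \<Rightarrow> real" where
  "grad_norm_sq A g f =
     invariant_value A (\<lambda>c p. gradient g c f p \<bullet> (g c p *v gradient g c f p))"

text \<open>For an endomorphism field \<open>J\<close>, the entry \<open>J c p $ i $ j\<close> is \<open>J\<^sup>i\<^sub>j\<close>; the value
  below is the component \<open>(\<nabla>\<^sub>k J)\<^sup>i\<^sub>j\<close>.\<close>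

definition cov_deriv_endo ::
  "('m, 'n::finite) tensor2 \<Rightarrow> ('m, 'n) tensor2 \<Rightarrow> ('m, 'n) chart \<Rightarrow> 'n \<Rightarrow> 'n \<Rightarrow> 'n \<Rightarrow> 'm \<Rightarrow> real" where
  "cov_deriv_endo g J c k i j p =
     coord_deriv c k (\<lambda>q. J c q $ i $ j) p
     + (\<Sum>l\<in>UNIV. christoffel g c i k l p * (J c p $ l $ j)
                   - christoffel g c l k j p * (J c p $ i $ l))"

definition kaehler_manifold ::
  "('m::{t2_space, second_countable_topology}, 'n::finite) chart set \<Rightarrow>
   ('m, 'n) tensor2 \<Rightarrow> ('m, 'n) tensor2 \<Rightarrow> bool" where
  "kaehler_manifold A g J \<longleftrightarrow>
     smooth_manifold A \<and> riemannian_metric A g \<and>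
     smooth_tensor2 A J \<and> endomorphism_tensor A J \<and>
     (\<forall>c\<in>A. \<forall>p\<in>chart_dom c.
        J c p ** J c p = - mat 1 \<and>
        transpose (J c p) ** g c p ** J c p = g c p \<and>
        (\<forall>i j k. cov_deriv_endo g J c k i j p = 0))"


subsection \<open>The connection is torsion-free and metric\<close>

lemma coord_deriv_cong:
  assumes c: "is_chart c" and p: "p \<in> chart_dom c"
    and eq: "\<And>q. q \<in> chart_dom c \<Longrightarrow> f q = h q"
  shows "coord_deriv c i f p = coord_deriv c i h p"
proof -
  let ?S = "chart_map c ` chart_dom c"
  have S: "open ?S" "chart_map c p \<in> ?S"
    using c p by (auto simp: is_chart_def)
  have e: "(f \<circ> chart_inv c) x = (h \<circ> chart_inv c) x" if "x \<in> ?S" for x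
    using that eq by (simp add: chart_inv_def inv_into_into)
  have "((f \<circ> chart_inv c) has_derivative D) (at (chart_map c p)) \<longleftrightarrow>
        ((h \<circ> chart_inv c) has_derivative D) (at (chart_map c p))" for D
    using has_derivative_transform_within_open[OF _ S, of _ D UNIV] e
    by (metis (no_types, lifting))
  then show ?thesis
    by (simp add: coord_deriv_def frechet_derivative_def)
qed

context
  fixes A :: "('m::{t2_space, second_countable_topology}, 'n::finite) chart set"
    and g :: "('m, 'n) tensor2" and c p
  assumes A: "smooth_manifold A" and g: "riemannian_metric A g"
    and c: "c \<in> A" and p: "p \<in> chart_dom c"
begin

lemma metric_symmetric: "q \<in> chart_dom c \<Longrightarrow> g c q $ i $ j = g c q $ j $ i"
  using g c unfolding riemannian_metric_def transpose_def vec_eq_iff by simp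

lemma coord_deriv_metric_symmetric:
  "coord_deriv c k (\<lambda>q. g c q $ i $ j) p = coord_deriv c k (\<lambda>q. g c q $ j $ i) p"
  by (rule coord_deriv_cong) (use A c p metric_symmetric in \<open>auto simp: smooth_manifold_def\<close>)

lemma metric_inv: "g c p ** matrix_inv (g c p) = mat 1"
proof -
  have "v = 0" if "g c p *v v = 0" for v
    using g c p that unfolding riemannian_metric_def by force
  then have "invertible (g c p)"
    by (metis invertible_left_inverse matrix_left_invertible_ker)
  then show ?thesis
    unfolding invertible_def matrix_inv_def by (metis (mono_tags, lifting) someI_ex)
qed

lemma christoffel_symmetric: "christoffel g c k i j p = christoffel g c k j i p"
  unfolding christoffel_def by (subst coord_deriv_metric_symmetric[of _ i j]) (simp add: add.commute)

lemma christoffel_lowered: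
  "(\<Sum>k\<in>UNIV. g c p $ m $ k * christoffel g c k i j p) =
     (coord_deriv c i (\<lambda>q. g c q $ j $ m) p + coord_deriv c j (\<lambda>q. g c q $ i $ m) p
      - coord_deriv c m (\<lambda>q. g c q $ i $ j) p) / 2" (is "?L = ?w m / 2")
proof -
  have "?L = (\<Sum>k\<in>UNIV. \<Sum>l\<in>UNIV. g c p $ m $ k * matrix_inv (g c p) $ k $ l * ?w l) / 2"
    by (simp add: christoffel_def sum_divide_distrib sum_distrib_left mult.assoc)
  also have "\<dots> = (\<Sum>l\<in>UNIV. (g c p ** matrix_inv (g c p)) $ m $ l * ?w l) / 2"
    by (subst sum.swap) (simp add: matrix_matrix_mult_def sum_distrib_right)
  also have "\<dots> = ?w m / 2"
    by (simp add: metric_inv mat_def if_distrib[of "\<lambda>x. x * _"] cong: if_cong)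
  finally show ?thesis .
qed

lemma christoffel_metric:
  "coord_deriv c k (\<lambda>q. g c q $ i $ j) p =
     (\<Sum>l\<in>UNIV. christoffel g c l k i p * g c p $ l $ j + christoffel g c l k j p * g c p $ i $ l)"
proof -
  have "(\<Sum>l\<in>UNIV. christoffel g c l k i p * g c p $ l $ j) =
        (\<Sum>l\<in>UNIV. g c p $ j $ l * christoffel g c l k i p)"
    by (intro sum.cong) (simp_all add: metric_symmetric[OF p, of _ j] mult.commute)
  moreover have "(\<Sum>l\<in>UNIV. christoffel g c l k j p * g c p $ i $ l) =
        (\<Sum>l\<in>UNIV. g c p $ i $ l * christoffel g c l k j p)"
    by (simp add: mult.commute)
  ultimately show ?thesis
    unfolding sum.distrib
    by (simp only: christoffel_lowered)
       (simp add: coord_deriv_metric_symmetric[of _ j i] coord_deriv_metric_symmetric[of _ k i]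
          coord_deriv_metric_symmetric[of _ k j] add_divide_distrib diff_divide_distrib)
qed

end


section \<open>Functions built from \<open>\<alpha>\<close> and \<open>\<epsilon>\<close>\<close>

definition psi_of :: "real \<Rightarrow> (real \<Rightarrow> real) \<Rightarrow> real \<Rightarrow> real" where
  "psi_of \<epsilon> \<alpha> t = (if \<epsilon> \<noteq> 0 then (t - 2 / \<alpha> t) / (4 * \<epsilon>) else 2 / (3 * \<alpha> t ^ 3))"

definition F_of :: "real \<Rightarrow> (real \<Rightarrow> real) \<Rightarrow> real \<Rightarrow> real \<Rightarrow> real \<Rightarrow> real" where
  "F_of \<epsilon> \<alpha> \<theta> \<kappa> t =
     (if \<epsilon> \<noteq> 0 then (\<theta> * (2 - t * \<alpha> t) + 4 * \<epsilon> * \<kappa> * \<alpha> t) / (4 * \<epsilon>)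
      else \<kappa> * \<alpha> t - 2 * \<theta> / (3 * (\<alpha> t)\<^sup>2))"

definition affine_mod :: "real \<Rightarrow> real \<Rightarrow> (real \<Rightarrow> real) \<Rightarrow> real \<Rightarrow> real" where
  "affine_mod c p \<alpha> t = c * \<alpha> (c * t - c * p)"

text \<open>The five normal forms on a set \<open>T\<close> of values of the variable; where a denominator occurs,
  \<open>T\<close> has to avoid its zeros.\<close>

definition normal_form :: "real set \<Rightarrow> (real \<Rightarrow> real) \<Rightarrow> real \<Rightarrow> bool" where
  "normal_form T \<alpha> \<epsilon> \<longleftrightarrow>
     (\<epsilon> = 1 \<and> (\<forall>t\<in>T. \<alpha> t = 2)) \<or>
     (\<epsilon> = 0 \<and> (\<forall>t\<in>T. t \<noteq> 0 \<and> \<alpha> t = 2 / t)) \<or>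
     (\<epsilon> = 1 \<and> (\<forall>t\<in>T. \<alpha> t = 2 * tanh t)) \<or>
     (\<epsilon> = 1 \<and> (\<forall>t\<in>T. t \<noteq> 0 \<and> \<alpha> t = 2 * (cosh t / sinh t))) \<or>
     (\<epsilon> = -1 \<and> (\<forall>t\<in>T. sin t \<noteq> 0 \<and> \<alpha> t = 2 * cot t))"

end

theory Submission
  imports Defs
begin

text \<open>Write \<open>H\<close> for the Hessian of \<open>\<tau>\<close> and \<open>r\<close> for the Ricci tensor. Since \<open>r\<close> is Hermitian, so is \<open>H\<close>
  (where \<open>\<alpha> \<noteq> 0\<close>, hence everywhere), so \<open>\<nabla>\<tau>\<close> is holomorphic and \<open>2 r(\<nabla>\<tau>, \<cdot>) = - dY\<close>; as
  \<open>2 H(\<nabla>\<tau>, \<cdot>) = dQ\<close>, evaluating the equation on \<open>\<nabla>\<tau>\<close> gives \<open>2 \<sigma> d\<tau> = \<alpha> dQ - dY\<close>. Composed with \<open>J\<close>, the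
  tensors \<open>g\<close>, \<open>r\<close> and \<open>H\<close> become closed two-forms, so the exterior derivative of the equation,
  contracted with the Kaehler form, gives \<open>2 d\<sigma> = \<alpha>' (Y d\<tau> - dQ)\<close> in real dimension four. With
  \<open>F = Y - \<alpha> Q\<close> and \<open>F' = - (2 \<sigma> + \<alpha>' Q)\<close> these two relations say \<open>dF = F' d\<tau>\<close> and
  \<open>dF' = - (\<alpha>' F + (\<alpha>'' + \<alpha> \<alpha>') Q) d\<tau>\<close>. Closedness of the right-hand sides and \<open>dQ \<and> d\<tau> \<noteq> 0\<close> force
  \<open>\<alpha>'' + \<alpha> \<alpha>' = 0\<close>, and then \<open>\<theta>\<close> and \<open>\<kappa>\<close> are, up to constant factors, Wronskians of \<open>F\<close> with explicit
  solutions of \<open>F'' + \<alpha>' F = 0\<close>, hence constant.\<close>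

section \<open>Smooth functions\<close>

text \<open>The relation dF = F' d\<tau> alone does not make F a function of \<tau> on U, since a
  level set of \<tau> in U may be disconnected. The Wronskians repair this: they are constant on the
  connected set U, and two of them, taken against independent solutions, determine F and F' at a
  point from the value of \<tau> there. The independent pair is \<alpha> and 2 - \<tau>\<alpha>,
  with Wronskian -4\<epsilon>. At \<epsilon> = 0 it degenerates and 1/\<alpha>^2 replaces its second
  member; hence the case distinctions in \<psi> and F. A second obstacle is that Q and Y are defined
  at each point through an arbitrarily selected chart, so they can be differentiated only after a
  comparison of charts. The normal forms are 2u'/u for the solutions u of u'' = \<epsilon>u; density
  excludes \<alpha> = 0, which would otherwise occur for \<epsilon> = 0.\<close>

lemma differentiable_transform_open:
  fixes f g :: "'a::euclidean_space \<Rightarrow> 'b::real_normed_vector"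
  assumes "open S" "x \<in> S" "\<And>y. y \<in> S \<Longrightarrow> f y = g y"
  shows "f differentiable (at x) \<longleftrightarrow> g differentiable (at x)"
    and "frechet_derivative f (at x) = frechet_derivative g (at x)"
proof -
  have "(f has_derivative D) (at x) \<longleftrightarrow> (g has_derivative D) (at x)" for D
    using has_derivative_transform_within_open[OF _ assms(1,2), of _ D UNIV] assms(3)
    by (metis (no_types, lifting))
  then show "f differentiable (at x) \<longleftrightarrow> g differentiable (at x)"
    and "frechet_derivative f (at x) = frechet_derivative g (at x)"
    by (simp_all add: differentiable_def frechet_derivative_def)
qed

section \<open>Closure properties of smoothness of finite order\<close>

lemma k_smooth_on_cong:
  assumes "open S" "\<And>y. y \<in> S \<Longrightarrow> f y = g y"
  shows "k_smooth_on k S f \<longleftrightarrow> k_smooth_on k S g"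
  using assms(2)
proof (induction k arbitrary: f g)
  case 0
  then show ?case unfolding k_smooth_on.simps(1) by (intro continuous_on_cong) auto
next
  case (Suc k)
  note d = differentiable_transform_open[OF assms(1) _ Suc.prems]
  have "k_smooth_on k S (\<lambda>x. frechet_derivative f (at x) v)
    \<longleftrightarrow> k_smooth_on k S (\<lambda>x. frechet_derivative g (at x) v)" for v
    by (rule Suc.IH) (simp add: d)
  then show ?case by (simp add: d)
qed

lemma k_smooth_on_subset: "k_smooth_on k S f \<Longrightarrow> T \<subseteq> S \<Longrightarrow> k_smooth_on k T f"
proof (induction k arbitrary: f)
  case 0
  then show ?case using continuous_on_subset by simp
next
  case (Suc k)
  then show ?case unfolding k_smooth_on.simps(2) by blast
qed

text \<open>Level \<open>Suc k\<close> does not mention continuity of \<open>f\<close> itself; the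
  descent ends at differentiability, which implies continuity.\<close>

lemma k_smooth_on_SucD: "k_smooth_on (Suc k) S f \<Longrightarrow> k_smooth_on k S f"
proof (induction k arbitrary: f)
  case 0
  then show ?case
    by (simp add: continuous_at_imp_continuous_on differentiable_imp_continuous_within)
next
  case (Suc k)
  from Suc.prems have "\<forall>x\<in>S. f differentiable (at x)"
    and "\<And>v. k_smooth_on (Suc k) S (\<lambda>x. frechet_derivative f (at x) v)"
    by (simp_all only: k_smooth_on.simps(2)) blast+
  with Suc.IH show ?case by (simp only: k_smooth_on.simps(2)) blast
qed

lemma k_smooth_on_const: "k_smooth_on k S (\<lambda>_. c)"
proof (induction k arbitrary: c)
  case (Suc k)
  have "frechet_derivative (\<lambda>_. c) (at x) = (\<lambda>_. 0)" for x :: 'a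
    by (rule frechet_derivative_const)
  with Suc show ?case by simp
qed simp

lemma k_smooth_on_id: "k_smooth_on k S (\<lambda>x. x)"
  by (cases k) (simp_all add: frechet_derivative_ident k_smooth_on_const)

lemma k_smooth_on_add:
  assumes "open S" "k_smooth_on k S f" "k_smooth_on k S g"
  shows "k_smooth_on k S (\<lambda>x. f x + g x)"
  using assms(2,3)
proof (induction k arbitrary: f g)
  case (Suc k)
  have d: "((\<lambda>x. f x + g x) has_derivative
       (\<lambda>v. frechet_derivative f (at x) v + frechet_derivative g (at x) v)) (at x)"
    if "x \<in> S" for x
    using that Suc.prems by (auto intro!: has_derivative_add simp: frechet_derivative_works)
  have "k_smooth_on k S (\<lambda>x. frechet_derivative (\<lambda>x. f x + g x) (at x) v)" for v
    by (subst k_smooth_on_cong[OF assms(1), where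
          g = "\<lambda>x. frechet_derivative f (at x) v + frechet_derivative g (at x) v"])
      (use Suc in \<open>auto simp: frechet_derivative_at[OF d, symmetric]\<close>)
  with differentiableI[OF d] show ?case by simp
qed (simp add: continuous_on_add)

lemma k_smooth_on_linear:
  assumes "open S" "k_smooth_on k S f" "bounded_linear L"
  shows "k_smooth_on k S (\<lambda>x. L (f x))"
  using assms(2)
proof (induction k arbitrary: f)
  case 0
  then show ?case using assms(3) by (simp add: bounded_linear.continuous_on)
next
  case (Suc k)
  have d: "((\<lambda>x. L (f x)) has_derivative (\<lambda>v. L (frechet_derivative f (at x) v))) (at x)"
    if "x \<in> S" for x
    using that Suc.prems by (auto intro!: bounded_linear.has_derivative[OF assms(3)]
        simp: frechet_derivative_works)
  have "k_smooth_on k S (\<lambda>x. frechet_derivative (\<lambda>x. L (f x)) (at x) v)" for v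
    by (subst k_smooth_on_cong[OF assms(1), where
          g = "\<lambda>x. L (frechet_derivative f (at x) v)"])
      (use Suc in \<open>auto simp: frechet_derivative_at[OF d, symmetric]\<close>)
  with differentiableI[OF d] show ?case by simp
qed

text \<open>The product rule keeps one factor undifferentiated, so the induction step also uses both
  factors at the lower level, which is what \<open>k_smooth_on_SucD\<close> supplies.\<close>

lemma k_smooth_on_mult:
  fixes f g :: "'a::euclidean_space \<Rightarrow> real"
  assumes "open S" "k_smooth_on k S f" "k_smooth_on k S g"
  shows "k_smooth_on k S (\<lambda>x. f x * g x)"
  using assms(2,3)
proof (induction k arbitrary: f g)
  case (Suc k)
  have d: "((\<lambda>x. f x * g x) has_derivative
       (\<lambda>v. f x * frechet_derivative g (at x) v + frechet_derivative f (at x) v * g x)) (at x)"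
    if "x \<in> S" for x
    using that Suc.prems by (auto intro!: has_derivative_mult simp: frechet_derivative_works)
  have "k_smooth_on k S (\<lambda>x. frechet_derivative (\<lambda>x. f x * g x) (at x) v)" for v
    by (subst k_smooth_on_cong[OF assms(1), where
          g = "\<lambda>x. f x * frechet_derivative g (at x) v + frechet_derivative f (at x) v * g x"])
      (use Suc.prems Suc.prems[THEN k_smooth_on_SucD] in \<open>auto simp: frechet_derivative_at[OF d, symmetric]
        intro!: k_smooth_on_add[OF assms(1)] Suc.IH\<close>)
  with differentiableI[OF d] show ?case by simp
qed (simp add: continuous_on_mult)

text \<open>The derivative of 1/f is built from f' and 1/f, and 1/f is already smooth of the lower
  order by induction, so \<open>f\<close> stays fixed.\<close>

lemma k_smooth_on_inverse:
  fixes f :: "'a::euclidean_space \<Rightarrow> real"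
  assumes "open S" "k_smooth_on k S f" "\<And>x. x \<in> S \<Longrightarrow> f x \<noteq> 0"
  shows "k_smooth_on k S (\<lambda>x. inverse (f x))"
  using assms(2)
proof (induction k)
  case 0
  then show ?case using assms(3) by (simp add: continuous_on_inverse)
next
  case (Suc k)
  have d: "((\<lambda>x. inverse (f x)) has_derivative
       (\<lambda>v. - (inverse (f x) * frechet_derivative f (at x) v * inverse (f x)))) (at x)"
    if "x \<in> S" for x
    using that Suc.prems assms(3) by (auto intro!: has_derivative_inverse simp: frechet_derivative_works)
  have i: "k_smooth_on k S (\<lambda>x. inverse (f x))"
    using Suc.IH k_smooth_on_SucD[OF Suc.prems] .
  have "k_smooth_on k S (\<lambda>x. - (inverse (f x) * frechet_derivative f (at x) v * inverse (f x)))" for v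
    by (rule k_smooth_on_linear[OF assms(1) _ bounded_linear_minus[OF bounded_linear_ident]],
        intro k_smooth_on_mult[OF assms(1)] i) (use Suc.prems in simp)
  then have "k_smooth_on k S (\<lambda>x. frechet_derivative (\<lambda>x. inverse (f x)) (at x) v)" for v
    by (subst k_smooth_on_cong[OF assms(1)]) (auto simp: frechet_derivative_at[OF d, symmetric])
  with differentiableI[OF d] show ?case by simp
qed

lemma frechet_derivative_real:
  fixes \<alpha> :: "real \<Rightarrow> real"
  assumes "\<alpha> differentiable (at t)"
  shows "frechet_derivative \<alpha> (at t) v = deriv \<alpha> t * v"
  using assms by (metis DERIV_deriv_iff_real_differentiable frechet_derivative_at
      has_field_derivative_def)

lemma k_smooth_on_deriv:
  fixes \<alpha> :: "real \<Rightarrow> real"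
  assumes "open I" "k_smooth_on (Suc k) I \<alpha>"
  shows "k_smooth_on k I (deriv \<alpha>)"
proof -
  have "k_smooth_on k I (\<lambda>t. frechet_derivative \<alpha> (at t) 1)"
    using assms(2) by simp
  then show ?thesis
    by (subst k_smooth_on_cong[OF assms(1), where g = "\<lambda>t. frechet_derivative \<alpha> (at t) 1"])
      (use assms(2) in \<open>auto simp: frechet_derivative_real\<close>)
qed

text \<open>The chain rule replaces \<alpha> by its derivative and leaves the inner function alone;
  hence the induction varies \<alpha> only.\<close>

lemma k_smooth_on_compose:
  fixes \<alpha> :: "real \<Rightarrow> real" and f :: "'a::euclidean_space \<Rightarrow> real"
  assumes "open S" "open I" "f ` S \<subseteq> I" "k_smooth_on k S f" "k_smooth_on k I \<alpha>"
  shows "k_smooth_on k S (\<lambda>x. \<alpha> (f x))"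
  using assms(4,5)
proof (induction k arbitrary: \<alpha>)
  case 0
  then show ?case
    using assms(3) continuous_on_compose2[of I \<alpha> S f] by simp
next
  case (Suc k)
  have d: "((\<lambda>x. \<alpha> (f x)) has_derivative
       (\<lambda>v. deriv \<alpha> (f x) * frechet_derivative f (at x) v)) (at x)"
    if "x \<in> S" for x
  proof -
    have "(f has_derivative frechet_derivative f (at x)) (at x)"
      using Suc.prems that by (simp add: frechet_derivative_works[symmetric])
    moreover have "(\<alpha> has_derivative (\<lambda>v. deriv \<alpha> (f x) * v)) (at (f x))"
    proof -
      have "\<alpha> differentiable (at (f x))" using Suc.prems that assms(3) by auto
      then show ?thesis
        by (simp add: DERIV_deriv_iff_real_differentiable[symmetric] has_field_derivative_def)
    qed
    ultimately show ?thesis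
      by (rule has_derivative_compose)
  qed
  have "k_smooth_on k S (\<lambda>x. deriv \<alpha> (f x) * frechet_derivative f (at x) v)" for v
  proof (rule k_smooth_on_mult[OF assms(1)])
    show "k_smooth_on k S (\<lambda>x. deriv \<alpha> (f x))"
      by (rule Suc.IH[OF k_smooth_on_SucD[OF Suc.prems(1)] k_smooth_on_deriv[OF assms(2) Suc.prems(2)]])
    show "k_smooth_on k S (\<lambda>x. frechet_derivative f (at x) v)"
      using Suc.prems(1) by simp
  qed
  then have "k_smooth_on k S (\<lambda>x. frechet_derivative (\<lambda>x. \<alpha> (f x)) (at x) v)" for v
    by (subst k_smooth_on_cong[OF assms(1)]) (auto simp: frechet_derivative_at[OF d, symmetric])
  with differentiableI[OF d] show ?case by simp
qed

lemma smooth_on_imp_differentiable: "smooth_on S f \<Longrightarrow> x \<in> S \<Longrightarrow> f differentiable (at x)"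
  by (auto simp: smooth_on_def dest!: spec[of _ "Suc 0"])

lemma smooth_on_imp_continuous_on: "smooth_on S f \<Longrightarrow> continuous_on S f"
  by (auto simp: smooth_on_def dest!: spec[of _ 0])

lemma smooth_on_frechet_derivative:
  assumes "smooth_on S f"
  shows "smooth_on S (\<lambda>x. frechet_derivative f (at x) v)"
  unfolding smooth_on_def
proof
  fix k
  have "k_smooth_on (Suc k) S f" using assms by (simp only: smooth_on_def)
  then show "k_smooth_on k S (\<lambda>x. frechet_derivative f (at x) v)" by simp
qed

lemma smooth_on_deriv:
  fixes \<alpha> :: "real \<Rightarrow> real"
  assumes "open I" "smooth_on I \<alpha>"
  shows "smooth_on I (deriv \<alpha>)"
  using assms k_smooth_on_deriv[OF assms(1)] by (simp only: smooth_on_def) blast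

lemma DERIV_smooth_on:
  fixes \<alpha> :: "real \<Rightarrow> real"
  shows "smooth_on I \<alpha> \<Longrightarrow> t \<in> I \<Longrightarrow> (\<alpha> has_real_derivative deriv \<alpha> t) (at t)"
  using smooth_on_imp_differentiable[of I \<alpha> t] DERIV_deriv_iff_real_differentiable[of \<alpha> t] by simp

section \<open>Symmetry of second derivatives\<close>

lemma has_derivative_line_real:
  fixes f :: "'a::euclidean_space \<Rightarrow> real"
  assumes "f differentiable (at (y + s *\<^sub>R u))"
  shows "((\<lambda>s. f (y + s *\<^sub>R u)) has_real_derivative
    frechet_derivative f (at (y + s *\<^sub>R u)) u) (at s)"
proof -
  have "(f has_derivative frechet_derivative f (at (y + s *\<^sub>R u))) (at (y + s *\<^sub>R u))"
    using assms by (simp add: frechet_derivative_works[symmetric])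
  moreover have "((\<lambda>s. y + s *\<^sub>R u) has_derivative (\<lambda>r. r *\<^sub>R u)) (at s)"
    by (auto intro!: derivative_eq_intros)
  ultimately have d: "((\<lambda>s. f (y + s *\<^sub>R u)) has_derivative
      (\<lambda>r. frechet_derivative f (at (y + s *\<^sub>R u)) (r *\<^sub>R u))) (at s)"
    by (rule has_derivative_compose[rotated])
  have "linear (frechet_derivative f (at (y + s *\<^sub>R u)))"
    using assms linear_frechet_derivative by blast
  then have "frechet_derivative f (at (y + s *\<^sub>R u)) (r *\<^sub>R u) =
      frechet_derivative f (at (y + s *\<^sub>R u)) u * r" for r
    by (simp add: linear_cmul mult.commute)
  with d show ?thesis by (simp add: has_field_derivative_def)
qed

text \<open>The mean value theorem, applied once in each direction, expresses the mixed second difference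
  of \<open>f\<close> as a value of the iterated derivative near \<open>x\<close>; the difference is symmetric in \<open>u\<close> and \<open>v\<close>.\<close>

lemma mixed_difference:
  fixes f :: "'a::euclidean_space \<Rightarrow> real"
  assumes f: "\<And>y. y \<in> ball x r \<Longrightarrow> f differentiable (at y)"
    and f': "\<And>y. y \<in> ball x r \<Longrightarrow> (\<lambda>y. frechet_derivative f (at y) u) differentiable (at y)"
    and h: "0 < h" "h * (norm u + norm v) < r"
  obtains y where "dist x y \<le> h * (norm u + norm v)"
    "f (x + h *\<^sub>R u + h *\<^sub>R v) - f (x + h *\<^sub>R u) - f (x + h *\<^sub>R v) + f x =
      h * h * frechet_derivative (\<lambda>y. frechet_derivative f (at y) u) (at y) v"
proof -
  have d: "dist x (x + s *\<^sub>R u + t *\<^sub>R v) \<le> h * (norm u + norm v)"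
    if "0 \<le> s" "s \<le> h" "0 \<le> t" "t \<le> h" for s t
  proof -
    have "norm (s *\<^sub>R u + t *\<^sub>R v) \<le> h * norm u + h * norm v"
      using that by (intro norm_triangle_mono) (auto intro!: mult_right_mono)
    moreover have "dist x (x + s *\<^sub>R u + t *\<^sub>R v) = norm (s *\<^sub>R u + t *\<^sub>R v)"
      by (metis add.assoc add_diff_cancel_left' dist_commute dist_norm)
    ultimately show ?thesis by (simp add: algebra_simps)
  qed
  then have b: "x + s *\<^sub>R u + t *\<^sub>R v \<in> ball x r" if "0 \<le> s" "s \<le> h" "0 \<le> t" "t \<le> h" for s t
    using that h(2) by (force simp: mem_ball)
  let ?u = "\<lambda>y. frechet_derivative f (at y) u"
  have "((\<lambda>s. f (x + h *\<^sub>R v + s *\<^sub>R u) - f (x + s *\<^sub>R u)) has_real_derivative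
      ?u (x + h *\<^sub>R v + s *\<^sub>R u) - ?u (x + s *\<^sub>R u)) (at s)" if "0 \<le> s" "s \<le> h" for s
  proof (intro DERIV_diff has_derivative_line_real f)
    show "x + h *\<^sub>R v + s *\<^sub>R u \<in> ball x r" using b[OF that, of h] h(1) by (simp add: ac_simps)
    show "x + s *\<^sub>R u \<in> ball x r" using b[OF that, of 0] h(1) by simp
  qed
  from MVT2[OF h(1) this] obtain s where s: "0 < s" "s < h"
    "f (x + h *\<^sub>R v + h *\<^sub>R u) - f (x + h *\<^sub>R u) - (f (x + h *\<^sub>R v) - f x) =
      h * (?u (x + h *\<^sub>R v + s *\<^sub>R u) - ?u (x + s *\<^sub>R u))"
    by auto
  have "((\<lambda>t. ?u (x + s *\<^sub>R u + t *\<^sub>R v)) has_real_derivative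
      frechet_derivative ?u (at (x + s *\<^sub>R u + t *\<^sub>R v)) v) (at t)" if "0 \<le> t" "t \<le> h" for t
    using b[of s t] that s by (intro has_derivative_line_real f') auto
  from MVT2[OF h(1) this] obtain t where t: "0 < t" "t < h"
    "?u (x + s *\<^sub>R u + h *\<^sub>R v) - ?u (x + s *\<^sub>R u) = h * frechet_derivative ?u (at (x + s *\<^sub>R u + t *\<^sub>R v)) v"
    by auto
  show thesis
  proof
    show "dist x (x + s *\<^sub>R u + t *\<^sub>R v) \<le> h * (norm u + norm v)"
      using d s t by simp
    show "f (x + h *\<^sub>R u + h *\<^sub>R v) - f (x + h *\<^sub>R u) - f (x + h *\<^sub>R v) + f x =
      h * h * frechet_derivative ?u (at (x + s *\<^sub>R u + t *\<^sub>R v)) v"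
      using s(3) t(3) by (simp add: ac_simps)
  qed
qed

lemma frechet_derivative_commute:
  fixes f :: "'a::euclidean_space \<Rightarrow> real"
  assumes "open S" "k_smooth_on 2 S f" "x \<in> S"
  shows "frechet_derivative (\<lambda>y. frechet_derivative f (at y) u) (at x) v =
         frechet_derivative (\<lambda>y. frechet_derivative f (at y) v) (at x) u"
proof -
  obtain r where r: "r > 0" "ball x r \<subseteq> S"
    using assms(1,3) openE by blast
  define A where "A u v y = frechet_derivative (\<lambda>y. frechet_derivative f (at y) u) (at y) v" for u v y
  have f: "\<And>y. y \<in> ball x r \<Longrightarrow> f differentiable (at y)"
    "\<And>y u. y \<in> ball x r \<Longrightarrow> (\<lambda>y. frechet_derivative f (at y) u) differentiable (at y)"
    and cont: "\<And>u v. continuous_on S (A u v)"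
    using assms(2) r(2) by (auto simp: numeral_2_eq_2 A_def[abs_def])
  \<comment> \<open>The summand 1 keeps the divisor \<open>K\<close> positive when u and v both
    vanish.\<close>
  define K where "K = norm u + norm v + 1"
  have K: "K > 0" by (simp add: K_def add_nonneg_pos)
  have "\<bar>A u v x - A v u x\<bar> \<le> e" if e: "e > 0" for e
  proof -
    have cc: "isCont (A u v) x" "isCont (A v u) x"
      using cont assms(1,3) continuous_on_eq_continuous_at by blast+
    obtain d1 where d1: "d1 > 0" "\<And>y. dist y x < d1 \<Longrightarrow> dist (A u v y) (A u v x) < e / 2"
      using cc(1) half_gt_zero[OF e] unfolding continuous_at_eps_delta by blast
    obtain d2 where d2: "d2 > 0" "\<And>y. dist y x < d2 \<Longrightarrow> dist (A v u y) (A v u x) < e / 2"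
      using cc(2) half_gt_zero[OF e] unfolding continuous_at_eps_delta by blast
    note d = d1 d2
    \<comment> \<open>So small that both intermediate points lie in the neighbourhoods given by
      continuity; the factor 2 makes the bound strict.\<close>
    define h where "h = min r (min d1 d2) / (2 * K)"
    have h: "h > 0" using r d K by (simp add: h_def)
    have hK: "h * (norm u + norm v) < min r (min d1 d2)"
    proof -
      have "h * (norm u + norm v) \<le> h * K" using h by (simp add: K_def)
      also have "\<dots> = min r (min d1 d2) / 2" using K by (simp add: h_def)
      also have "\<dots> < min r (min d1 d2)" using r d by auto
      finally show ?thesis .
    qed
    have hr: "h * (norm u + norm v) < r" "h * (norm v + norm u) < r"
      using hK by (simp_all add: add.commute)
    obtain y where y: "dist x y \<le> h * (norm u + norm v)"
      "f (x + h *\<^sub>R u + h *\<^sub>R v) - f (x + h *\<^sub>R u) - f (x + h *\<^sub>R v) + f x = h * h * A u v y"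
      using mixed_difference[OF f h hr(1)] unfolding A_def by blast
    obtain z where z: "dist x z \<le> h * (norm v + norm u)"
      "f (x + h *\<^sub>R v + h *\<^sub>R u) - f (x + h *\<^sub>R v) - f (x + h *\<^sub>R u) + f x = h * h * A v u z"
      using mixed_difference[OF f h hr(2)] unfolding A_def by blast
    have "f (x + h *\<^sub>R u + h *\<^sub>R v) = f (x + h *\<^sub>R v + h *\<^sub>R u)"
      by (simp add: ac_simps)
    with y(2) z(2) have "h * h * A u v y = h * h * A v u z"
      by linarith
    then have "A u v y = A v u z" using h by simp
    moreover have "dist y x < d1" "dist z x < d2"
      using y(1) z(1) hK by (auto simp: dist_commute add.commute)
    then have "dist (A u v y) (A u v x) < e / 2" "dist (A v u z) (A v u x) < e / 2"
      using d(2,4) by blast+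
    ultimately show ?thesis unfolding dist_real_def by linarith
  qed
  then have "A u v x = A v u x"
    by (metis abs_le_zero_iff eq_iff_diff_eq_0 field_le_epsilon add_0)
  then show ?thesis by (simp add: A_def)
qed

section \<open>Calculus in a chart\<close>

lemma chart_inv_chart_map: "is_chart c \<Longrightarrow> p \<in> chart_dom c \<Longrightarrow> chart_inv c (chart_map c p) = p"
  by (simp add: is_chart_def homeomorphism_def)

text \<open>The region is kept apart from the chart domain because it will be the part of U inside a
  chart, or the overlap of two charts.\<close>

locale chart_region =
  fixes c :: "('m::topological_space, 'n::finite) chart" and W :: "'m set"
  assumes chart: "is_chart c" and open_region: "open W" and region: "W \<subseteq> chart_dom c"
begin

abbreviation D :: "'n \<Rightarrow> ('m \<Rightarrow> real) \<Rightarrow> 'm \<Rightarrow> real" where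
  "D \<equiv> coord_deriv c"

definition sm :: "('m \<Rightarrow> real) \<Rightarrow> bool" where
  "sm f \<longleftrightarrow> smooth_on (chart_map c ` W) (f \<circ> chart_inv c)"

lemma inv_map [simp]: "p \<in> W \<Longrightarrow> chart_inv c (chart_map c p) = p"
  using chart_inv_chart_map chart region by blast

lemma open_image: "open (chart_map c ` W)"
proof -
  have h: "homeomorphism (chart_dom c) (chart_map c ` chart_dom c) (chart_map c) (chart_inv c)"
    and o: "open (chart_map c ` chart_dom c)"
    using chart by (simp_all add: is_chart_def)
  have "openin (top_of_set (chart_dom c)) W"
    using open_region region by (simp add: open_subset)
  with h have "openin (top_of_set (chart_map c ` chart_dom c)) (chart_map c ` W)"
    by (rule homeomorphism_imp_open_map)
  with o show ?thesis by (simp add: openin_open_eq)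
qed

lemma D_cong:
  assumes "\<And>q. q \<in> W \<Longrightarrow> f q = h q" "p \<in> W"
  shows "D i f p = D i h p"
proof -
  have "frechet_derivative (f \<circ> chart_inv c) (at (chart_map c p)) =
      frechet_derivative (h \<circ> chart_inv c) (at (chart_map c p))"
    by (rule differentiable_transform_open(2)[OF open_image]) (use assms in auto)
  then show ?thesis by (simp add: coord_deriv_def)
qed

lemma sm_cong:
  assumes "\<And>q. q \<in> W \<Longrightarrow> f q = h q"
  shows "sm f \<longleftrightarrow> sm h"
  unfolding sm_def smooth_on_def
  by (intro all_cong1 k_smooth_on_cong[OF open_image]) (use assms in auto)

lemma pullback_has_derivative:
  assumes "sm f" "p \<in> W"
  shows "((f \<circ> chart_inv c) has_derivative
    frechet_derivative (f \<circ> chart_inv c) (at (chart_map c p))) (at (chart_map c p))"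
  using smooth_on_imp_differentiable assms
  unfolding sm_def frechet_derivative_works[symmetric] by blast

lemma D_eqI:
  assumes "((f \<circ> chart_inv c) has_derivative F) (at (chart_map c p))"
  shows "D i f p = F (axis i 1)"
  unfolding coord_deriv_def by (simp add: frechet_derivative_at[OF assms, symmetric])

lemma frechet_eq_sum_D:
  assumes "sm f" "p \<in> W"
  shows "frechet_derivative (f \<circ> chart_inv c) (at (chart_map c p)) v = (\<Sum>i\<in>UNIV. v $ i * D i f p)"
proof -
  let ?F = "frechet_derivative (f \<circ> chart_inv c) (at (chart_map c p))"
  have l: "linear ?F"
    using pullback_has_derivative[OF assms] has_derivative_linear by blast
  have "?F v = ?F (\<Sum>i\<in>UNIV. v $ i *\<^sub>R axis i 1)"
    by (simp add: basis_expansion scalar_mult_eq_scaleR[symmetric])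
  also have "\<dots> = (\<Sum>i\<in>UNIV. v $ i * ?F (axis i 1))"
    by (simp add: linear_sum[OF l] linear_cmul[OF l])
  finally show ?thesis by (simp add: coord_deriv_def)
qed

lemma sm_continuous_on:
  assumes "sm f" shows "continuous_on W f"
proof -
  have "continuous_on W (chart_map c)"
    using chart region by (auto simp: is_chart_def homeomorphism_def intro: continuous_on_subset)
  moreover have "continuous_on (chart_map c ` W) (f \<circ> chart_inv c)"
    using assms smooth_on_imp_continuous_on unfolding sm_def by blast
  ultimately have "continuous_on W ((f \<circ> chart_inv c) \<circ> chart_map c)"
    by (rule continuous_on_compose)
  then show ?thesis by (rule continuous_on_eq) simp
qed

lemma sm_const: "sm (\<lambda>_. a)"
  unfolding sm_def smooth_on_def comp_def by (simp add: k_smooth_on_const)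

lemma sm_add: "sm f \<Longrightarrow> sm h \<Longrightarrow> sm (\<lambda>p. f p + h p)"
  unfolding sm_def smooth_on_def comp_def by (simp add: k_smooth_on_add open_image)

lemma sm_mult: "sm f \<Longrightarrow> sm h \<Longrightarrow> sm (\<lambda>p. f p * h p)"
  unfolding sm_def smooth_on_def comp_def by (simp add: k_smooth_on_mult open_image)

lemma sm_uminus: "sm f \<Longrightarrow> sm (\<lambda>p. - f p)"
  using sm_mult[OF sm_const[of "-1"], of f] by simp

lemma sm_diff: "sm f \<Longrightarrow> sm h \<Longrightarrow> sm (\<lambda>p. f p - h p)"
  using sm_add[of f "\<lambda>p. - h p"] sm_uminus[of h] by simp

lemma sm_sum: "(\<And>k. k \<in> K \<Longrightarrow> sm (f k)) \<Longrightarrow> sm (\<lambda>p. \<Sum>k\<in>K. f k p)"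
  by (induction K rule: infinite_finite_induct) (auto simp: sm_const intro: sm_add)

lemma sm_prod: "(\<And>k. k \<in> K \<Longrightarrow> sm (f k)) \<Longrightarrow> sm (\<lambda>p. \<Prod>k\<in>K. f k p)"
  by (induction K rule: infinite_finite_induct) (auto simp: sm_const intro: sm_mult)

lemma sm_divide:
  assumes "sm f" "sm h" "\<And>p. p \<in> W \<Longrightarrow> h p \<noteq> 0"
  shows "sm (\<lambda>p. f p / h p)"
proof -
  have "sm (\<lambda>p. inverse (h p))"
    using assms(2,3) unfolding sm_def smooth_on_def comp_def
    by (auto intro!: k_smooth_on_inverse open_image)
  from sm_mult[OF assms(1) this] show ?thesis by (simp add: divide_inverse)
qed

lemma sm_compose:
  assumes "smooth_on I \<alpha>" "open I" "f ` W \<subseteq> I" "sm f"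
  shows "sm (\<lambda>p. \<alpha> (f p))"
  unfolding sm_def smooth_on_def comp_def
proof
  fix k
  show "k_smooth_on k (chart_map c ` W) (\<lambda>x. \<alpha> (f (chart_inv c x)))"
    by (rule k_smooth_on_compose[OF open_image assms(2)])
      (use assms(1,3,4) in \<open>auto simp: sm_def smooth_on_def comp_def\<close>)
qed

lemma sm_D: assumes "sm f" shows "sm (D i f)"
proof -
  have "k_smooth_on k (chart_map c ` W) (D i f \<circ> chart_inv c)" for k
  proof -
    have "k_smooth_on k (chart_map c ` W) (\<lambda>x. frechet_derivative (f \<circ> chart_inv c) (at x) (axis i 1))"
      using smooth_on_frechet_derivative assms unfolding sm_def smooth_on_def by blast
    then show ?thesis
      by (subst k_smooth_on_cong[OF open_image]) (auto simp: coord_deriv_def)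
  qed
  then show ?thesis by (simp add: sm_def smooth_on_def)
qed

lemma D_const: "D i (\<lambda>_. a) p = 0"
  by (simp add: coord_deriv_def comp_def)

lemma D_add: "sm f \<Longrightarrow> sm h \<Longrightarrow> p \<in> W \<Longrightarrow> D i (\<lambda>p. f p + h p) p = D i f p + D i h p"
  using D_eqI[of "\<lambda>p. f p + h p", unfolded comp_def, OF has_derivative_add[OF
      pullback_has_derivative[unfolded comp_def] pullback_has_derivative[unfolded comp_def]]]
  by (simp add: comp_def coord_deriv_def)

lemma D_mult:
  assumes "sm f" "sm h" "p \<in> W"
  shows "D i (\<lambda>p. f p * h p) p = D i f p * h p + f p * D i h p"
  using D_eqI[of "\<lambda>p. f p * h p", unfolded comp_def, OF has_derivative_mult[OF
      pullback_has_derivative[OF assms(1,3), unfolded comp_def]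
      pullback_has_derivative[OF assms(2,3), unfolded comp_def]]] assms(3)
  by (simp add: comp_def coord_deriv_def)

lemma D_uminus: "sm f \<Longrightarrow> p \<in> W \<Longrightarrow> D i (\<lambda>p. - f p) p = - D i f p"
  using D_mult[OF sm_const[of "-1"], of f p i] by (simp add: D_const)

lemma D_diff: "sm f \<Longrightarrow> sm h \<Longrightarrow> p \<in> W \<Longrightarrow> D i (\<lambda>p. f p - h p) p = D i f p - D i h p"
  using D_add[of f "\<lambda>p. - h p" p i] sm_uminus[of h] by (simp add: D_uminus)

lemma D_sum:
  assumes "\<And>k. k \<in> K \<Longrightarrow> sm (f k)" "p \<in> W"
  shows "D i (\<lambda>p. \<Sum>k\<in>K. f k p) p = (\<Sum>k\<in>K. D i (f k) p)"
  using assms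
  by (induction K rule: infinite_finite_induct) (simp_all add: D_const D_add sm_sum)

lemma D_compose:
  assumes "\<alpha> differentiable (at (f p))" "sm f" "p \<in> W"
  shows "D i (\<lambda>p. \<alpha> (f p)) p = deriv \<alpha> (f p) * D i f p"
proof -
  have "(\<alpha> has_derivative (\<lambda>v. deriv \<alpha> (f p) * v)) (at ((f \<circ> chart_inv c) (chart_map c p)))"
    using assms(1,3) by (simp add: DERIV_deriv_iff_real_differentiable[symmetric] has_field_derivative_def)
  from has_derivative_compose[OF pullback_has_derivative[OF assms(2,3)] this]
  have "((\<lambda>p. \<alpha> (f p)) \<circ> chart_inv c has_derivative
    (\<lambda>v. deriv \<alpha> (f p) * frechet_derivative (f \<circ> chart_inv c) (at (chart_map c p)) v)) (at (chart_map c p))"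
    by (simp add: comp_def)
  from D_eqI[OF this] show ?thesis by (simp add: coord_deriv_def)
qed

lemma D_commute:
  assumes "sm f" "p \<in> W"
  shows "D i (D j f) p = D j (D i f) p"
proof -
  let ?f = "f \<circ> chart_inv c" and ?x = "chart_map c p"
  have *: "D i (D j f) p = frechet_derivative (\<lambda>y. frechet_derivative ?f (at y) (axis j 1)) (at ?x) (axis i 1)" for i j
  proof -
    have "frechet_derivative (D j f \<circ> chart_inv c) (at ?x) =
      frechet_derivative (\<lambda>y. frechet_derivative ?f (at y) (axis j 1)) (at ?x)"
      by (rule differentiable_transform_open(2)[OF open_image]) (use assms(2) in \<open>auto simp: coord_deriv_def\<close>)
    then show ?thesis by (simp add: coord_deriv_def)
  qed
  show ?thesis
    unfolding *[of i j] *[of j i]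
    by (rule frechet_derivative_commute[OF open_image]) (use assms in \<open>auto simp: sm_def smooth_on_def\<close>)
qed

text \<open>The coordinate functions are the test functions on which the Hessians in two charts are
  compared.\<close>

lemma sm_coordinate: "sm (\<lambda>q. chart_map c q $ k)"
proof -
  have "k_smooth_on n (chart_map c ` W) (\<lambda>x. x $ k)" for n
    using k_smooth_on_linear[OF open_image k_smooth_on_id bounded_linear_vec_nth] .
  then show ?thesis
    unfolding sm_def smooth_on_def
    by (subst k_smooth_on_cong[OF open_image, where g = "\<lambda>x. x $ k"]) auto
qed

lemma D_coordinate: assumes "p \<in> W" shows "D i (\<lambda>q. chart_map c q $ k) p = (if i = k then 1 else 0)"
proof -
  have "((\<lambda>x::real^'n. x $ k) has_derivative (\<lambda>x. x $ k)) (at (chart_map c p))"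
    by (simp add: bounded_linear_imp_has_derivative bounded_linear_vec_nth)
  then have "(((\<lambda>q. chart_map c q $ k) \<circ> chart_inv c) has_derivative (\<lambda>x. x $ k)) (at (chart_map c p))"
    by (rule has_derivative_transform_within_open[OF _ open_image]) (use assms in auto)
  from D_eqI[OF this] show ?thesis by (simp add: axis_def)
qed

lemmas sm_intros = sm_const sm_add sm_mult sm_uminus sm_diff sm_sum sm_D

section \<open>Entrywise calculus of matrix- and vector-valued functions\<close>

definition smM :: "('m \<Rightarrow> real^'k^'l) \<Rightarrow> bool" where
  "smM T \<longleftrightarrow> (\<forall>a b. sm (\<lambda>p. T p $ a $ b))"

definition DM :: "'n \<Rightarrow> ('m \<Rightarrow> real^'k^'l) \<Rightarrow> 'm \<Rightarrow> real^'k^'l" where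
  "DM i T p = (\<chi> a b. D i (\<lambda>q. T q $ a $ b) p)"

definition smV :: "('m \<Rightarrow> real^'k) \<Rightarrow> bool" where
  "smV v \<longleftrightarrow> (\<forall>a. sm (\<lambda>p. v p $ a))"

definition DV :: "'n \<Rightarrow> ('m \<Rightarrow> real^'k) \<Rightarrow> 'm \<Rightarrow> real^'k" where
  "DV i v p = (\<chi> a. D i (\<lambda>q. v q $ a) p)"

lemma smM_mult: "smM S \<Longrightarrow> smM T \<Longrightarrow> smM (\<lambda>p. S p ** T p)"
  by (auto simp: smM_def matrix_matrix_mult_def intro!: sm_intros)

lemma smM_add: "smM S \<Longrightarrow> smM T \<Longrightarrow> smM (\<lambda>p. S p + T p)"
  by (auto simp: smM_def intro!: sm_intros)

lemma smM_diff: "smM S \<Longrightarrow> smM T \<Longrightarrow> smM (\<lambda>p. S p - T p)"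
  by (auto simp: smM_def intro!: sm_intros)

lemma smM_transpose: "smM S \<Longrightarrow> smM (\<lambda>p. transpose (S p))"
  by (auto simp: smM_def transpose_def)

lemma smM_DM: "smM S \<Longrightarrow> smM (DM i S)"
  by (auto simp: smM_def DM_def intro!: sm_intros)

lemmas smM_intros = smM_mult smM_add smM_diff smM_transpose smM_DM

lemma smV_mult: "smM S \<Longrightarrow> smV v \<Longrightarrow> smV (\<lambda>p. S p *v v p)"
  by (auto simp: smM_def smV_def matrix_vector_mult_def intro!: sm_intros)

lemma smV_add: "smV v \<Longrightarrow> smV w \<Longrightarrow> smV (\<lambda>p. v p + w p)"
  by (auto simp: smV_def intro!: sm_intros)

lemma smV_DV: "smV v \<Longrightarrow> smV (DV i v)"
  by (auto simp: smV_def DV_def intro!: sm_intros)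

lemmas smV_intros = smV_mult smV_add smV_DV

lemma sm_trace: "smM T \<Longrightarrow> sm (\<lambda>p. trace (T p))"
  by (auto simp: smM_def trace_def intro!: sm_intros)

lemma sm_inner: "smV v \<Longrightarrow> smV w \<Longrightarrow> sm (\<lambda>p. v p \<bullet> w p)"
  by (auto simp: smV_def inner_vec_def intro!: sm_intros)

lemma DM_cong:
  assumes "\<And>q. q \<in> W \<Longrightarrow> S q = T q" "p \<in> W"
  shows "DM i S p = DM i T p"
  by (simp add: DM_def vec_eq_iff) (intro allI D_cong, use assms in auto)

lemma DV_cong:
  assumes "\<And>q. q \<in> W \<Longrightarrow> v q = w q" "p \<in> W"
  shows "DV i v p = DV i w p"
  by (simp add: DV_def vec_eq_iff) (intro allI D_cong, use assms in auto)

lemma DM_add: "smM S \<Longrightarrow> smM T \<Longrightarrow> p \<in> W \<Longrightarrow> DM i (\<lambda>p. S p + T p) p = DM i S p + DM i T p"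
  by (simp add: smM_def DM_def D_add vec_eq_iff)

lemma DM_diff: "smM S \<Longrightarrow> smM T \<Longrightarrow> p \<in> W \<Longrightarrow> DM i (\<lambda>p. S p - T p) p = DM i S p - DM i T p"
  by (simp add: smM_def DM_def D_diff vec_eq_iff)

lemma DM_mult:
  "smM S \<Longrightarrow> smM T \<Longrightarrow> p \<in> W \<Longrightarrow> DM i (\<lambda>p. S p ** T p) p = DM i S p ** T p + S p ** DM i T p"
  by (simp add: smM_def DM_def matrix_matrix_mult_def D_sum D_mult sm_mult sum.distrib vec_eq_iff)

lemma DM_transpose: "DM i (\<lambda>p. transpose (S p)) p = transpose (DM i S p)"
  by (simp add: DM_def transpose_def)

lemma DM_commute: "smM S \<Longrightarrow> p \<in> W \<Longrightarrow> DM i (DM j S) p = DM j (DM i S) p"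
  by (simp add: DM_def smM_def D_commute)

lemma DV_add: "smV v \<Longrightarrow> smV w \<Longrightarrow> p \<in> W \<Longrightarrow> DV i (\<lambda>p. v p + w p) p = DV i v p + DV i w p"
  by (simp add: smV_def DV_def D_add vec_eq_iff)

lemma DV_mult:
  "smM S \<Longrightarrow> smV v \<Longrightarrow> p \<in> W \<Longrightarrow> DV i (\<lambda>p. S p *v v p) p = DM i S p *v v p + S p *v DV i v p"
  by (simp add: smM_def smV_def DM_def DV_def matrix_vector_mult_def D_sum D_mult sm_mult sum.distrib vec_eq_iff)

lemma DV_commute: "smV v \<Longrightarrow> p \<in> W \<Longrightarrow> DV i (DV j v) p = DV j (DV i v) p"
  by (simp add: DV_def smV_def D_commute)

lemma D_trace: "smM T \<Longrightarrow> p \<in> W \<Longrightarrow> D i (\<lambda>p. trace (T p)) p = trace (DM i T p)"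
  by (simp add: smM_def DM_def trace_def D_sum)

lemma D_inner:
  "smV v \<Longrightarrow> smV w \<Longrightarrow> p \<in> W \<Longrightarrow> D i (\<lambda>p. v p \<bullet> w p) p = DV i v p \<bullet> w p + v p \<bullet> DV i w p"
  by (simp add: smV_def DV_def inner_vec_def D_sum D_mult sm_mult sum.distrib)

end

section \<open>Riemannian metrics in a chart\<close>

lemma matrix_distribs:
  fixes A B C :: "real^'n^'n"
  shows "A ** (B + C) = A ** B + A ** C" "(A + B) ** C = A ** C + B ** C"
    "A ** (B - C) = A ** B - A ** C" "(A - B) ** C = A ** C - B ** C"
    "(- A) ** B = - (A ** B)" "A ** (- B) = - (A ** B)"
  by (simp_all add: vec_eq_iff matrix_matrix_mult_def algebra_simps sum.distrib sum_subtractf sum_negf)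

lemma transpose_distribs:
  fixes A B :: "real^'n^'m"
  shows "transpose (A + B) = transpose A + transpose B" "transpose (A - B) = transpose A - transpose B"
    "transpose (- A) = - transpose A"
  by (simp_all add: vec_eq_iff transpose_def)

lemma trace_transpose: "trace (transpose A) = trace A"
  by (simp add: trace_def transpose_def)

lemma trace_uminus: "trace (- A) = - trace (A :: real^'n^'n)"
  by (simp add: trace_def sum_negf)

lemma inner_matrix_vector: "x \<bullet> (A *v y) = (transpose A *v x) \<bullet> (y :: real^'n)"
  by (simp add: dot_lmul_matrix)

lemma trace_sym_skew:
  fixes A B :: "real^'n^'n"
  assumes "transpose A = - A" "transpose B = B"
  shows "trace (A ** B) = 0"
proof -
  have "trace (A ** B) = trace (transpose (A ** B))" by (simp add: trace_transpose)
  also have "\<dots> = - trace (A ** B)"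
    by (simp add: matrix_transpose_mul assms matrix_distribs trace_uminus trace_mul_sym[of B A])
  finally show ?thesis by simp
qed

lemma (in chart_region) sm_det:
  fixes T :: "'m \<Rightarrow> real^'k^'k"
  assumes "smM T"
  shows "sm (\<lambda>p. det (T p))"
  unfolding det_def using assms by (auto simp: smM_def intro!: sm_sum sm_mult sm_const sm_prod)

text \<open>By Cramer's rule the entries of the inverse are quotients of determinants, which are
  polynomials in smooth entries.\<close>

lemma (in chart_region) smM_matrix_inverse:
  fixes S T :: "'m \<Rightarrow> real^'k^'k"
  assumes S: "smM S" and ST: "\<And>p. p \<in> W \<Longrightarrow> S p ** T p = mat 1"
  shows "smM T"
proof -
  have d: "det (S p) \<noteq> 0" if "p \<in> W" for p
    using arg_cong[OF ST[OF that], of det] by (auto simp: det_mul)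
  have "T p $ a $ b = det (\<chi> i j. if j = a then axis b 1 $ i else S p $ i $ j) / det (S p)"
    if "p \<in> W" for p a b
  proof -
    have "S p *v (T p *v axis b 1) = axis b 1"
      by (simp add: matrix_vector_mul_assoc ST[OF that])
    then have "T p *v axis b 1 = (\<chi> k. det (\<chi> i j. if j = k then axis b 1 $ i else S p $ i $ j) / det (S p))"
      using cramer[OF d[OF that]] by blast
    then show ?thesis
      by (simp add: vec_eq_iff matrix_vector_mult_basis column_def)
  qed
  moreover have "sm (\<lambda>p. det (\<chi> i j. if j = a then axis b 1 $ i else S p $ i $ j) / det (S p))" for a b :: 'k
  proof (rule sm_divide[OF sm_det sm_det d])
    show "smM (\<lambda>p. \<chi> i j. if j = a then axis b 1 $ i else S p $ i $ j)"
      unfolding smM_def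
    proof (intro allI)
      fix i j
      show "sm (\<lambda>p. (\<chi> i j. if j = a then axis b 1 $ i else S p $ i $ j) $ i $ j)"
        using S by (cases "j = a") (auto simp: smM_def sm_const)
    qed
  qed (use S in auto)
  ultimately show ?thesis
    unfolding smM_def by (metis (no_types, lifting) sm_cong)
qed

locale riemannian_region =
  fixes A :: "('m::{t2_space, second_countable_topology}, 'n::finite) chart set"
    and g :: "('m, 'n) tensor2" and c :: "('m, 'n) chart" and W :: "'m set"
  assumes manifold: "smooth_manifold A" and metric: "riemannian_metric A g"
    and chart_in: "c \<in> A" and open_W: "open W" and W_sub: "W \<subseteq> chart_dom c"

sublocale riemannian_region \<subseteq> chart_region c W
  using manifold chart_in open_W W_sub by unfold_locales (auto simp: smooth_manifold_def)

context riemannian_region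
begin

text \<open>In one fixed chart everything becomes a matrix whose row is the upper index:
  \<open>\<Gamma> i\<close> is the difference between \<nabla> and the partial derivative in
  direction i, and \<open>R i j\<close> is the curvature endomorphism. Tensor identities then become
  identities between matrix products.\<close>

definition G :: "'m \<Rightarrow> real^'n^'n" where "G p = g c p"
definition Gi :: "'m \<Rightarrow> real^'n^'n" where "Gi p = matrix_inv (g c p)"
definition \<Gamma> :: "'n \<Rightarrow> 'm \<Rightarrow> real^'n^'n" where "\<Gamma> i p = (\<chi> k j. christoffel g c k i j p)"
definition R :: "'n \<Rightarrow> 'n \<Rightarrow> 'm \<Rightarrow> real^'n^'n" where "R i j p = (\<chi> l k. curvature g c l k i j p)"
definition Ric :: "'m \<Rightarrow> real^'n^'n" where "Ric p = ricci g c p"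

lemma sm_chart_imp: "smooth_in_chart c f \<Longrightarrow> sm f"
  unfolding smooth_in_chart_def sm_def smooth_on_def
  by (intro allI, rule k_smooth_on_subset[OF _ image_mono[OF W_sub]]) blast

lemma smM_tensor: "smooth_tensor2 A T \<Longrightarrow> smM (T c)"
  using chart_in by (auto simp: smooth_tensor2_def smM_def intro: sm_chart_imp)

lemma smM_G: "smM G"
  using metric smM_tensor[of g] by (simp add: G_def[abs_def] riemannian_metric_def)

lemma G_sym: "p \<in> W \<Longrightarrow> transpose (G p) = G p"
  using metric chart_in W_sub by (auto simp: riemannian_metric_def G_def)

lemma G_Gi: "p \<in> W \<Longrightarrow> G p ** Gi p = mat 1"
  using metric_inv[OF manifold metric chart_in] W_sub by (auto simp: G_def Gi_def)

lemma Gi_G: "p \<in> W \<Longrightarrow> Gi p ** G p = mat 1"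
  using G_Gi matrix_left_right_inverse by blast

lemma Gi_sym: assumes "p \<in> W" shows "transpose (Gi p) = Gi p"
proof -
  have "transpose (Gi p) ** G p = mat 1"
    using G_Gi[OF assms] G_sym[OF assms] by (metis matrix_transpose_mul transpose_mat)
  then show ?thesis
    by (metis G_Gi assms matrix_mul_assoc matrix_mul_lid matrix_mul_rid)
qed

lemma smM_Gi: "smM Gi"
  by (rule smM_matrix_inverse[OF smM_G G_Gi])

lemma sm_metric: "sm (\<lambda>p. g c p $ a $ b)"
  using smM_G by (simp add: smM_def G_def)

lemma smM_\<Gamma>: "smM (\<Gamma> i)"
  unfolding smM_def \<Gamma>_def christoffel_def vec_lambda_beta
  by (intro allI sm_divide sm_intros sm_metric)
    (use smM_Gi in \<open>auto simp: smM_def Gi_def\<close>)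

lemma \<Gamma>_sym: "p \<in> W \<Longrightarrow> \<Gamma> i p $ k $ j = \<Gamma> j p $ k $ i"
  using christoffel_symmetric[OF manifold metric chart_in, of p] W_sub by (auto simp: \<Gamma>_def)

lemma DM_G: "p \<in> W \<Longrightarrow> DM i G p = transpose (\<Gamma> i p) ** G p + G p ** \<Gamma> i p"
  using christoffel_metric[OF manifold metric chart_in, of p] W_sub
  by (simp add: vec_eq_iff DM_def G_def \<Gamma>_def transpose_def matrix_matrix_mult_def sum.distrib subset_iff
      mult.commute)

lemma R_eq: "R i j p = DM i (\<Gamma> j) p - DM j (\<Gamma> i) p + \<Gamma> i p ** \<Gamma> j p - \<Gamma> j p ** \<Gamma> i p"
  by (simp add: vec_eq_iff R_def curvature_def DM_def \<Gamma>_def matrix_matrix_mult_def sum_subtractf)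

lemma smM_R: "smM (R i j)"
  by (simp add: R_eq[abs_def] smM_intros smM_\<Gamma>)

lemma Ric_eq: "Ric p $ j $ k = (\<Sum>i\<in>UNIV. R i j p $ i $ k)"
  by (simp add: Ric_def ricci_def R_def)

lemma smM_Ric: "smM Ric"
  using smM_R by (simp add: smM_def Ric_eq sm_sum)

section \<open>Symmetries of the curvature tensor\<close>

lemma R_swap: "R j i p = - R i j p"
  by (simp add: R_eq)

text \<open>The connection is torsion-free: symmetry of \<Gamma> in its lower indices cancels
  derivative terms and products in pairs over the cyclic sum.\<close>

lemma first_bianchi:
  assumes "p \<in> W"
  shows "R i j p $ l $ k + R j k p $ l $ i + R k i p $ l $ j = 0"
proof -
  have "DM i (\<Gamma> j) p $ l $ k = DM i (\<Gamma> k) p $ l $ j" for i j k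
    by (simp add: DM_def) (rule D_cong, simp_all add: assms \<Gamma>_sym[of _ j])
  moreover have "(\<Gamma> i p ** \<Gamma> j p) $ l $ k = (\<Gamma> i p ** \<Gamma> k p) $ l $ j" for i j k
    by (simp add: matrix_matrix_mult_def \<Gamma>_sym[OF assms, of j])
  ultimately show ?thesis
    by (simp add: R_eq)
qed

text \<open>The metric is parallel, so its second partial derivatives can be written through
  \<Gamma>; that they commute says that the curvature acts trivially on G.\<close>

lemma G_R_skew:
  assumes "p \<in> W"
  shows "transpose (G p ** R i j p) = - (G p ** R i j p)"
proof -
  have 1: "DM i (DM j G) p =
     transpose (DM i (\<Gamma> j) p) ** G p + transpose (\<Gamma> j p) ** (transpose (\<Gamma> i p) ** G p + G p ** \<Gamma> i p)
     + ((transpose (\<Gamma> i p) ** G p + G p ** \<Gamma> i p) ** \<Gamma> j p + G p ** DM i (\<Gamma> j) p)" for i j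
  proof -
    have "DM i (DM j G) p = DM i (\<lambda>q. transpose (\<Gamma> j q) ** G q + G q ** \<Gamma> j q) p"
      by (rule DM_cong) (simp_all add: DM_G assms)
    then show ?thesis
      by (simp add: DM_add DM_mult smM_intros smM_\<Gamma> smM_G assms DM_transpose DM_G)
  qed
  have "DM i (DM j G) p = DM j (DM i G) p"
    by (rule DM_commute[OF smM_G assms])
  then show ?thesis
    unfolding 1 R_eq
    by (simp add: matrix_transpose_mul G_sym assms transpose_distribs matrix_distribs matrix_mul_assoc algebra_simps)
qed

text \<open>Each bracket is a covariant derivative of the curvature in which only the endomorphism
  indices are corrected. The corrections for the two form indices would cancel in the cyclic sum
  because \<Gamma> is symmetric.\<close>

lemma second_bianchi:
  assumes "p \<in> W"
  shows "(DM k (R i j) p + \<Gamma> k p ** R i j p - R i j p ** \<Gamma> k p) +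
         (DM i (R j k) p + \<Gamma> i p ** R j k p - R j k p ** \<Gamma> i p) +
         (DM j (R k i) p + \<Gamma> j p ** R k i p - R k i p ** \<Gamma> j p) = 0"
proof -
  have "DM k (R i j) p = DM k (DM i (\<Gamma> j)) p - DM k (DM j (\<Gamma> i)) p
     + (DM k (\<Gamma> i) p ** \<Gamma> j p + \<Gamma> i p ** DM k (\<Gamma> j) p)
     - (DM k (\<Gamma> j) p ** \<Gamma> i p + \<Gamma> j p ** DM k (\<Gamma> i) p)" for i j k
    by (simp add: R_eq[abs_def] DM_add DM_diff DM_mult smM_intros smM_\<Gamma> assms)
  moreover have "DM k (DM i (\<Gamma> j)) p = DM i (DM k (\<Gamma> j)) p" "DM k (DM j (\<Gamma> i)) p = DM j (DM k (\<Gamma> i)) p"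
    "DM i (DM j (\<Gamma> k)) p = DM j (DM i (\<Gamma> k)) p"
    by (rule DM_commute[OF smM_\<Gamma> assms])+
  ultimately show ?thesis
    by (simp add: R_eq matrix_distribs matrix_mul_assoc)
qed

text \<open>Half the sum of two cyclically shifted first Bianchi identities minus half the sum of
  the other two; skewness within each pair of indices cancels the remaining terms.\<close>

lemma pair_symmetry:
  assumes "p \<in> W"
  shows "(G p ** R i j p) $ l $ k = (G p ** R k l p) $ j $ i"
proof -
  define r where "r i j k l = (G p ** R i j p) $ l $ k" for i j k l
  have sw: "r j i k l = - r i j k l" for i j k l
    by (simp add: r_def R_swap[of j i] matrix_distribs)
  have sk: "r i j l k = - r i j k l" for i j k l
    using arg_cong[OF G_R_skew[OF assms, of i j], of "\<lambda>M. M $ k $ l"]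
    by (simp add: r_def transpose_def)
  have cy: "r i j k l + r j k i l + r k i j l = 0" for i j k l
  proof -
    have "r i j k l + r j k i l + r k i j l =
        (\<Sum>m\<in>UNIV. G p $ l $ m * (R i j p $ m $ k + R j k p $ m $ i + R k i p $ m $ j))"
      by (simp add: r_def matrix_matrix_mult_def sum.distrib algebra_simps)
    then show ?thesis by (simp add: first_bianchi[OF assms])
  qed
  have "r i j k l = r k l i j"
    using cy[of i j k l] cy[of j k l i] cy[of k l i j] cy[of l i j k]
      sk[of j k i l] sk[of k l i j] sw[of l j k i] sk[of j l k i] sw[of l i k j] sk[of i l j k]
      sw[of i k l j] sk[of k i j l] sw[of l i j k] sk[of i j k l]
    by linarith
  then show ?thesis by (simp add: r_def)
qed

section \<open>Gradient and Hessian\<close>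

definition grad :: "('m \<Rightarrow> real) \<Rightarrow> 'm \<Rightarrow> real^'n" where "grad f p = gradient g c f p"
definition df :: "('m \<Rightarrow> real) \<Rightarrow> 'm \<Rightarrow> real^'n" where "df f p = differential c f p"
definition H :: "('m \<Rightarrow> real) \<Rightarrow> 'm \<Rightarrow> real^'n^'n" where "H f p = hessian g f c p"
text \<open>The Hessian as the endomorphism sending v to the covariant derivative of the gradient
  along v; see \<open>nabla_grad\<close>.\<close>

definition S :: "('m \<Rightarrow> real) \<Rightarrow> 'm \<Rightarrow> real^'n^'n" where "S f p = Gi p ** H f p"
text \<open>The polarization of Q. Two different arguments are needed in the Koszul-type formula
  that compares Hessians in two charts.\<close>

definition B :: "('m \<Rightarrow> real) \<Rightarrow> ('m \<Rightarrow> real) \<Rightarrow> 'm \<Rightarrow> real" where "B f h p = grad f p \<bullet> (G p *v grad h p)"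

lemma df_nth [simp]: "df f p $ i = D i f p"
  by (simp add: df_def differential_def)

lemma grad_eq: "grad f p = Gi p *v df f p"
  by (simp add: grad_def gradient_def Gi_def df_def)

lemma G_grad: "p \<in> W \<Longrightarrow> G p *v grad f p = df f p"
  by (simp add: grad_eq matrix_vector_mul_assoc G_Gi)

lemma smV_df: "sm f \<Longrightarrow> smV (df f)"
  by (simp add: smV_def sm_D)

lemma smV_grad: "sm f \<Longrightarrow> smV (grad f)"
  by (simp add: grad_eq[abs_def] smV_mult smM_Gi smV_df)

lemma sm_B: "sm f \<Longrightarrow> sm h \<Longrightarrow> sm (B f h)"
  by (simp add: B_def[abs_def] sm_inner smV_grad smV_mult smM_G)

lemma H_nth: "H f p $ i $ j = D i (D j f) p - (\<Sum>k\<in>UNIV. \<Gamma> i p $ k $ j * D k f p)"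
  by (simp add: H_def hessian_def \<Gamma>_def)

lemma H_row: "H f p $ i = DV i (df f) p - transpose (\<Gamma> i p) *v df f p"
  by (simp add: vec_eq_iff H_nth DV_def matrix_vector_mult_def transpose_def del: transpose_matrix_vector)

lemma smM_H: "sm f \<Longrightarrow> smM (H f)"
  unfolding smM_def H_nth by (intro allI sm_intros) (use smM_\<Gamma> in \<open>auto simp: smM_def\<close>)

lemma smM_S: "sm f \<Longrightarrow> smM (S f)"
  by (simp add: S_def[abs_def] smM_intros smM_Gi smM_H)

lemma H_sym: "sm f \<Longrightarrow> p \<in> W \<Longrightarrow> transpose (H f p) = H f p"
  by (simp add: vec_eq_iff transpose_def H_nth D_commute \<Gamma>_sym)

lemma G_S: "p \<in> W \<Longrightarrow> G p ** S f p = H f p"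
  by (simp add: S_def matrix_mul_assoc G_Gi)

text \<open>Differentiate \<open>G grad f = df\<close>: of the two Christoffel terms in the
  derivative of G, one completes the covariant derivative of the gradient, the other that of
  df.\<close>

lemma G_nabla_grad:
  assumes "sm f" "p \<in> W"
  shows "G p *v (DV i (grad f) p + \<Gamma> i p *v grad f p) = H f p $ i"
proof -
  have "DV i (df f) p = DV i (\<lambda>q. G q *v grad f q) p"
    by (rule DV_cong) (simp_all add: G_grad assms)
  also have "\<dots> = DM i G p *v grad f p + G p *v DV i (grad f) p"
    by (rule DV_mult) (use assms smM_G smV_grad in auto)
  also have "\<dots> = transpose (\<Gamma> i p) *v df f p + G p *v (DV i (grad f) p + \<Gamma> i p *v grad f p)"
    by (simp add: DM_G assms algebra_simps matrix_vector_mul_assoc[symmetric] G_grad del: transpose_matrix_vector)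
  finally show ?thesis by (simp add: H_row)
qed

lemma nabla_grad:
  assumes "sm f" "p \<in> W"
  shows "DV i (grad f) p + \<Gamma> i p *v grad f p = S f p *v axis i 1"
proof -
  have "DV i (grad f) p + \<Gamma> i p *v grad f p = Gi p *v (G p *v (DV i (grad f) p + \<Gamma> i p *v grad f p))"
    by (simp add: matrix_vector_mul_assoc Gi_G assms)
  also have "\<dots> = Gi p *v (H f p $ i)" by (simp add: G_nabla_grad assms)
  also have "H f p $ i = H f p *v axis i 1"
    using H_sym[OF assms] by (simp add: vec_eq_iff transpose_def matrix_vector_mult_basis column_def)
  finally show ?thesis by (simp add: S_def matrix_vector_mul_assoc)
qed

lemma D_B:
  assumes "sm f" "sm h" "p \<in> W"
  shows "D i (B f h) p = (H f p *v grad h p + H h p *v grad f p) $ i"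
proof -
  let ?v = "grad f p" and ?w = "grad h p"
  have s: "H f p $ i = H f p *v axis i 1" if "sm f" for f
    using H_sym[OF that assms(3)] by (simp add: vec_eq_iff transpose_def matrix_vector_mult_basis column_def)
  have "D i (B f h) p = DV i (grad f) p \<bullet> (G p *v ?w) + ?v \<bullet> (DM i G p *v ?w + G p *v DV i (grad h) p)"
    unfolding B_def[abs_def]
    by (simp add: D_inner DV_mult assms smV_grad smV_mult smM_G)
  also have "\<dots> = (DV i (grad f) p + \<Gamma> i p *v ?v) \<bullet> (G p *v ?w)
      + ?v \<bullet> (G p *v (DV i (grad h) p + \<Gamma> i p *v ?w))"
    by (simp add: DM_G assms algebra_simps inner_add_left inner_add_right matrix_vector_mul_assoc[symmetric]
        inner_matrix_vector[of ?v "transpose (\<Gamma> i p)"] del: transpose_matrix_vector)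
  also have "\<dots> = (H f p $ i) \<bullet> ?w + ?v \<bullet> (H h p $ i)"
    by (simp add: G_nabla_grad assms inner_matrix_vector G_sym del: transpose_matrix_vector)
  also have "\<dots> = (H f p *v ?w + H h p *v ?v) $ i"
    by (simp add: matrix_vector_mul_component inner_commute)
  finally show ?thesis .
qed

end

section \<open>Kaehler metrics in a chart\<close>

lemma sum_rotate: "(\<Sum>a\<in>A. \<Sum>b\<in>B. \<Sum>m\<in>C. X a b m) = (\<Sum>m\<in>C. \<Sum>a\<in>A. \<Sum>b\<in>B. X a b m)"
proof -
  have "(\<Sum>a\<in>A. \<Sum>b\<in>B. \<Sum>m\<in>C. X a b m) = (\<Sum>a\<in>A. \<Sum>m\<in>C. \<Sum>b\<in>B. X a b m)"
    by (intro sum.cong refl sum.swap)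
  also have "\<dots> = (\<Sum>m\<in>C. \<Sum>a\<in>A. \<Sum>b\<in>B. X a b m)" by (rule sum.swap)
  finally show ?thesis .
qed

lemma sum_reverse: "(\<Sum>a\<in>A. \<Sum>b\<in>B. \<Sum>m\<in>C. X a b m) = (\<Sum>m\<in>C. \<Sum>b\<in>B. \<Sum>a\<in>A. X a b m)"
  by (rule trans[OF sum_rotate]) (intro sum.cong refl sum.swap)

locale kaehler_region = riemannian_region A g c W
  for A :: "('m::{t2_space, second_countable_topology}, 'n::finite) chart set" and g c W +
  fixes Jt :: "('m, 'n) tensor2"
  assumes kaehler: "kaehler_manifold A g Jt"
begin

definition J :: "'m \<Rightarrow> real^'n^'n" where "J p = Jt c p"

lemma smM_J: "smM J"
proof -
  have "smooth_tensor2 A Jt" using kaehler unfolding kaehler_manifold_def by blast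
  then have "smM (Jt c)" by (rule smM_tensor)
  then show ?thesis unfolding J_def[abs_def] .
qed

lemma kaehlerD:
  assumes "p \<in> W"
  shows "J p ** J p = - mat 1 \<and> transpose (J p) ** G p ** J p = G p \<and>
    (\<forall>i j k. cov_deriv_endo g Jt c k i j p = 0)"
proof -
  have "p \<in> chart_dom c" using assms W_sub by blast
  then show ?thesis
    using kaehler chart_in unfolding kaehler_manifold_def J_def G_def by blast
qed

lemma J_J: "p \<in> W \<Longrightarrow> J p ** J p = - mat 1"
  using kaehlerD by blast

lemma J_J': "p \<in> W \<Longrightarrow> (M :: real^'n^'n) ** J p ** J p = - M"
  by (simp add: matrix_mul_assoc[symmetric] J_J matrix_distribs)

lemma J_G_J: "p \<in> W \<Longrightarrow> transpose (J p) ** G p ** J p = G p"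
  using kaehlerD by blast

text \<open>Multiply the hypothesis by J on the right. For symmetric M the conclusion says that
  \<open>M ** J\<close> is skew, hence a two-form; this is used for the metric, the Ricci tensor and
  the Hessian.\<close>

lemma JT_hermitian:
  assumes "p \<in> W" "transpose (J p) ** M ** J p = M"
  shows "transpose (J p) ** M = - (M ** J p)"
proof -
  have "- (transpose (J p) ** M) = M ** J p"
    by (simp only: J_J'[OF assms(1), symmetric] assms(2))
  from arg_cong[OF this, of uminus] show ?thesis by simp
qed

lemma JT_G: "p \<in> W \<Longrightarrow> transpose (J p) ** G p = - (G p ** J p)"
  by (simp add: JT_hermitian J_G_J)

lemma DM_J:
  assumes "p \<in> W" shows "DM k J p = J p ** \<Gamma> k p - \<Gamma> k p ** J p"
proof -
  have "cov_deriv_endo g Jt c k i j p = 0" for i j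
    using kaehlerD[OF assms] by blast
  then have "DM k J p $ i $ j + (\<Gamma> k p ** J p - J p ** \<Gamma> k p) $ i $ j = 0" for i j
    by (simp add: cov_deriv_endo_def DM_def J_def \<Gamma>_def matrix_matrix_mult_def sum_subtractf mult.commute)
  then show ?thesis by (simp add: vec_eq_iff algebra_simps)
qed

text \<open>As in \<open>G_R_skew\<close>, but for the parallel field J: its second derivatives
  commute, so the curvature acts trivially on it.\<close>

lemma R_J:
  assumes "p \<in> W"
  shows "R i j p ** J p = J p ** R i j p"
proof -
  have 1: "DM i (DM j J) p =
     (J p ** \<Gamma> i p - \<Gamma> i p ** J p) ** \<Gamma> j p + J p ** DM i (\<Gamma> j) p
     - (DM i (\<Gamma> j) p ** J p + \<Gamma> j p ** (J p ** \<Gamma> i p - \<Gamma> i p ** J p))" for i j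
  proof -
    have "DM i (DM j J) p = DM i (\<lambda>q. J q ** \<Gamma> j q - \<Gamma> j q ** J q) p"
      by (rule DM_cong) (simp_all add: DM_J assms)
    then show ?thesis
      by (simp add: DM_diff DM_mult smM_intros smM_\<Gamma> smM_J assms DM_J)
  qed
  have "DM i (DM j J) p = DM j (DM i J) p"
    by (rule DM_commute[OF smM_J assms])
  then show ?thesis
    unfolding 1 R_eq
    by (simp add: matrix_distribs matrix_mul_assoc algebra_simps)
qed

text \<open>Pair symmetry turns the form indices into endomorphism indices, where invariance follows
  from \<open>R_J\<close> and J being an isometry.\<close>

lemma G_R_JJ:
  assumes "p \<in> W"
  shows "(\<Sum>a\<in>UNIV. \<Sum>b\<in>UNIV. J p $ a $ i * J p $ b $ j * (G p ** R a b p) $ l $ k) = (G p ** R i j p) $ l $ k"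
proof -
  have "(\<Sum>a\<in>UNIV. \<Sum>b\<in>UNIV. J p $ a $ i * J p $ b $ j * (G p ** R a b p) $ l $ k) =
      (\<Sum>a\<in>UNIV. \<Sum>b\<in>UNIV. J p $ a $ i * J p $ b $ j * (G p ** R k l p) $ b $ a)"
    using pair_symmetry[OF assms] by simp
  also have "\<dots> = (transpose (J p) ** (G p ** R k l p) ** J p) $ j $ i"
    by (simp add: matrix_matrix_mult_def transpose_def sum_distrib_left sum_distrib_right ac_simps)
  also have "transpose (J p) ** (G p ** R k l p) ** J p = transpose (J p) ** G p ** J p ** R k l p"
    by (simp add: R_J assms matrix_mul_assoc[symmetric])
  also have "\<dots> = G p ** R k l p" by (simp add: J_G_J assms)
  finally show ?thesis by (simp add: pair_symmetry[OF assms, of k l])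
qed

lemma R_JJ:
  assumes "p \<in> W"
  shows "(\<Sum>a\<in>UNIV. \<Sum>b\<in>UNIV. J p $ a $ i * J p $ b $ j * R a b p $ l $ k) = R i j p $ l $ k"
proof -
  have R: "R a b p $ l $ k = (\<Sum>m\<in>UNIV. Gi p $ l $ m * (G p ** R a b p) $ m $ k)" for a b
  proof -
    have "R a b p = Gi p ** (G p ** R a b p)" by (simp add: matrix_mul_assoc Gi_G assms)
    then have "R a b p $ l $ k = (Gi p ** (G p ** R a b p)) $ l $ k" by (rule arg_cong)
    also have "\<dots> = (\<Sum>m\<in>UNIV. Gi p $ l $ m * (G p ** R a b p) $ m $ k)"
      by (simp only: matrix_matrix_mult_def[of "Gi p"] vec_lambda_beta)
    finally show ?thesis .
  qed
  have "(\<Sum>a\<in>UNIV. \<Sum>b\<in>UNIV. J p $ a $ i * J p $ b $ j * R a b p $ l $ k) =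
    (\<Sum>a\<in>UNIV. \<Sum>b\<in>UNIV. \<Sum>m\<in>UNIV. Gi p $ l $ m * (J p $ a $ i * J p $ b $ j * (G p ** R a b p) $ m $ k))"
    unfolding R by (simp add: sum_distrib_left ac_simps)
  also have "\<dots> = (\<Sum>m\<in>UNIV. Gi p $ l $ m *
      (\<Sum>a\<in>UNIV. \<Sum>b\<in>UNIV. J p $ a $ i * J p $ b $ j * (G p ** R a b p) $ m $ k))"
    unfolding sum_distrib_left by (rule sum_rotate)
  also have "\<dots> = R i j p $ l $ k"
    unfolding G_R_JJ[OF assms] R ..
  finally show ?thesis .
qed

text \<open>r(JY, JZ) is the trace of X \<mapsto> R(X, JY) JZ = J R(X, JY) Z. Moving J around the
  trace puts it on X, and R(JX, JY) = R(X, Y).\<close>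

lemma Ric_hermitian:
  assumes "p \<in> W"
  shows "transpose (J p) ** Ric p ** J p = Ric p"
proof -
  have "(transpose (J p) ** Ric p ** J p) $ a $ b = Ric p $ a $ b" for a b
  proof -
    have "(transpose (J p) ** Ric p ** J p) $ a $ b =
        (\<Sum>j\<in>UNIV. J p $ j $ a * (\<Sum>k\<in>UNIV. Ric p $ j $ k * J p $ k $ b))"
      by (simp add: matrix_mul_assoc[symmetric]) (simp add: matrix_matrix_mult_def transpose_def)
    also have "\<dots> = (\<Sum>j\<in>UNIV. J p $ j $ a * (\<Sum>i\<in>UNIV. (R i j p ** J p) $ i $ b))"
    proof -
      have "(\<Sum>k\<in>UNIV. Ric p $ j $ k * J p $ k $ b) = (\<Sum>i\<in>UNIV. (R i j p ** J p) $ i $ b)" for j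
        unfolding Ric_eq sum_distrib_right by (subst sum.swap) (simp add: matrix_matrix_mult_def)
      then show ?thesis by simp
    qed
    also have "\<dots> = (\<Sum>j\<in>UNIV. J p $ j $ a * (\<Sum>i\<in>UNIV. \<Sum>m\<in>UNIV. J p $ i $ m * R i j p $ m $ b))"
      by (simp add: R_J assms) (simp add: matrix_matrix_mult_def)
    also have "\<dots> = (\<Sum>j\<in>UNIV. \<Sum>i\<in>UNIV. \<Sum>m\<in>UNIV. J p $ i $ m * J p $ j $ a * R i j p $ m $ b)"
      by (simp add: sum_distrib_left ac_simps)
    also have "\<dots> = (\<Sum>m\<in>UNIV. \<Sum>i\<in>UNIV. \<Sum>j\<in>UNIV. J p $ i $ m * J p $ j $ a * R i j p $ m $ b)"
      by (rule sum_reverse)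
    also have "\<dots> = Ric p $ a $ b"
      by (simp add: R_JJ assms Ric_eq)
    finally show ?thesis .
  qed
  then show ?thesis by (simp add: vec_eq_iff)
qed

text \<open>The first Bianchi identity splits R(X, Y) into two terms whose traces against J are
  Ricci contractions. This exhibits the Ricci form as a trace of the curvature, to which the second
  Bianchi identity applies.\<close>

lemma trace_J_R:
  assumes "p \<in> W"
  shows "trace (J p ** R i j p) = (Ric p ** J p) $ j $ i - (Ric p ** J p) $ i $ j"
proof -
  have *: "(\<Sum>k\<in>UNIV. \<Sum>m\<in>UNIV. J p $ k $ m * R k a p $ m $ b) = (Ric p ** J p) $ a $ b" for a b
  proof -
    have "(\<Sum>k\<in>UNIV. \<Sum>m\<in>UNIV. J p $ k $ m * R k a p $ m $ b) = (\<Sum>k\<in>UNIV. (R k a p ** J p) $ k $ b)"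
      by (simp add: R_J assms) (simp add: matrix_matrix_mult_def)
    also have "\<dots> = (Ric p ** J p) $ a $ b"
      unfolding matrix_matrix_mult_def vec_lambda_beta Ric_eq sum_distrib_right by (rule sum.swap)
    finally show ?thesis .
  qed
  have R: "R i j p $ m $ k = R k j p $ m $ i - R k i p $ m $ j" for k m
    using first_bianchi[OF assms, of i j m k] R_swap[of k j] by simp
  have "trace (J p ** R i j p) =
      (\<Sum>k\<in>UNIV. \<Sum>m\<in>UNIV. J p $ k $ m * R k j p $ m $ i - J p $ k $ m * R k i p $ m $ j)"
    unfolding trace_def matrix_matrix_mult_def vec_lambda_beta R right_diff_distrib ..
  then show ?thesis by (simp add: sum_subtractf *)
qed

text \<open>Only applied to skew-symmetric \<open>T\<close>, for which the cyclic sum is the exterior derivative.\<close>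

definition closed_form :: "('m \<Rightarrow> real^'n^'n) \<Rightarrow> bool" where
  "closed_form T \<longleftrightarrow> (\<forall>p\<in>W. \<forall>i j k. DM k T p $ i $ j + DM i T p $ j $ k + DM j T p $ k $ i = 0)"

text \<open>The form is parallel, so its partial derivatives consist of Christoffel terms only, and
  these cancel in the cyclic sum by symmetry of \<Gamma>.\<close>

lemma closed_kaehler_form: "closed_form (\<lambda>p. G p ** J p)"
  unfolding closed_form_def
proof (intro ballI allI)
  fix p i j k assume p: "p \<in> W"
  define \<omega> where "\<omega> = G p ** J p"
  have sk: "\<omega> $ b $ a = - \<omega> $ a $ b" for a b
  proof -
    have "transpose \<omega> = - \<omega>" by (simp add: \<omega>_def matrix_transpose_mul G_sym p JT_G)
    from arg_cong[OF this, of "\<lambda>M. M $ a $ b"] show ?thesis by (simp add: transpose_def)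
  qed
  have "DM k (\<lambda>p. G p ** J p) p = transpose (\<Gamma> k p) ** \<omega> + \<omega> ** \<Gamma> k p" for k
    by (simp add: DM_mult smM_G smM_J p DM_G DM_J matrix_distribs matrix_mul_assoc \<omega>_def)
  then have "DM k (\<lambda>p. G p ** J p) p $ i $ j =
      (\<Sum>m\<in>UNIV. \<Gamma> k p $ m $ i * \<omega> $ m $ j) + (\<Sum>m\<in>UNIV. \<Gamma> k p $ m $ j * \<omega> $ i $ m)" for i j k
    by (simp add: matrix_matrix_mult_def transpose_def mult.commute)
  moreover have "(\<Sum>m\<in>UNIV. \<Gamma> k p $ m $ i * \<omega> $ m $ j) = - (\<Sum>m\<in>UNIV. \<Gamma> i p $ m $ k * \<omega> $ j $ m)" for i j k
    by (simp add: \<Gamma>_sym[OF p, of k _ i] sk[of _ j] sum_negf)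
  ultimately show "DM k (\<lambda>p. G p ** J p) p $ i $ j + DM i (\<lambda>p. G p ** J p) p $ j $ k
      + DM j (\<lambda>p. G p ** J p) p $ k $ i = 0"
    by simp
qed

text \<open>The form is -1/2 times the trace of \<open>J ** R i j\<close>. Since J is parallel,
  tracing the second Bianchi identity against J gives closedness. The symmetry of the Ricci tensor
  will be read off from the equation \<alpha>H + r = \<sigma>g.\<close>

lemma closed_ricci_form:
  assumes sym: "\<And>p. p \<in> W \<Longrightarrow> transpose (Ric p) = Ric p"
  shows "closed_form (\<lambda>p. Ric p ** J p)"
  unfolding closed_form_def
proof (intro ballI allI)
  fix p i j k assume p: "p \<in> W"
  have T: "trace (J q ** R i j q) = -2 * (Ric q ** J q) $ i $ j" if "q \<in> W" for q i j
  proof -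
    have "transpose (Ric q ** J q) = - (Ric q ** J q)"
      by (simp add: matrix_transpose_mul sym that JT_hermitian Ric_hermitian)
    from arg_cong[OF this, of "\<lambda>M. M $ i $ j"] show ?thesis
      by (simp add: trace_J_R that) (simp add: transpose_def)
  qed
  define N where "N k i j = DM k (R i j) p + \<Gamma> k p ** R i j p - R i j p ** \<Gamma> k p" for k i j
  have *: "-2 * DM k (\<lambda>p. Ric p ** J p) p $ i $ j = trace (J p ** N k i j)" for i j k
  proof -
    have "-2 * DM k (\<lambda>p. Ric p ** J p) p $ i $ j = D k (\<lambda>q. -2 * (Ric q ** J q) $ i $ j) p"
      using smM_mult[OF smM_Ric smM_J] p
      by (subst D_mult) (auto simp: sm_const DM_def D_const smM_def)
    also have "\<dots> = D k (\<lambda>q. trace (J q ** R i j q)) p"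
      by (rule D_cong) (simp_all add: T p)
    also have "\<dots> = trace (DM k J p ** R i j p + J p ** DM k (R i j) p)"
      by (simp add: D_trace DM_mult smM_mult smM_J smM_R p)
    also have "\<dots> = trace (J p ** N k i j)"
    proof -
      have "trace (\<Gamma> k p ** J p ** R i j p) = trace (J p ** R i j p ** \<Gamma> k p)"
        using trace_mul_sym[of "\<Gamma> k p" "J p ** R i j p"] by (simp add: matrix_mul_assoc)
      then show ?thesis
        by (simp add: N_def DM_J p matrix_distribs matrix_mul_assoc trace_add trace_sub)
    qed
    finally show ?thesis .
  qed
  have "trace (J p ** N k i j) + trace (J p ** N i j k) + trace (J p ** N j k i) = 0"
  proof -
    have "N k i j + N i j k + N j k i = 0" using second_bianchi[OF p] by (simp add: N_def)
    moreover have "trace (J p ** N k i j) + trace (J p ** N i j k) + trace (J p ** N j k i) =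
        trace (J p ** (N k i j + N i j k + N j k i))"
      by (simp add: matrix_distribs trace_add)
    ultimately show ?thesis by (simp add: trace_def matrix_matrix_mult_def)
  qed
  then show "DM k (\<lambda>p. Ric p ** J p) p $ i $ j + DM i (\<lambda>p. Ric p ** J p) p $ j $ k
      + DM j (\<lambda>p. Ric p ** J p) p $ k $ i = 0"
    unfolding *[symmetric] by linarith
qed

text \<open>The two-form \<open>H(\<cdot>, J \<cdot>)\<close> is half the exterior derivative of the one-form \<open>df \<circ> J\<close>.\<close>

lemma closed_hessian_form:
  assumes f: "sm f" and herm: "\<And>p. p \<in> W \<Longrightarrow> transpose (J p) ** H f p ** J p = H f p"
  shows "closed_form (\<lambda>p. H f p ** J p)"
  unfolding closed_form_def
proof (intro ballI allI)
  fix p i j k assume p: "p \<in> W"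
  define \<mu> where "\<mu> q = transpose (J q) *v df f q" for q
  have sm\<mu>: "smV \<mu>"
    unfolding \<mu>_def[abs_def] by (intro smV_mult smM_transpose smM_J smV_df f)
  \<comment> \<open>Because J is parallel, the covariant derivative of df \<circ> J is the Hessian
    composed with J.\<close>
  have h: "(H f q ** J q) $ i = DV i \<mu> q - transpose (\<Gamma> i q) *v \<mu> q" if q: "q \<in> W" for q i
  proof -
    have "DV i \<mu> q = transpose (DM i J q) *v df f q + transpose (J q) *v DV i (df f) q"
      unfolding \<mu>_def[abs_def]
      by (simp add: DV_mult smM_transpose smM_J smV_df f q DM_transpose del: transpose_matrix_vector)
    also have "\<dots> = transpose (\<Gamma> i q) *v \<mu> q + transpose (J q) *v (H f q $ i)"
      by (simp add: DM_J q H_row \<mu>_def transpose_distribs matrix_transpose_mul algebra_simps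
          matrix_vector_mul_assoc del: transpose_matrix_vector)
    also have "transpose (J q) *v (H f q $ i) = (H f q ** J q) $ i"
      by (simp add: vec_eq_iff matrix_vector_mult_def transpose_def matrix_matrix_mult_def mult.commute
          del: transpose_matrix_vector)
    finally show ?thesis by simp
  qed
  have two: "2 * (H f q ** J q) $ i $ j = D i (\<lambda>q. \<mu> q $ j) q - D j (\<lambda>q. \<mu> q $ i) q" if q: "q \<in> W" for q i j
  proof -
    have "transpose (H f q ** J q) = - (H f q ** J q)"
      by (simp add: matrix_transpose_mul H_sym f q JT_hermitian herm)
    from arg_cong[OF this, of "\<lambda>M. M $ i $ j"]
    have "2 * (H f q ** J q) $ i $ j = (H f q ** J q) $ i $ j - (H f q ** J q) $ j $ i"
      by (simp add: transpose_def)
    also have "\<dots> = D i (\<lambda>q. \<mu> q $ j) q - D j (\<lambda>q. \<mu> q $ i) q"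
      by (simp add: h q DV_def matrix_vector_mult_def transpose_def \<Gamma>_sym[OF q, of i _ j]
          del: transpose_matrix_vector)
    finally show ?thesis .
  qed
  have *: "2 * DM k (\<lambda>p. H f p ** J p) p $ i $ j =
      D k (D i (\<lambda>q. \<mu> q $ j)) p - D k (D j (\<lambda>q. \<mu> q $ i)) p" for i j k
  proof -
    have "2 * DM k (\<lambda>p. H f p ** J p) p $ i $ j = D k (\<lambda>q. 2 * (H f q ** J q) $ i $ j) p"
      using smM_mult[OF smM_H[OF f] smM_J] p
      by (subst D_mult) (auto simp: sm_const DM_def D_const smM_def)
    also have "\<dots> = D k (\<lambda>q. D i (\<lambda>q. \<mu> q $ j) q - D j (\<lambda>q. \<mu> q $ i) q) p"
      by (rule D_cong) (simp_all add: two p)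
    finally show ?thesis
      using sm\<mu> p by (simp add: D_diff sm_D smV_def)
  qed
  have "D a (D b (\<lambda>q. \<mu> q $ l)) p = D b (D a (\<lambda>q. \<mu> q $ l)) p" for a b l
    using sm\<mu> p by (intro D_commute) (auto simp: smV_def)
  from this[of k i j] this[of k j i] this[of i j k]
  show "DM k (\<lambda>p. H f p ** J p) p $ i $ j + DM i (\<lambda>p. H f p ** J p) p $ j $ k
      + DM j (\<lambda>p. H f p ** J p) p $ k $ i = 0"
    using *[of k i j] *[of i j k] *[of j k i] by linarith
qed

text \<open>Commutation with J says that the gradient is a holomorphic vector field; the proof
  lowers an index, where both sides become Hessian expressions.\<close>

lemma S_J:
  assumes q: "q \<in> W" and herm: "transpose (J q) ** H f q ** J q = H f q"
  shows "J q ** S f q = S f q ** J q"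
proof -
  have "G q ** (J q ** S f q) = - (transpose (J q) ** G q ** S f q)"
    by (simp add: JT_G q matrix_distribs matrix_mul_assoc)
  also have "\<dots> = - (transpose (J q) ** H f q)"
    by (simp add: matrix_mul_assoc[symmetric] G_S q)
  also have "\<dots> = G q ** (S f q ** J q)"
    by (simp add: JT_hermitian[OF q herm] q matrix_mul_assoc G_S)
  finally have "Gi q ** (G q ** (J q ** S f q)) = Gi q ** (G q ** (S f q ** J q))" by simp
  then show ?thesis by (simp only: matrix_mul_assoc Gi_G[OF q] matrix_mul_lid)
qed

lemma J_Gi_skew:
  assumes q: "q \<in> W"
  shows "transpose (J q ** Gi q) = - (J q ** Gi q)"
proof -
  have "transpose (J q ** Gi q) = Gi q ** (transpose (J q) ** G q) ** Gi q"
    by (simp add: matrix_mul_assoc[symmetric] G_Gi q matrix_transpose_mul Gi_sym)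
  also have "\<dots> = - (J q ** Gi q)"
    by (simp add: JT_G q matrix_distribs matrix_mul_assoc Gi_G)
  finally show ?thesis .
qed

text \<open>The Ricci identity is traced for the gradient \<open>v\<close> and for \<open>J v\<close>; the divergence of the Hessian
  is eliminated between the two results.\<close>

lemma ricci_gradient:
  assumes f: "sm f" and herm: "\<And>p. p \<in> W \<Longrightarrow> transpose (J p) ** H f p ** J p = H f p"
    and p: "p \<in> W" and sym: "transpose (Ric p) = Ric p"
  shows "2 * (Ric p *v grad f p) $ j = - D j (\<lambda>q. trace (S f q)) p"
proof -
  have SJ: "J q ** S f q = S f q ** J q" if q: "q \<in> W" for q
    by (rule S_J[OF q herm[OF q]])
  have trJS: "trace (J q ** S f q) = 0" if q: "q \<in> W" for q
    using trace_sym_skew[OF J_Gi_skew[OF q] H_sym[OF f q]] by (simp add: S_def matrix_mul_assoc)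
  \<comment> \<open>\<open>N i\<close> is the covariant derivative of \<open>S f\<close>, and
    \<delta> below is its divergence.\<close>
  define N where "N i = DM i (S f) p + \<Gamma> i p ** S f p - S f p ** \<Gamma> i p" for i
  define \<delta> where "\<delta> = (\<chi> j. \<Sum>i\<in>UNIV. N i $ i $ j)"
  define v where "v = grad f p"
  have JN: "J p ** N i = N i ** J p" for i
  proof -
    have "DM i (\<lambda>q. J q ** S f q) p = DM i (\<lambda>q. S f q ** J q) p"
      by (rule DM_cong) (simp_all add: SJ p)
    then have "(J p ** \<Gamma> i p - \<Gamma> i p ** J p) ** S f p + J p ** DM i (S f) p =
        DM i (S f) p ** J p + S f p ** (J p ** \<Gamma> i p - \<Gamma> i p ** J p)"
      by (simp add: DM_mult smM_J smM_S f p DM_J)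
    moreover have "\<Gamma> i p ** J p ** S f p = \<Gamma> i p ** S f p ** J p"
      "S f p ** J p ** \<Gamma> i p = J p ** S f p ** \<Gamma> i p"
      by (simp_all add: matrix_mul_assoc[symmetric] SJ[OF p])
    ultimately show ?thesis
      by (simp add: N_def matrix_distribs matrix_mul_assoc algebra_simps)
  qed
  have trN: "trace (N i) = D i (\<lambda>q. trace (S f q)) p" for i
    by (simp add: N_def D_trace smM_S f p trace_add trace_sub trace_mul_sym[of "S f p"])
  \<comment> \<open>The trace of J S vanishes identically, as J Gi is skew and the Hessian
    symmetric; J being parallel, its derivative is the trace of \<open>J ** N i\<close>.\<close>
  have trJN: "trace (J p ** N i) = 0" for i
  proof -
    have "0 = D i (\<lambda>q. trace (J q ** S f q)) p"
      using D_cong[of "\<lambda>q. trace (J q ** S f q)" "\<lambda>_. 0" p i] trJS p by (simp add: D_const)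
    also have "\<dots> = trace ((J p ** \<Gamma> i p - \<Gamma> i p ** J p) ** S f p + J p ** DM i (S f) p)"
      by (simp add: D_trace DM_mult smM_mult smM_J smM_S f p DM_J)
    also have "trace (\<Gamma> i p ** J p ** S f p) = trace (J p ** S f p ** \<Gamma> i p)"
      using trace_mul_sym[of "\<Gamma> i p" "J p ** S f p"] by (simp add: matrix_mul_assoc)
    then have "trace ((J p ** \<Gamma> i p - \<Gamma> i p ** J p) ** S f p + J p ** DM i (S f) p) = trace (J p ** N i)"
      by (simp add: N_def matrix_distribs matrix_mul_assoc trace_add trace_sub)
    finally show ?thesis by simp
  qed
  \<comment> \<open>The Ricci identity for the gradient. The remaining correction terms
    \<open>S ** \<Gamma>\<close> are symmetric in i and j and drop out.\<close>
  have Rv: "(R i j p *v v) $ a = N i $ a $ j - N j $ a $ i" for i j a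
  proof -
    have DS: "DV i (DV j (grad f)) p + DM i (\<Gamma> j) p *v v + \<Gamma> j p *v DV i (grad f) p = (\<chi> a. DM i (S f) p $ a $ j)" for i j
    proof -
      have "(\<chi> a. DM i (S f) p $ a $ j) = DV i (\<lambda>q. S f q *v axis j 1) p"
        by (simp add: vec_eq_iff DM_def DV_def matrix_vector_mult_basis column_def)
      also have "\<dots> = DV i (\<lambda>q. DV j (grad f) q + \<Gamma> j q *v grad f q) p"
        by (rule DV_cong) (simp_all add: nabla_grad f p)
      also have "\<dots> = DV i (DV j (grad f)) p + (DM i (\<Gamma> j) p *v v + \<Gamma> j p *v DV i (grad f) p)"
        by (simp add: DV_add DV_mult smV_intros smV_grad smM_\<Gamma> f p v_def)
      finally show ?thesis by (simp add: add.assoc)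
    qed
    have \<Gamma>S: "\<Gamma> i p *v (DV j (grad f) p + \<Gamma> j p *v v) = (\<chi> a. (\<Gamma> i p ** S f p) $ a $ j)" for i j
      by (simp add: v_def nabla_grad f p matrix_vector_mul_assoc)
        (simp add: vec_eq_iff matrix_vector_mult_basis column_def)
    have "R i j p *v v = (\<chi> a. DM i (S f) p $ a $ j) - (\<chi> a. DM j (S f) p $ a $ i)
       + (\<chi> a. (\<Gamma> i p ** S f p) $ a $ j) - (\<chi> a. (\<Gamma> j p ** S f p) $ a $ i)"
      unfolding DS[symmetric] \<Gamma>S[symmetric] R_eq
      by (simp add: DV_commute[of "grad f" p i j] smV_grad f p algebra_simps matrix_vector_mul_assoc)
    moreover have "(S f p ** \<Gamma> i p) $ a $ j = (S f p ** \<Gamma> j p) $ a $ i"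
      by (simp add: matrix_matrix_mult_def \<Gamma>_sym[OF p, of i])
    ultimately show ?thesis by (simp add: N_def)
  qed
  have 1: "(Ric p *v v) $ j = \<delta> $ j - D j (\<lambda>q. trace (S f q)) p" for j
  proof -
    have "(Ric p *v v) $ j = (\<Sum>i\<in>UNIV. (R i j p *v v) $ i)"
      unfolding matrix_vector_mult_def vec_lambda_beta Ric_eq sum_distrib_right by (rule sum.swap)
    also have "\<dots> = \<delta> $ j - trace (N j)" by (simp add: Rv sum_subtractf \<delta>_def trace_def)
    finally show ?thesis by (simp add: trN)
  qed
  \<comment> \<open>For J v the term corresponding to dY is the trace of \<open>J ** N j\<close>,
    which is zero, so only the divergence survives.\<close>
  have "(Ric p *v (J p *v v)) $ j = (transpose (J p) *v \<delta>) $ j" for j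
  proof -
    have "(Ric p *v (J p *v v)) $ j = (\<Sum>i\<in>UNIV. (R i j p *v (J p *v v)) $ i)"
      unfolding matrix_vector_mult_def[of "Ric p"] matrix_vector_mult_def[of "R _ _ _"]
        vec_lambda_beta Ric_eq sum_distrib_right by (rule sum.swap)
    also have "\<dots> = (\<Sum>i\<in>UNIV. \<Sum>m\<in>UNIV. J p $ i $ m * (R i j p *v v) $ m)"
      by (simp add: matrix_vector_mul_assoc R_J p)
        (simp add: matrix_vector_mul_assoc[symmetric] matrix_vector_mult_def[of "J p"])
    also have "\<dots> = (\<Sum>i\<in>UNIV. (J p ** N i) $ i $ j) - trace (J p ** N j)"
      by (simp add: Rv trace_def matrix_matrix_mult_def right_diff_distrib sum_subtractf)
    also have "\<dots> = (\<Sum>i\<in>UNIV. \<Sum>m\<in>UNIV. N i $ i $ m * J p $ m $ j)"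
      unfolding trJN unfolding JN by (simp add: matrix_matrix_mult_def)
    also have "\<dots> = (transpose (J p) *v \<delta>) $ j"
      by (subst sum.swap) (simp add: matrix_vector_mult_def transpose_def \<delta>_def sum_distrib_left mult.commute
          del: transpose_matrix_vector)
    finally show ?thesis .
  qed
  \<comment> \<open>Hermitian symmetry of the Ricci tensor allows J to be cancelled, leaving
    \<delta> = -r(v); inserted in \<open>1\<close> this produces the factor 2.\<close>
  then have "transpose (J p) *v \<delta> = (Ric p ** J p) *v v"
    by (simp add: vec_eq_iff matrix_vector_mul_assoc del: transpose_matrix_vector)
  also have "Ric p ** J p = - (transpose (J p) ** Ric p)"
    by (simp add: JT_hermitian Ric_hermitian p)
  finally have "transpose (J p) *v (\<delta> + Ric p *v v) = 0"
    by (simp add: algebra_simps matrix_vector_mul_assoc vec.neg del: transpose_matrix_vector)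
      (simp add: vec_eq_iff matrix_vector_mult_def sum_negf del: transpose_matrix_vector)
  then have "transpose (J p) *v (transpose (J p) *v (\<delta> + Ric p *v v)) = 0"
    by (simp del: transpose_matrix_vector)
  moreover have "transpose (J p) ** transpose (J p) = - mat 1"
    by (simp add: matrix_transpose_mul[symmetric] J_J p transpose_distribs)
  ultimately have "(0 - mat 1) *v (\<delta> + Ric p *v v) = 0"
    by (simp add: matrix_vector_mul_assoc del: transpose_matrix_vector)
  then have "\<delta> + Ric p *v v = 0"
    by (simp only: matrix_vector_mult_diff_rdistrib) (simp add: neg_eq_iff_add_eq_0)
  then have "\<delta> $ j + (Ric p *v v) $ j = 0"
    by (metis vector_add_component zero_index)
  with 1[of j] show ?thesis by (simp add: v_def)
qed

end

section \<open>Change of charts\<close>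

context riemannian_region
begin

lemma B_eq: "p \<in> W \<Longrightarrow> B f h p = (\<Sum>i\<in>UNIV. grad f p $ i * D i h p)"
  by (simp add: B_def G_grad inner_vec_def)

text \<open>This determines the Hessian by first derivatives of scalars, so its behaviour under a change of
  charts follows without second derivatives of the transition maps.\<close>

lemma koszul:
  assumes "sm f" "sm h" "sm k" "p \<in> W"
  shows "B h (B f k) p + B k (B f h) p - B f (B h k) p = 2 * (grad h p \<bullet> (H f p *v grad k p))"
proof -
  have s: "x \<bullet> (H e p *v y) = y \<bullet> (H e p *v x)" if "sm e" for e x y
    by (subst inner_matrix_vector) (simp only: H_sym[OF that assms(4)] inner_commute)
  have B: "B e (B u w) p = grad e p \<bullet> (H u p *v grad w p + H w p *v grad u p)" if "sm u" "sm w" for e u w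
    by (simp add: B_eq[OF assms(4), of e] D_B that assms inner_vec_def)
  show ?thesis
    unfolding B[OF assms(1,3)] B[OF assms(1,2)] B[OF assms(2,3)] inner_add_right
    using s[OF assms(1), of "grad k p" "grad h p"] s[OF assms(2), of "grad f p" "grad k p"]
      s[OF assms(3), of "grad f p" "grad h p"]
    by linarith
qed

end

locale two_charts = C: riemannian_region A g c W + E: riemannian_region A g d W
  for A :: "('m::{t2_space, second_countable_topology}, 'n::finite) chart set" and g c d W
begin

definition P :: "'m \<Rightarrow> real^'n^'n" where "P p = jacobian_between c d p"

lemma sm_transition: "C.sm (\<lambda>q. chart_map d q $ k)" "E.sm (\<lambda>q. chart_map c q $ k)"
proof -
  have "smooth_on (chart_map c ` (chart_dom c \<inter> chart_dom d)) (chart_map d \<circ> chart_inv c)"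
    "smooth_on (chart_map d ` (chart_dom d \<inter> chart_dom c)) (chart_map c \<circ> chart_inv d)"
    using C.manifold C.chart_in E.chart_in unfolding smooth_manifold_def by blast+
  then have s: "k_smooth_on n (chart_map c ` W) (chart_map d \<circ> chart_inv c)"
    "k_smooth_on n (chart_map d ` W) (chart_map c \<circ> chart_inv d)" for n
    using C.W_sub E.W_sub unfolding smooth_on_def
    by (meson image_mono k_smooth_on_subset le_inf_iff)+
  show "C.sm (\<lambda>q. chart_map d q $ k)"
    unfolding C.sm_def smooth_on_def
    using k_smooth_on_linear[OF C.open_image s(1) bounded_linear_vec_nth] by (simp add: comp_def)
  show "E.sm (\<lambda>q. chart_map c q $ k)"
    unfolding E.sm_def smooth_on_def
    using k_smooth_on_linear[OF E.open_image s(2) bounded_linear_vec_nth] by (simp add: comp_def)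
qed

lemma df_change:
  assumes f: "E.sm f" and p: "p \<in> W"
  shows "C.df f p = transpose (P p) *v E.df f p"
proof -
  let ?x = "chart_map c p" and ?y = "chart_map d p"
  let ?T = "\<lambda>x. \<chi> k. chart_map d (chart_inv c x) $ k"
  let ?T' = "\<lambda>v. \<chi> k. frechet_derivative ((\<lambda>q. chart_map d q $ k) \<circ> chart_inv c) (at ?x) v"
  have T: "(?T has_derivative ?T') (at ?x)"
    using C.pullback_has_derivative[OF sm_transition(1) p]
    by (subst has_derivative_componentwise_within) (auto simp: Basis_vec_def inner_axis comp_def)
  have "((f \<circ> chart_inv d) has_derivative frechet_derivative (f \<circ> chart_inv d) (at ?y)) (at (?T ?x))"
    using E.pullback_has_derivative[OF f p] p by simp
  from has_derivative_compose[OF T this]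
  have "((\<lambda>x. (f \<circ> chart_inv d) (?T x)) has_derivative
      (\<lambda>v. frechet_derivative (f \<circ> chart_inv d) (at ?y) (?T' v))) (at ?x)" .
  then have "((f \<circ> chart_inv c) has_derivative
      (\<lambda>v. frechet_derivative (f \<circ> chart_inv d) (at ?y) (?T' v))) (at ?x)"
    by (rule has_derivative_transform_within_open[OF _ C.open_image]) (use p in auto)
  from C.D_eqI[OF this] have "C.D i f p = (\<Sum>k\<in>UNIV. ?T' (axis i 1) $ k * E.D k f p)" for i
    by (simp add: E.frechet_eq_sum_D[OF f p])
  then show ?thesis
    by (simp add: vec_eq_iff matrix_vector_mult_def transpose_def P_def jacobian_between_def coord_deriv_def
        del: transpose_matrix_vector)
qed

text \<open>Covariance of g makes Gi P^T G' a left inverse of the Jacobian P, where G' is the metric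
  in the second chart. For square matrices it is a right inverse too, and multiplying by the inverse
  of G' gives the claim.\<close>

lemma P_Gi_PT:
  assumes p: "p \<in> W"
  shows "P p ** C.Gi p ** transpose (P p) = E.Gi p"
proof -
  have "p \<in> chart_dom c \<inter> chart_dom d" using p C.W_sub E.W_sub by blast
  then have G: "C.G p = transpose (P p) ** E.G p ** P p"
    using C.metric C.chart_in E.chart_in
    unfolding riemannian_metric_def bilinear_tensor_def C.G_def E.G_def P_def by blast
  have "(C.Gi p ** transpose (P p) ** E.G p) ** P p = C.Gi p ** C.G p"
    by (simp add: G matrix_mul_assoc)
  then have "(C.Gi p ** transpose (P p) ** E.G p) ** P p = mat 1"
    by (simp only: C.Gi_G[OF p])
  then have "P p ** (C.Gi p ** transpose (P p) ** E.G p) = mat 1"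
    by (rule matrix_left_right_inverse1)
  then have "P p ** (C.Gi p ** transpose (P p) ** E.G p) ** E.Gi p = E.Gi p" by simp
  moreover have "P p ** (C.Gi p ** transpose (P p) ** E.G p) ** E.Gi p
      = P p ** C.Gi p ** transpose (P p) ** (E.G p ** E.Gi p)"
    by (simp only: matrix_mul_assoc)
  ultimately show ?thesis by (simp add: E.G_Gi p)
qed

lemma grad_change:
  assumes f: "E.sm f" and p: "p \<in> W"
  shows "E.grad f p = P p *v C.grad f p"
  unfolding E.grad_eq C.grad_eq df_change[OF assms] P_Gi_PT[OF p, symmetric]
  by (simp only: matrix_vector_mul_assoc matrix_mul_assoc)

lemma B_change:
  assumes f: "E.sm f" and h: "E.sm h" and p: "p \<in> W"
  shows "C.B f h p = E.B f h p"
  unfolding C.B_def E.B_def C.G_grad[OF p] E.G_grad[OF p] df_change[OF h p] grad_change[OF f p]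
  by (subst inner_matrix_vector) (simp del: transpose_matrix_vector)

lemma B_cong:
  assumes "\<And>q. q \<in> W \<Longrightarrow> u q = w q" "p \<in> W"
  shows "C.B f u p = C.B f w p"
  unfolding C.B_eq[OF assms(2)]
  by (intro sum.cong refl arg_cong2[where f = "(*)"] C.D_cong assms)

text \<open>By \<open>koszul\<close> both sides are the same combination of iterated
  \<open>B\<close>, which are scalars independent of the chart.\<close>

lemma hessian_form_change:
  assumes f: "C.sm f" "E.sm f" and h: "C.sm h" "E.sm h" and k: "C.sm k" "E.sm k" and p: "p \<in> W"
  shows "C.grad h p \<bullet> (C.H f p *v C.grad k p) = E.grad h p \<bullet> (E.H f p *v E.grad k p)"
proof -
  have B: "C.B e (C.B u w) p = E.B e (E.B u w) p" if "E.sm e" "E.sm u" "E.sm w" for e u w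
    using B_cong[of "C.B u w" "E.B u w" p e] B_change that p E.sm_B by simp
  show ?thesis
    using C.koszul[OF f(1) h(1) k(1) p] E.koszul[OF f(2) h(2) k(2) p]
    by (simp add: B f h k)
qed

text \<open>The gradients of the coordinate functions are the columns of Gi. Testing on them
  compares the Hessians after multiplication by Gi on both sides, which G then undoes.\<close>

lemma H_change:
  assumes f: "C.sm f" "E.sm f" and p: "p \<in> W"
  shows "C.H f p = transpose (P p) ** E.H f p ** P p"
proof -
  let ?x = "\<lambda>a q. chart_map c q $ a"
  have df: "C.df (?x a) p = axis a 1" for a
    by (simp add: vec_eq_iff C.D_coordinate p axis_def)
  have gC: "C.grad (?x a) p = C.Gi p *v axis a 1" for a
    by (simp only: C.grad_eq df)
  have gE: "E.grad (?x a) p = P p *v (C.Gi p *v axis a 1)" for a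
    by (simp only: grad_change[OF sm_transition(2) p] gC)
  have e: "axis a 1 \<bullet> (M *v axis b 1) = M $ a $ b" for a b and M :: "real^'n^'n"
    by (simp add: inner_axis' matrix_vector_mult_basis column_def)
  have "(C.Gi p ** C.H f p ** C.Gi p) $ a $ b = (C.Gi p ** (transpose (P p) ** E.H f p ** P p) ** C.Gi p) $ a $ b" for a b
  proof -
    have "(C.Gi p ** C.H f p ** C.Gi p) $ a $ b =
        C.grad (?x a) p \<bullet> (C.H f p *v C.grad (?x b) p)"
      unfolding gC e[symmetric]
      by (simp only: matrix_vector_mul_assoc[symmetric] inner_matrix_vector[of _ "C.Gi p"] C.Gi_sym[OF p])
    also have "\<dots> = E.grad (?x a) p \<bullet> (E.H f p *v E.grad (?x b) p)"
      by (rule hessian_form_change[OF f C.sm_coordinate sm_transition(2) C.sm_coordinate sm_transition(2) p])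
    also have "\<dots> = (C.Gi p ** (transpose (P p) ** E.H f p ** P p) ** C.Gi p) $ a $ b"
      unfolding gE e[symmetric]
      by (simp only: matrix_vector_mul_assoc[symmetric] inner_matrix_vector[of _ "C.Gi p"] C.Gi_sym[OF p]
          inner_matrix_vector[of _ "transpose (P p)"] transpose_transpose)
    finally show ?thesis .
  qed
  then have "C.Gi p ** C.H f p ** C.Gi p = C.Gi p ** (transpose (P p) ** E.H f p ** P p) ** C.Gi p"
    by (simp add: vec_eq_iff)
  then have "C.G p ** (C.Gi p ** C.H f p ** C.Gi p) ** C.G p =
      C.G p ** (C.Gi p ** (transpose (P p) ** E.H f p ** P p) ** C.Gi p) ** C.G p"
    by (simp only:)
  moreover have "C.G p ** (C.Gi p ** M ** C.Gi p) ** C.G p = M" for M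
  proof -
    have "C.G p ** (C.Gi p ** M ** C.Gi p) ** C.G p = (C.G p ** C.Gi p) ** M ** (C.Gi p ** C.G p)"
      by (simp only: matrix_mul_assoc)
    then show ?thesis by (simp add: C.G_Gi C.Gi_G p)
  qed
  ultimately show ?thesis by simp
qed

lemma trace_S_change:
  assumes f: "C.sm f" "E.sm f" and p: "p \<in> W"
  shows "trace (C.S f p) = trace (E.S f p)"
proof -
  have "trace (C.S f p) = trace (C.Gi p ** transpose (P p) ** E.H f p ** P p)"
    by (simp add: C.S_def H_change[OF f p] matrix_mul_assoc)
  also have "\<dots> = trace (P p ** (C.Gi p ** transpose (P p) ** E.H f p))"
    by (rule trace_mul_sym)
  also have "\<dots> = trace (E.S f p)"
    by (simp add: E.S_def P_Gi_PT[OF p, symmetric] matrix_mul_assoc)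
  finally show ?thesis .
qed

end

text \<open>A global scalar uses a chart selected anew at every point. Before it is differentiated
  it must be identified with the expression in one fixed chart, which is the purpose of the
  comparison of charts.\<close>

lemma invariant_value_chart:
  assumes "c \<in> A" "p \<in> chart_dom c"
  obtains d where "d \<in> A" "p \<in> chart_dom d" "\<And>S. invariant_value A S p = S d p"
  unfolding invariant_value_def
  using assms someI[of "\<lambda>c. c \<in> A \<and> p \<in> chart_dom c" c] that by blast

lemma two_charts_overlap:
  assumes "smooth_manifold A" "riemannian_metric A g" "c \<in> A" "d \<in> A"
  shows "two_charts A g c d (chart_dom c \<inter> chart_dom d)"
  using assms by unfold_locales (auto simp: smooth_manifold_def is_chart_def)

lemma (in riemannian_region) laplacian_eq:
  assumes "smooth_fun A f" "p \<in> W"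
  shows "laplacian A g f p = trace (S f p)"
proof -
  have p: "p \<in> chart_dom c" using assms(2) W_sub by blast
  obtain d where d: "d \<in> A" "p \<in> chart_dom d" "\<And>S. invariant_value A S p = S d p"
    using invariant_value_chart[OF chart_in p] by blast
  \<comment> \<open>The comparison takes place on the overlap instead of W; matrices such as
    \<open>S f p\<close> depend on the chart but not on the region.\<close>
  interpret X: two_charts A g c d "chart_dom c \<inter> chart_dom d"
    by (rule two_charts_overlap[OF manifold metric chart_in d(1)])
  have "X.C.sm f" "X.E.sm f"
    using assms(1) chart_in d(1) X.C.sm_chart_imp X.E.sm_chart_imp unfolding smooth_fun_def by blast+
  from X.trace_S_change[OF this, of p] p d(2) show ?thesis
    by (simp add: laplacian_def metric_trace_def d(3) X.C.S_def X.E.S_def S_def X.C.Gi_def X.E.Gi_def Gi_def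
        X.C.H_def X.E.H_def H_def)
qed

lemma (in riemannian_region) grad_norm_sq_eq:
  assumes "smooth_fun A f" "p \<in> W"
  shows "grad_norm_sq A g f p = B f f p"
proof -
  have p: "p \<in> chart_dom c" using assms(2) W_sub by blast
  obtain d where d: "d \<in> A" "p \<in> chart_dom d" "\<And>S. invariant_value A S p = S d p"
    using invariant_value_chart[OF chart_in p] by blast
  interpret X: two_charts A g c d "chart_dom c \<inter> chart_dom d"
    by (rule two_charts_overlap[OF manifold metric chart_in d(1)])
  have "X.E.sm f"
    using assms(1) chart_in d(1) X.C.sm_chart_imp X.E.sm_chart_imp unfolding smooth_fun_def by blast+
  from X.B_change[OF this this, of p] p d(2) show ?thesis
    by (simp add: grad_norm_sq_def d(3) X.C.B_def X.E.B_def B_def X.C.G_def X.E.G_def G_def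
        X.C.grad_def X.E.grad_def grad_def)
qed

section \<open>The Ricci-Hessian equation in a chart\<close>

text \<open>Contraction of \<open>a \<and> T\<close> with the inverse of the Kaehler form.\<close>

lemma (in kaehler_region) contract_wedge:
  assumes p: "p \<in> W" and SJ: "J p ** M = M ** J p"
    and sym: "transpose (G p ** M) = G p ** M"
  defines "T \<equiv> G p ** M ** J p" and "Z \<equiv> - (J p ** Gi p)"
  shows "(\<Sum>i\<in>UNIV. \<Sum>j\<in>UNIV. (a $ k * T $ i $ j + a $ i * T $ j $ k + a $ j * T $ k $ i) * Z $ j $ i) =
    trace M * a $ k - 2 * (transpose M *v a) $ k"
proof -
  have GiT: "transpose M ** G p = G p ** M"
    using sym by (simp add: matrix_transpose_mul G_sym p)
  have GMGi: "G p ** M ** Gi p = transpose M"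
  proof -
    have "G p ** M ** Gi p = transpose M ** (G p ** Gi p)"
      by (simp add: GiT[symmetric] matrix_mul_assoc)
    then show ?thesis by (simp add: G_Gi p)
  qed
  have TZ: "T ** Z = transpose M"
    by (simp add: T_def Z_def matrix_distribs matrix_mul_assoc J_J' p GMGi)
  have ZT: "Z ** T = M"
  proof -
    have "Z ** T = - (J p ** (Gi p ** G p) ** (M ** J p))"
      by (simp add: T_def Z_def matrix_distribs matrix_mul_assoc)
    also have "\<dots> = - (J p ** J p ** M)" by (simp add: Gi_G p SJ[symmetric] matrix_mul_assoc)
    also have "\<dots> = M" by (simp add: J_J p matrix_distribs)
    finally show ?thesis .
  qed
  have skT: "T $ j $ k = - T $ k $ j" for j k
  proof -
    have "transpose T = transpose (J p) ** (G p ** M)"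
      unfolding T_def by (simp add: matrix_transpose_mul[of "G p ** M"] sym)
    also have "\<dots> = - (G p ** (J p ** M))"
      by (simp add: matrix_mul_assoc JT_G p matrix_distribs)
    also have "\<dots> = - T" by (simp add: SJ T_def matrix_mul_assoc)
    finally have "transpose T = - T" .
    from arg_cong[OF this, of "\<lambda>M. M $ k $ j"] show ?thesis by (simp add: transpose_def)
  qed
  have skZ: "Z $ j $ i = - Z $ i $ j" for i j
  proof -
    have "transpose Z = - Z" by (simp add: Z_def transpose_distribs J_Gi_skew[OF p])
    from arg_cong[OF this, of "\<lambda>M. M $ i $ j"] show ?thesis by (simp add: transpose_def)
  qed
  \<comment> \<open>The first cyclic term yields the trace. The other two are equal because T and Z
    are skew.\<close>
  have 1: "(\<Sum>i\<in>UNIV. \<Sum>j\<in>UNIV. a $ k * T $ i $ j * Z $ j $ i) = a $ k * trace M"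
  proof -
    have "(\<Sum>i\<in>UNIV. \<Sum>j\<in>UNIV. a $ k * T $ i $ j * Z $ j $ i) = a $ k * trace (T ** Z)"
      by (simp add: trace_def matrix_matrix_mult_def sum_distrib_left mult.assoc)
    then show ?thesis by (simp add: TZ trace_transpose)
  qed
  have 2: "(\<Sum>i\<in>UNIV. \<Sum>j\<in>UNIV. a $ i * T $ j $ k * Z $ j $ i) = - (transpose M *v a) $ k"
  proof -
    have "(\<Sum>i\<in>UNIV. \<Sum>j\<in>UNIV. a $ i * T $ j $ k * Z $ j $ i) =
        - (\<Sum>i\<in>UNIV. (\<Sum>j\<in>UNIV. Z $ i $ j * T $ j $ k) * a $ i)"
      unfolding sum_negf[symmetric] sum_distrib_right
      by (intro sum.cong refl) (subst skZ, simp)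
    also have "\<dots> = - (transpose (Z ** T) *v a) $ k"
      by (simp add: matrix_vector_mult_def transpose_def matrix_matrix_mult_def del: transpose_matrix_vector)
    finally show ?thesis by (simp add: ZT del: transpose_matrix_vector)
  qed
  have 3: "(\<Sum>i\<in>UNIV. \<Sum>j\<in>UNIV. a $ j * T $ k $ i * Z $ j $ i) = - (transpose M *v a) $ k"
  proof -
    have "(\<Sum>i\<in>UNIV. \<Sum>j\<in>UNIV. a $ j * T $ k $ i * Z $ j $ i) =
        (\<Sum>j\<in>UNIV. \<Sum>i\<in>UNIV. a $ j * T $ k $ i * Z $ j $ i)"
      by (rule sum.swap)
    also have "\<dots> = (\<Sum>i\<in>UNIV. \<Sum>j\<in>UNIV. a $ i * T $ j $ k * Z $ j $ i)"
      by (intro sum.cong refl) (subst skT, subst skZ, simp)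
    finally show ?thesis by (simp only: 2)
  qed
  show ?thesis
    unfolding distrib_right sum.distrib 1 2 3 by (simp add: mult.commute del: transpose_matrix_vector)
qed

lemma matrix_scaleR_distribs:
  fixes M N :: "real^'n^'n"
  shows "(r *\<^sub>R M) ** N = r *\<^sub>R (M ** N)" "M ** (r *\<^sub>R N) = r *\<^sub>R (M ** N)"
    "trace (r *\<^sub>R M) = r * trace M" "(r *\<^sub>R M) *v v = r *\<^sub>R (M *v v)"
  by (simp_all add: vec_eq_iff matrix_matrix_mult_def matrix_vector_mult_def trace_def sum_distrib_left
      mult.assoc mult.left_commute)

locale ricci_hessian_region = kaehler_region A g c W Jt
  for A :: "('m::{t2_space, second_countable_topology}, 'n::finite) chart set" and g c W Jt +
  fixes \<tau> \<sigma> :: "'m \<Rightarrow> real" and \<alpha> :: "real \<Rightarrow> real" and I :: "real set"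
  assumes sm_\<tau>: "sm \<tau>"
    and I: "open I" "\<tau> ` W \<subseteq> I" "smooth_on I \<alpha>"
    and eq: "\<And>p. p \<in> W \<Longrightarrow> \<alpha> (\<tau> p) *\<^sub>R H \<tau> p + Ric p = \<sigma> p *\<^sub>R G p"
    and dense: "W \<subseteq> closure {p \<in> W. \<alpha> (\<tau> p) \<noteq> 0}"
    and dim4: "CARD('n) = 4"
begin

definition Q :: "'m \<Rightarrow> real" where "Q = B \<tau> \<tau>"
definition Y :: "'m \<Rightarrow> real" where "Y p = trace (S \<tau> p)"

lemma sm_fun_\<tau>: "smooth_on I \<beta> \<Longrightarrow> sm (\<lambda>p. \<beta> (\<tau> p))"
  using sm_compose I sm_\<tau> by blast

lemma sm_\<alpha>: "sm (\<lambda>p. \<alpha> (\<tau> p))" "sm (\<lambda>p. deriv \<alpha> (\<tau> p))" "sm (\<lambda>p. deriv (deriv \<alpha>) (\<tau> p))"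
  by (intro sm_fun_\<tau> smooth_on_deriv I)+

lemma D_fun_\<tau>: "smooth_on I \<beta> \<Longrightarrow> p \<in> W \<Longrightarrow> D i (\<lambda>p. \<beta> (\<tau> p)) p = deriv \<beta> (\<tau> p) * D i \<tau> p"
  using D_compose[of \<beta> \<tau> p i] smooth_on_imp_differentiable[of I \<beta> "\<tau> p"] I sm_\<tau> by auto

lemma D_\<alpha>:
  assumes "p \<in> W"
  shows "D i (\<lambda>p. \<alpha> (\<tau> p)) p = deriv \<alpha> (\<tau> p) * D i \<tau> p"
    "D i (\<lambda>p. deriv \<alpha> (\<tau> p)) p = deriv (deriv \<alpha>) (\<tau> p) * D i \<tau> p"
    "D i (\<lambda>p. deriv (deriv \<alpha>) (\<tau> p)) p = deriv (deriv (deriv \<alpha>)) (\<tau> p) * D i \<tau> p"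
  using assms by (intro D_fun_\<tau> smooth_on_deriv I; simp)+

lemma sm_Q: "sm Q" and sm_Y: "sm Y"
  by (simp_all add: Q_def Y_def[abs_def] sm_B sm_trace smM_S sm_\<tau>)

lemma Ric_sym: assumes "p \<in> W" shows "transpose (Ric p) = Ric p"
proof -
  have "Ric p = \<sigma> p *\<^sub>R G p - \<alpha> (\<tau> p) *\<^sub>R H \<tau> p" using eq[OF assms] by (simp add: algebra_simps)
  then show ?thesis by (simp add: transpose_distribs transpose_scalar G_sym H_sym sm_\<tau> assms)
qed

text \<open>At points with \<open>\<alpha> \<noteq> 0\<close> this follows from the equation and the Hermitian symmetry of the Ricci
  tensor; the other points are reached by continuity.\<close>

lemma H_hermitian:
  assumes "p \<in> W"
  shows "transpose (J p) ** H \<tau> p ** J p = H \<tau> p"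
proof -
  define K where "K q = transpose (J q) ** H \<tau> q ** J q - H \<tau> q" for q
  have K0: "K q = 0" if q: "q \<in> W" "\<alpha> (\<tau> q) \<noteq> 0" for q
  proof -
    have H: "\<alpha> (\<tau> q) *\<^sub>R H \<tau> q = \<sigma> q *\<^sub>R G q - Ric q" using eq[OF q(1)] by (simp add: algebra_simps)
    have "\<alpha> (\<tau> q) *\<^sub>R (transpose (J q) ** H \<tau> q ** J q) = transpose (J q) ** (\<alpha> (\<tau> q) *\<^sub>R H \<tau> q) ** J q"
      by (simp add: matrix_scaleR_distribs)
    also have "\<dots> = \<alpha> (\<tau> q) *\<^sub>R H \<tau> q"
      unfolding H by (simp add: matrix_distribs matrix_scaleR_distribs J_G_J Ric_hermitian q)
    finally show ?thesis using q(2) by (simp add: K_def)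
  qed
  have "K p $ a $ b = 0" for a b
  proof (rule ccontr)
    assume n: "K p $ a $ b \<noteq> 0"
    have "smM K" unfolding K_def[abs_def] by (intro smM_intros smM_J smM_H sm_\<tau>)
    then have "continuous_on W (\<lambda>q. K q $ a $ b)" by (simp add: smM_def sm_continuous_on)
    moreover have "open (- {0 :: real})" by (simp add: open_Compl)
    ultimately have o: "open ((\<lambda>q. K q $ a $ b) -` (- {0}) \<inter> W)"
      using continuous_on_open_vimage[OF open_W] by blast
    have "p \<in> (\<lambda>q. K q $ a $ b) -` (- {0}) \<inter> W" "p \<in> closure {p \<in> W. \<alpha> (\<tau> p) \<noteq> 0}"
      using n assms dense by auto
    then have "((\<lambda>q. K q $ a $ b) -` (- {0}) \<inter> W) \<inter> {p \<in> W. \<alpha> (\<tau> p) \<noteq> 0} \<noteq> {}"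
      using open_Int_closure_eq_empty[OF o, of "{p \<in> W. \<alpha> (\<tau> p) \<noteq> 0}"] by blast
    then obtain q where "q \<in> W" "\<alpha> (\<tau> q) \<noteq> 0" "K q $ a $ b \<noteq> 0" by blast
    with K0[of q] show False by simp
  qed
  then have "K p = 0" by (simp add: vec_eq_iff)
  then show ?thesis by (simp add: K_def)
qed

text \<open>No smoothness of \<sigma> is assumed; the trace of the equation expresses it through
  smooth functions, 4 being the trace of the identity.\<close>

lemma sm_\<sigma>: "sm \<sigma>"
proof -
  have e: "\<sigma> p = trace (Gi p ** H \<tau> p) * \<alpha> (\<tau> p) / 4 + trace (Gi p ** Ric p) / 4" if "p \<in> W" for p
  proof -
    have "trace (Gi p ** (\<alpha> (\<tau> p) *\<^sub>R H \<tau> p + Ric p)) = 4 * \<sigma> p"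
      unfolding eq[OF that] by (simp add: matrix_scaleR_distribs Gi_G that trace_I dim4)
    then have "\<alpha> (\<tau> p) * trace (Gi p ** H \<tau> p) + trace (Gi p ** Ric p) = 4 * \<sigma> p"
      by (simp add: matrix_distribs trace_add matrix_scaleR_distribs)
    then show ?thesis by (simp add: mult.commute)
  qed
  have "sm (\<lambda>p. trace (Gi p ** H \<tau> p) * \<alpha> (\<tau> p) / 4 + trace (Gi p ** Ric p) / 4)"
    by (intro sm_intros sm_divide sm_trace smM_mult smM_Gi smM_H smM_Ric sm_\<alpha> sm_\<tau>) auto
  with sm_cong[OF e] show ?thesis by simp
qed

lemma D_Q: "p \<in> W \<Longrightarrow> D i Q p = 2 * (H \<tau> p *v grad \<tau> p) $ i"
  by (simp add: Q_def D_B sm_\<tau>)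

lemma d_sigma_1:
  assumes p: "p \<in> W"
  shows "2 * \<sigma> p * D i \<tau> p = \<alpha> (\<tau> p) * D i Q p - D i Y p"
proof -
  have "\<alpha> (\<tau> p) *\<^sub>R (H \<tau> p *v grad \<tau> p) + Ric p *v grad \<tau> p = \<sigma> p *\<^sub>R df \<tau> p"
    using arg_cong[OF eq[OF p], of "\<lambda>M. M *v grad \<tau> p"]
    by (simp add: matrix_vector_mult_add_rdistrib matrix_scaleR_distribs G_grad p)
  from arg_cong[OF this, of "\<lambda>v. v $ i"]
  have "\<alpha> (\<tau> p) * (H \<tau> p *v grad \<tau> p) $ i + (Ric p *v grad \<tau> p) $ i = \<sigma> p * D i \<tau> p" by simp
  moreover have "2 * (Ric p *v grad \<tau> p) $ i = - D i Y p"
    unfolding Y_def[abs_def] by (rule ricci_gradient[OF sm_\<tau> H_hermitian p Ric_sym[OF p]])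
  ultimately show ?thesis using D_Q[OF p, of i] by (simp add: algebra_simps)
qed

text \<open>The Kaehler form, the Ricci form and the form of the Hessian are closed, so the exterior derivative
  of the equation is \<open>d\<alpha> \<and> H(\<cdot>, J \<cdot>) = d\<sigma> \<and> g(\<cdot>, J \<cdot>)\<close>, which is then contracted.\<close>

lemma d_sigma_2:
  assumes p: "p \<in> W"
  shows "2 * D k \<sigma> p = deriv \<alpha> (\<tau> p) * (Y p * D k \<tau> p - D k Q p)"
proof -
  let ?h = "\<lambda>q. H \<tau> q ** J q" and ?r = "\<lambda>q. Ric q ** J q" and ?w = "\<lambda>q. G q ** J q"
  define a where "a = deriv \<alpha> (\<tau> p) *\<^sub>R df \<tau> p"
  define b where "b = df \<sigma> p"
  have eqJ: "\<alpha> (\<tau> q) * ?h q $ i $ j + ?r q $ i $ j = \<sigma> q * ?w q $ i $ j" if "q \<in> W" for q i j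
    using arg_cong[OF eq[OF that], of "\<lambda>M. (M ** J q) $ i $ j"]
    by (simp add: matrix_distribs matrix_scaleR_distribs)
  have sm: "sm (\<lambda>q. ?h q $ i $ j)" "sm (\<lambda>q. ?r q $ i $ j)" "sm (\<lambda>q. ?w q $ i $ j)" for i j
    using smM_mult[OF smM_H[OF sm_\<tau>] smM_J] smM_mult[OF smM_Ric smM_J] smM_mult[OF smM_G smM_J]
    by (simp_all add: smM_def)
  have d: "a $ k * ?h p $ i $ j + \<alpha> (\<tau> p) * DM k ?h p $ i $ j + DM k ?r p $ i $ j =
      b $ k * ?w p $ i $ j + \<sigma> p * DM k ?w p $ i $ j" for i j k
  proof -
    have "D k (\<lambda>q. \<alpha> (\<tau> q) * ?h q $ i $ j + ?r q $ i $ j) p = D k (\<lambda>q. \<sigma> q * ?w q $ i $ j) p"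
      by (rule D_cong) (simp_all add: eqJ p)
    then show ?thesis
      by (simp add: D_add D_mult sm sm_mult sm_\<alpha> sm_\<sigma> p D_\<alpha> DM_def a_def b_def)
  qed
  have c: "DM k T p $ i $ j + DM i T p $ j $ k + DM j T p $ k $ i = 0" if "closed_form T" for T i j k
    using that p by (simp add: closed_form_def)
  have wedge: "a $ k * ?h p $ i $ j + a $ i * ?h p $ j $ k + a $ j * ?h p $ k $ i =
      b $ k * ?w p $ i $ j + b $ i * ?w p $ j $ k + b $ j * ?w p $ k $ i" for i j k
  proof -
    have "\<alpha> (\<tau> p) * (DM k ?h p $ i $ j + DM i ?h p $ j $ k + DM j ?h p $ k $ i) = 0"
      "DM k ?r p $ i $ j + DM i ?r p $ j $ k + DM j ?r p $ k $ i = 0"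
      "\<sigma> p * (DM k ?w p $ i $ j + DM i ?w p $ j $ k + DM j ?w p $ k $ i) = 0"
      using c[OF closed_hessian_form[OF sm_\<tau> H_hermitian]] c[OF closed_ricci_form[OF Ric_sym]]
        c[OF closed_kaehler_form] by simp_all
    then show ?thesis
      using d[of k i j] d[of i j k] d[of j k i] unfolding distrib_left by linarith
  qed
  \<comment> \<open>The contraction with M = S on the left and M = 1 on the right. The dimension
    enters here: the right-hand side is 4b - 2b = 2b.\<close>
  have "trace (S \<tau> p) * a $ k - 2 * (transpose (S \<tau> p) *v a) $ k =
      trace (mat 1 :: real^'n^'n) * b $ k - 2 * (transpose (mat 1) *v b) $ k"
    using contract_wedge[OF p S_J[OF p H_hermitian[OF p]], of a k]
      contract_wedge[OF p, of "mat 1" b k] wedge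
    by (simp add: G_S p H_sym sm_\<tau> G_sym del: transpose_matrix_vector)
  then have "Y p * a $ k - 2 * (transpose (S \<tau> p) *v a) $ k = 2 * b $ k"
    by (simp add: Y_def trace_I dim4 del: transpose_matrix_vector)
  moreover have "transpose (S \<tau> p) *v a = deriv \<alpha> (\<tau> p) *\<^sub>R (H \<tau> p *v grad \<tau> p)"
  proof -
    have "transpose (S \<tau> p) *v df \<tau> p = transpose (S \<tau> p) *v (G p *v grad \<tau> p)"
      by (simp only: G_grad[OF p])
    also have "\<dots> = transpose (G p ** S \<tau> p) *v grad \<tau> p"
      by (simp add: matrix_transpose_mul G_sym p matrix_vector_mul_assoc del: transpose_matrix_vector)
    finally have "transpose (S \<tau> p) *v df \<tau> p = H \<tau> p *v grad \<tau> p"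
      by (simp only: G_S[OF p] H_sym[OF sm_\<tau> p])
    then show ?thesis by (simp add: a_def matrix_vector_mult_scaleR del: transpose_matrix_vector)
  qed
  ultimately have "Y p * a $ k - 2 * (deriv \<alpha> (\<tau> p) *\<^sub>R (H \<tau> p *v grad \<tau> p)) $ k = 2 * b $ k"
    by simp
  then show ?thesis
    by (simp add: D_Q[OF p] a_def b_def algebra_simps)
qed

section \<open>The scalars F and F' and the differential equation for \<alpha>\<close>

definition F :: "'m \<Rightarrow> real" where "F p = Y p - \<alpha> (\<tau> p) * Q p"
definition F' :: "'m \<Rightarrow> real" where "F' p = - (2 * \<sigma> p + Q p * deriv \<alpha> (\<tau> p))"

lemma sm_F: "sm F" and sm_F': "sm F'"
  unfolding F_def[abs_def] F'_def[abs_def] by (intro sm_intros sm_\<alpha> sm_Q sm_Y sm_\<sigma>)+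

lemma D_F: "p \<in> W \<Longrightarrow> D i F p = F' p * D i \<tau> p"
  using d_sigma_1[of p i]
  by (simp add: F_def[abs_def] F'_def D_diff D_mult sm_mult sm_\<alpha> sm_Q sm_Y D_\<alpha> algebra_simps)

lemma D_F':
  assumes p: "p \<in> W"
  shows "D i F' p = - (Y p * deriv \<alpha> (\<tau> p) + Q p * deriv (deriv \<alpha>) (\<tau> p)) * D i \<tau> p"
proof -
  have "D i F' p = - (2 * D i \<sigma> p + D i Q p * deriv \<alpha> (\<tau> p) + Q p * (deriv (deriv \<alpha>) (\<tau> p) * D i \<tau> p))"
    unfolding F'_def[abs_def]
    by (subst D_uminus)
      (simp_all add: D_add D_mult sm_add sm_mult sm_\<alpha> sm_Q sm_\<sigma> sm_const D_const D_\<alpha> p)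
  then show ?thesis using d_sigma_2[OF p, of i] by (simp add: algebra_simps)
qed

text \<open>A consequence of the symmetry of the second derivatives of \<open>F'\<close>.\<close>

lemma alpha_equation:
  assumes p: "p \<in> W" and w: "D i Q p * D j \<tau> p - D j Q p * D i \<tau> p \<noteq> 0"
  shows "deriv (deriv \<alpha>) (\<tau> p) + \<alpha> (\<tau> p) * deriv \<alpha> (\<tau> p) = 0"
proof -
  define K where "K q = Y q * deriv \<alpha> (\<tau> q) + Q q * deriv (deriv \<alpha>) (\<tau> q)" for q
  have sm_K: "sm K" unfolding K_def[abs_def] by (intro sm_intros sm_\<alpha> sm_Q sm_Y)
  have *: "D i (D j F') p = - (D i K p * D j \<tau> p + K p * D i (D j \<tau>) p)" for i j
  proof -
    have "D i (D j F') p = D i (\<lambda>q. - (K q * D j \<tau> q)) p"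
      by (rule D_cong) (use p in \<open>auto simp: D_F' K_def algebra_simps\<close>)
    then show ?thesis by (simp add: D_uminus D_mult sm_mult sm_D sm_K sm_\<tau> p)
  qed
  have sym: "D i K p * D j \<tau> p = D j K p * D i \<tau> p"
    using *[of i j] *[of j i] D_commute[OF sm_F' p, of i j] D_commute[OF sm_\<tau> p, of i j] by simp
  \<comment> \<open>Write dK = a dQ + b d\<tau>. Since \<open>sym\<close> says that dK \<and>
    d\<tau> = 0, the coefficient b disappears and a dQ \<and> d\<tau> = 0 remains.\<close>
  define a where "a = deriv (deriv \<alpha>) (\<tau> p) + \<alpha> (\<tau> p) * deriv \<alpha> (\<tau> p)"
  define b where "b = Y p * deriv (deriv \<alpha>) (\<tau> p) + Q p * deriv (deriv (deriv \<alpha>)) (\<tau> p)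
    - 2 * \<sigma> p * deriv \<alpha> (\<tau> p)"
  have DK: "D i K p = a * D i Q p + b * D i \<tau> p" for i
  proof -
    have "D i Y p = \<alpha> (\<tau> p) * D i Q p - 2 * \<sigma> p * D i \<tau> p"
      using d_sigma_1[OF p, of i] by simp
    then show ?thesis
      by (simp add: K_def[abs_def] D_add D_mult sm_mult sm_\<alpha> sm_Q sm_Y D_\<alpha> p a_def b_def)
        (simp add: algebra_simps)
  qed
  have "a * (D i Q p * D j \<tau> p - D j Q p * D i \<tau> p) = 0"
    using sym unfolding DK by (simp add: algebra_simps)
  with w show ?thesis by (simp add: a_def)
qed

lemma D_F'_alpha:
  assumes "p \<in> W" "deriv (deriv \<alpha>) (\<tau> p) + \<alpha> (\<tau> p) * deriv \<alpha> (\<tau> p) = 0"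
  shows "D i F' p = - deriv \<alpha> (\<tau> p) * F p * D i \<tau> p"
proof -
  have "deriv (deriv \<alpha>) (\<tau> p) = - \<alpha> (\<tau> p) * deriv \<alpha> (\<tau> p)" using assms(2) by simp
  then show ?thesis by (simp add: D_F' assms(1) F_def algebra_simps)
qed

section \<open>Laplacian of a function of \<tau>, and trace of the Ricci tensor\<close>

lemma H_compose:
  assumes "smooth_on I \<beta>" "p \<in> W"
  shows "H (\<lambda>q. \<beta> (\<tau> q)) p $ i $ j =
    deriv \<beta> (\<tau> p) * H \<tau> p $ i $ j + deriv (deriv \<beta>) (\<tau> p) * (D i \<tau> p * D j \<tau> p)"
proof -
  have "D i (D j (\<lambda>q. \<beta> (\<tau> q))) p = D i (\<lambda>q. deriv \<beta> (\<tau> q) * D j \<tau> q) p"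
    by (rule D_cong) (simp_all add: D_fun_\<tau> assms)
  also have "\<dots> = deriv (deriv \<beta>) (\<tau> p) * D i \<tau> p * D j \<tau> p + deriv \<beta> (\<tau> p) * D i (D j \<tau>) p"
    using assms I(1) by (simp add: D_mult sm_fun_\<tau> smooth_on_deriv sm_D sm_\<tau> D_fun_\<tau>)
  finally show ?thesis
    by (simp add: H_nth D_fun_\<tau> assms right_diff_distrib sum_distrib_left ac_simps)
qed

lemma trace_S_compose:
  assumes "smooth_on I \<beta>" "p \<in> W"
  shows "trace (S (\<lambda>q. \<beta> (\<tau> q)) p) = deriv \<beta> (\<tau> p) * Y p + deriv (deriv \<beta>) (\<tau> p) * Q p"
proof -
  have "trace (S (\<lambda>q. \<beta> (\<tau> q)) p) =
      (\<Sum>i\<in>UNIV. \<Sum>k\<in>UNIV. deriv \<beta> (\<tau> p) * (Gi p $ i $ k * H \<tau> p $ k $ i) +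
        deriv (deriv \<beta>) (\<tau> p) * (D k \<tau> p * Gi p $ i $ k * D i \<tau> p))"
    by (simp add: S_def trace_def matrix_matrix_mult_def H_compose[OF assms] algebra_simps)
  also have "\<dots> = deriv \<beta> (\<tau> p) * Y p +
      deriv (deriv \<beta>) (\<tau> p) * (\<Sum>i\<in>UNIV. (\<Sum>k\<in>UNIV. Gi p $ i $ k * D k \<tau> p) * D i \<tau> p)"
    by (simp add: Y_def S_def trace_def matrix_matrix_mult_def sum.distrib sum_distrib_left sum_distrib_right ac_simps)
  also have "(\<Sum>i\<in>UNIV. (\<Sum>k\<in>UNIV. Gi p $ i $ k * D k \<tau> p) * D i \<tau> p) = Q p"
    by (simp add: Q_def B_eq assms grad_eq matrix_vector_mult_def)
  finally show ?thesis .
qed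

lemma trace_Gi_Ric: "p \<in> W \<Longrightarrow> trace (Gi p ** Ric p) = 4 * \<sigma> p - \<alpha> (\<tau> p) * Y p"
proof -
  assume p: "p \<in> W"
  have "trace (Gi p ** (\<alpha> (\<tau> p) *\<^sub>R H \<tau> p + Ric p)) = 4 * \<sigma> p"
    unfolding eq[OF p] by (simp add: matrix_scaleR_distribs Gi_G p trace_I dim4)
  then show ?thesis by (simp add: matrix_distribs trace_add matrix_scaleR_distribs Y_def S_def)
qed

end

section \<open>Solutions of the Riccati equation\<close>

text \<open>Integrating factor: w exp(-h) is constant for an antiderivative h of b. As T is only
  known to be connected, h is taken on the compact interval between t0 and t.\<close>

lemma linear_ode_zero:
  fixes w b :: "real \<Rightarrow> real"
  assumes T: "connected T" "t0 \<in> T" "t \<in> T" and b: "continuous_on T b"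
    and w: "\<And>x. x \<in> T \<Longrightarrow> (w has_real_derivative b x * w x) (at x)" and "w t0 = 0"
  shows "w t = 0"
proof -
  define l u where "l = min t0 t" and "u = max t0 t"
  have sub: "{l..u} \<subseteq> T"
    using T unfolding connected_iff_interval l_def u_def
    by (metis atLeastAtMost_iff max_def min_def subsetI)
  have "continuous_on {l..u} b" using b sub continuous_on_subset by blast
  then obtain h where h: "\<And>x. x \<in> {l..u} \<Longrightarrow> (h has_vector_derivative b x) (at x within {l..u})"
    by (rule antiderivative_continuous) blast
  have "((\<lambda>x. w x * exp (- h x)) has_real_derivative 0) (at x within {l..u})" if x: "x \<in> {l..u}" for x
  proof -
    have "(h has_real_derivative b x) (at x within {l..u})"
      using h[OF x] by (simp add: has_real_derivative_iff_has_vector_derivative)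
    moreover have "(w has_real_derivative b x * w x) (at x within {l..u})"
      using w sub x has_field_derivative_at_within by blast
    ultimately have "((\<lambda>x. w x * exp (- h x)) has_real_derivative
        b x * w x * exp (- h x) + exp (- h x) * (- b x) * w x) (at x within {l..u})"
      by (auto intro!: derivative_eq_intros)
    then show ?thesis by (simp add: algebra_simps)
  qed
  then obtain C where C: "\<And>x. x \<in> {l..u} \<Longrightarrow> w x * exp (- h x) = C"
    using has_field_derivative_zero_constant[of "{l..u}" "\<lambda>x. w x * exp (- h x)"] by blast
  have "t0 \<in> {l..u}" "t \<in> {l..u}" by (auto simp: l_def u_def)
  with C[of t0] C[of t] \<open>w t0 = 0\<close> show ?thesis by simp
qed

text \<open>The substitution \<open>\<alpha> = 2 u' / u\<close> linearizes the Riccati equation to \<open>u'' = \<epsilon> u\<close>.\<close>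

lemma riccati_linearized:
  fixes \<alpha> u u' :: "real \<Rightarrow> real"
  assumes T: "connected T" "t0 \<in> T" "t \<in> T"
    and \<alpha>: "\<And>x. x \<in> T \<Longrightarrow> (\<alpha> has_real_derivative (4 * \<epsilon> - (\<alpha> x)\<^sup>2) / 2) (at x)"
    and u: "\<And>x. (u has_real_derivative u' x) (at x)" "\<And>x. (u' has_real_derivative \<epsilon> * u x) (at x)"
    and "\<alpha> t0 * u t0 = 2 * u' t0"
  shows "\<alpha> t * u t = 2 * u' t"
proof -
  \<comment> \<open>The difference w solves w' = -\<alpha> w / 2. Working with \<alpha>u - 2u'
    instead of the quotient admits zeros of u.\<close>
  have "(\<lambda>x. \<alpha> x * u x - 2 * u' x) t = 0"
  proof (rule linear_ode_zero[OF T])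
    show "continuous_on T (\<lambda>x. - \<alpha> x / 2)"
      using \<alpha> by (intro continuous_intros) (auto intro!: continuous_at_imp_continuous_on DERIV_isCont)
    show "((\<lambda>x. \<alpha> x * u x - 2 * u' x) has_real_derivative - \<alpha> x / 2 * (\<alpha> x * u x - 2 * u' x)) (at x)"
      if "x \<in> T" for x
    proof -
      have "((\<lambda>x. \<alpha> x * u x - 2 * u' x) has_real_derivative
          (4 * \<epsilon> - (\<alpha> x)\<^sup>2) / 2 * u x + u' x * \<alpha> x - 2 * (\<epsilon> * u x)) (at x)"
        by (intro DERIV_diff DERIV_mult DERIV_cmult \<alpha> u that)
      then show ?thesis by (rule DERIV_cong) (simp add: field_simps power2_eq_square)
    qed
    show "\<alpha> t0 * u t0 - 2 * u' t0 = 0" using assms(7) by simp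
  qed
  then show ?thesis by simp
qed

text \<open>Here u = t - t1, with t1 fitted to the value at t0. The product form of the conclusion
  also shows that \<alpha> has no zero on T.\<close>

lemma riccati_zero:
  fixes \<alpha> :: "real \<Rightarrow> real"
  assumes T: "connected T" "t0 \<in> T"
    and \<alpha>: "\<And>x. x \<in> T \<Longrightarrow> (\<alpha> has_real_derivative - (\<alpha> x)\<^sup>2 / 2) (at x)"
    and "\<alpha> t0 \<noteq> 0"
  obtains t1 where "\<And>t. t \<in> T \<Longrightarrow> \<alpha> t * (t - t1) = 2"
proof
  fix t assume t: "t \<in> T"
  have "\<alpha> t * (t - (t0 - 2 / \<alpha> t0)) = 2 * 1"
    by (rule riccati_linearized[OF T t, where \<epsilon> = 0])
      (use \<alpha> assms(4) in \<open>auto intro!: derivative_eq_intros\<close>)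
  then show "\<alpha> t * (t - (t0 - 2 / \<alpha> t0)) = 2" by simp
qed

lemma affine_mod_apply: "c \<noteq> 0 \<Longrightarrow> affine_mod c b \<alpha> (b + t / c) = c * \<alpha> t"
  by (simp add: affine_mod_def distrib_left)

text \<open>The sign of \<epsilon> and the value at t0 select a solution u of u'' = \<epsilon>u; the
  scaling by c makes \<epsilon> equal to 1 or -1 unless it is 0. The denominators sin and sinh do
  not vanish, for \<alpha>u = 2u' would force u' to vanish as well. The hypothesis \<open>nz\<close>
  excludes \<alpha> = 0, which is not in the list.\<close>

lemma riccati_normal_form:
  fixes \<alpha> :: "real \<Rightarrow> real"
  assumes T: "connected T" "t0 \<in> T"
    and \<alpha>: "\<And>x. x \<in> T \<Longrightarrow> (\<alpha> has_real_derivative (4 * \<epsilon> - (\<alpha> x)\<^sup>2) / 2) (at x)"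
    and nz: "\<epsilon> = 0 \<Longrightarrow> \<alpha> t0 \<noteq> 0"
  obtains c b where "c \<noteq> 0" "normal_form ((\<lambda>t. b + t / c) ` T) (affine_mod c b \<alpha>) (c\<^sup>2 * \<epsilon>)"
proof -
  have lin: "\<alpha> t * u t = 2 * u' t"
    if "t \<in> T" "\<And>x. (u has_real_derivative u' x) (at x)"
      "\<And>x. (u' has_real_derivative \<epsilon> * u x) (at x)" "\<alpha> t0 * u t0 = 2 * u' t0" for u u' t
    using riccati_linearized[where \<alpha> = \<alpha> and u = u and u' = u' and \<epsilon> = \<epsilon>, OF T that(1) \<alpha> that(2-4)]
    by simp
  consider "\<epsilon> = 0" | "\<epsilon> < 0" | "\<epsilon> > 0" by linarith
  then show thesis
  proof cases
    case 1
    have d: "\<And>x. x \<in> T \<Longrightarrow> (\<alpha> has_real_derivative - (\<alpha> x)\<^sup>2 / 2) (at x)" using \<alpha> 1 by simp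
    obtain t1 where t1: "\<And>t. t \<in> T \<Longrightarrow> \<alpha> t * (t - t1) = 2"
      using riccati_zero[where \<alpha> = \<alpha>, OF T d nz[OF 1]] by blast
    have "- t1 + t / 1 \<noteq> 0 \<and> affine_mod 1 (- t1) \<alpha> (- t1 + t / 1) = 2 / (- t1 + t / 1)" if "t \<in> T" for t
    proof -
      have "t - t1 \<noteq> 0" using t1[OF that] by auto
      then show ?thesis
        using t1[OF that] affine_mod_apply[of 1 "- t1" \<alpha> t] by (simp add: field_simps)
    qed
    then show thesis using 1 by (intro that[of 1 "- t1"]) (auto simp: normal_form_def)
  next
    case 2
    define k where "k = sqrt (- \<epsilon>)"
    have k: "k > 0" "\<epsilon> = - k\<^sup>2" using 2 by (auto simp: k_def)
    have am: "affine_mod (1 / k) b \<alpha> (b + t / (1 / k)) = \<alpha> t / k" for b t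
      using affine_mod_apply[of "1 / k" b \<alpha> t] k(1) by simp
    have arg: "b + t / (1 / k) = k * t + b" for b t by simp
    \<comment> \<open>The phase b is chosen so that cot (k t0 + b) = tan x is the prescribed value
      of \<alpha> / (2k) at t0.\<close>
    define x where "x = arctan (\<alpha> t0 / (2 * k))"
    define b where "b = pi / 2 - x - k * t0"
    have u: "((\<lambda>t. sin (k * t + b)) has_real_derivative k * cos (k * t + b)) (at t)"
      "((\<lambda>t. k * cos (k * t + b)) has_real_derivative \<epsilon> * sin (k * t + b)) (at t)" for t
      by (auto intro!: derivative_eq_intros simp: k(2) power2_eq_square)
    have "k * t0 + b = pi / 2 - x" by (simp add: b_def)
    then have sc: "sin (k * t0 + b) = cos x" "cos (k * t0 + b) = sin x"
      by (simp_all only: sin_diff cos_diff) simp_all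
    have "\<alpha> t0 / (2 * k) = sin x / cos x" "cos x \<noteq> 0"
      unfolding x_def using tan_arctan[of "\<alpha> t0 / (2 * k)"] by (simp_all add: tan_def)
    then have "\<alpha> t0 * sin (k * t0 + b) = 2 * (k * cos (k * t0 + b))"
      unfolding sc using k(1) by (simp add: field_simps)
    then have l: "\<alpha> t * sin (k * t + b) = 2 * (k * cos (k * t + b))" if "t \<in> T" for t
      using lin[OF that u] by blast
    have "sin (b + t / (1 / k)) \<noteq> 0 \<and> affine_mod (1 / k) b \<alpha> (b + t / (1 / k)) = 2 * cot (b + t / (1 / k))"
      if "t \<in> T" for t
    proof -
      have "sin (k * t + b) \<noteq> 0"
      proof
        assume s: "sin (k * t + b) = 0"
        with l[OF that] k(1) have "cos (k * t + b) = 0" by simp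
        with s sin_cos_squared_add[of "k * t + b"] show False by simp
      qed
      moreover from this have "\<alpha> t / k = 2 * cot (k * t + b)"
        using l[OF that] k(1) by (simp add: cot_def field_simps)
      ultimately show ?thesis unfolding am unfolding arg by blast
    qed
    then show thesis
      using k by (intro that[of "1 / k" b]) (auto simp: normal_form_def power_divide)
  next
    case 3
    define k where "k = sqrt \<epsilon>"
    have k: "k > 0" "\<epsilon> = k\<^sup>2" using 3 by (auto simp: k_def)
    have am: "affine_mod (1 / k) b \<alpha> (b + t / (1 / k)) = \<alpha> t / k" for b t
      using affine_mod_apply[of "1 / k" b \<alpha> t] k(1) by simp
    have arg: "b + t / (1 / k) = k * t + b" for b t by simp
    have e1: "(1 / k)\<^sup>2 * \<epsilon> = 1" "(- 1 / k)\<^sup>2 * \<epsilon> = 1" using k by (simp_all add: power_divide)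
    have artanh: "\<exists>y. tanh y = m" if "\<bar>m\<bar> < 1" for m :: real
    proof
      have e: "exp (- 2 * (ln x / 2)) = inverse x" if "x > 0" for x :: real
        using that by (simp add: exp_minus)
      have "0 < (1 + m) / (1 - m)" using that by (simp add: abs_less_iff)
      from e[OF this] show "tanh (ln ((1 + m) / (1 - m)) / 2) = m"
        unfolding tanh_real_altdef using that by (simp only:) (simp add: field_simps abs_less_iff)
    qed
    \<comment> \<open>The values 1 and -1 are the equilibria, giving constant \<alpha>; a negative c
      turns the second into the first. Initial values between them give tanh, those outside give
      coth.\<close>
    define m where "m = \<alpha> t0 / (2 * k)"
    consider "m = 1" | "m = -1" | "\<bar>m\<bar> < 1" | "\<bar>1 / m\<bar> < 1" "m \<noteq> 0"
    proof -
      have "\<bar>1 / m\<bar> < 1" "m \<noteq> 0" if "\<not> \<bar>m\<bar> \<le> 1"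
        using that by (auto simp: divide_simps)
      moreover have "m = 1 \<or> m = -1 \<or> \<bar>m\<bar> < 1 \<or> \<not> \<bar>m\<bar> \<le> 1" by linarith
      ultimately show thesis using that by blast
    qed
    then show thesis
    proof cases
      case 1
      have "((\<lambda>t. exp (k * t)) has_real_derivative k * exp (k * t)) (at t)"
        "((\<lambda>t. k * exp (k * t)) has_real_derivative \<epsilon> * exp (k * t)) (at t)" for t
        by (auto intro!: derivative_eq_intros simp: k(2) power2_eq_square)
      moreover have "\<alpha> t0 * exp (k * t0) = 2 * (k * exp (k * t0))"
        using 1 k(1) by (simp add: m_def field_simps)
      ultimately have "\<alpha> t * exp (k * t) = 2 * (k * exp (k * t))" if "t \<in> T" for t
        using lin[OF that, of "\<lambda>t. exp (k * t)" "\<lambda>t. k * exp (k * t)"] by blast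
      then have "affine_mod (1 / k) 0 \<alpha> (0 + t / (1 / k)) = 2" if "t \<in> T" for t
        unfolding am using that k(1) by simp
      then show thesis
        using k(1) e1 by (intro that[of "1 / k" 0]) (auto simp: normal_form_def)
    next
      case 2
      have "((\<lambda>t. exp (- k * t)) has_real_derivative - k * exp (- k * t)) (at t)"
        "((\<lambda>t. - k * exp (- k * t)) has_real_derivative \<epsilon> * exp (- k * t)) (at t)" for t
        by (auto intro!: derivative_eq_intros simp: k(2) power2_eq_square)
      moreover have "\<alpha> t0 * exp (- k * t0) = 2 * (- k * exp (- k * t0))"
        using 2 k(1) by (simp add: m_def field_simps)
      ultimately have l: "\<alpha> t * exp (- k * t) = 2 * (- k * exp (- k * t))" if "t \<in> T" for t
        using lin[OF that, of "\<lambda>t. exp (- k * t)" "\<lambda>t. - k * exp (- k * t)"] by blast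
      have "\<alpha> t = 2 * (- k)" if "t \<in> T" for t
      proof -
        have "(\<alpha> t - 2 * (- k)) * exp (- k * t) = 0"
          unfolding left_diff_distrib l[OF that] by simp
        then show ?thesis by simp
      qed
      then have "affine_mod (- 1 / k) 0 \<alpha> (0 + t / (- 1 / k)) = 2" if "t \<in> T" for t
        using that affine_mod_apply[of "- 1 / k" 0 \<alpha> t] k(1) by simp
      then show thesis
        using k(1) e1 by (intro that[of "- 1 / k" 0]) (auto simp: normal_form_def)
    next
      case 3
      then obtain y where y: "tanh y = m" using artanh by blast
      define b where "b = y - k * t0"
      have u: "((\<lambda>t. cosh (k * t + b)) has_real_derivative k * sinh (k * t + b)) (at t)"
        "((\<lambda>t. k * sinh (k * t + b)) has_real_derivative \<epsilon> * cosh (k * t + b)) (at t)" for t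
        by (auto intro!: derivative_eq_intros simp: k(2) power2_eq_square)
      have "\<alpha> t0 * cosh (k * t0 + b) = 2 * (k * sinh (k * t0 + b))"
        using y k(1) cosh_real_pos[of y] by (simp add: b_def m_def tanh_def field_simps)
      then have l: "\<alpha> t * cosh (k * t + b) = 2 * (k * sinh (k * t + b))" if "t \<in> T" for t
        using lin[OF that u] by blast
      have "affine_mod (1 / k) b \<alpha> (b + t / (1 / k)) = 2 * tanh (b + t / (1 / k))" if "t \<in> T" for t
        unfolding am unfolding arg
        using l[OF that] k(1) cosh_real_pos[of "k * t + b"] by (simp add: tanh_def field_simps)
      then show thesis
        using k(1) e1 by (intro that[of "1 / k" b]) (auto simp: normal_form_def)
    next
      case 4
      then obtain y where y: "tanh y = 1 / m" using artanh by blast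
      \<comment> \<open>With tanh y = 1 / m the function coth (k t + b) takes the value m at
        t0.\<close>
      define b where "b = y - k * t0"
      have u: "((\<lambda>t. sinh (k * t + b)) has_real_derivative k * cosh (k * t + b)) (at t)"
        "((\<lambda>t. k * cosh (k * t + b)) has_real_derivative \<epsilon> * sinh (k * t + b)) (at t)" for t
        by (auto intro!: derivative_eq_intros simp: k(2) power2_eq_square)
      have "\<alpha> t0 \<noteq> 0" using 4 by (auto simp: m_def)
      then have "\<alpha> t0 * sinh (k * t0 + b) = 2 * (k * cosh (k * t0 + b))"
        using y k(1) cosh_real_pos[of y] by (simp add: b_def m_def tanh_def field_simps)
      then have l: "\<alpha> t * sinh (k * t + b) = 2 * (k * cosh (k * t + b))" if "t \<in> T" for t
        using lin[OF that u] by blast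
      have "b + t / (1 / k) \<noteq> 0 \<and>
          affine_mod (1 / k) b \<alpha> (b + t / (1 / k)) = 2 * (cosh (b + t / (1 / k)) / sinh (b + t / (1 / k)))"
        if "t \<in> T" for t
      proof -
        have "sinh (k * t + b) \<noteq> 0"
          using l[OF that] k(1) cosh_real_pos[of "k * t + b"] by auto
        moreover from this have "\<alpha> t / k = 2 * (cosh (k * t + b) / sinh (k * t + b))"
          using l[OF that] k(1) by (simp add: field_simps)
        ultimately show ?thesis unfolding am unfolding arg by auto
      qed
      then show thesis
        using k(1) e1 by (intro that[of "1 / k" b]) (auto simp: normal_form_def)
    qed
  qed
qed

text \<open>The second derivative depends on \<open>deriv f\<close> near t, so the formula for the
  first derivative is required on an open set.\<close>

lemma deriv_deriv_eqI:
  fixes f :: "real \<Rightarrow> real"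
  assumes S: "open S" "t \<in> S" and f: "\<And>x. x \<in> S \<Longrightarrow> (f has_real_derivative f' x) (at x)"
    and f': "(f' has_real_derivative f'') (at t)"
  shows "deriv f t = f' t" "deriv (deriv f) t = f''"
proof -
  show "deriv f t = f' t" using f S by (simp add: DERIV_imp_deriv)
  have "(deriv f has_real_derivative f'') (at t)"
    by (rule has_field_derivative_transform_within_open[OF f' S]) (use DERIV_imp_deriv[OF f] in simp)
  then show "deriv (deriv f) t = f''" by (rule DERIV_imp_deriv)
qed

section \<open>The theorem\<close>

text \<open>A vanishing differential makes h constant on a ball in a chart; connectedness of U
  spreads local constancy.\<close>

lemma constant_if_coord_derivs_zero:
  assumes A: "smooth_manifold A" and U: "open U" "connected U" "U \<subseteq> carrier_of A"
    and loc: "\<And>c. c \<in> A \<Longrightarrow> chart_region.sm c (U \<inter> chart_dom c) h"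
      "\<And>c p i. c \<in> A \<Longrightarrow> p \<in> U \<Longrightarrow> p \<in> chart_dom c \<Longrightarrow> coord_deriv c i h p = 0"
    and pq: "p \<in> U" "q \<in> U"
  shows "h p = h (q :: 'm::{t2_space, second_countable_topology})"
proof (rule connected_local_const[OF U(2) pq], rule ballI)
  fix p assume p: "p \<in> U"
  then obtain c where c: "c \<in> A" "p \<in> chart_dom c" using U(3) by (auto simp: carrier_of_def)
  interpret X: chart_region c "U \<inter> chart_dom c"
    using A c(1) U(1) by unfold_locales (auto simp: smooth_manifold_def is_chart_def)
  let ?W = "U \<inter> chart_dom c" and ?h = "h \<circ> chart_inv c"
  have pW: "p \<in> ?W" using p c by simp
  obtain r where r: "r > 0" "ball (chart_map c p) r \<subseteq> chart_map c ` ?W"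
    using X.open_image pW by (meson imageI openE)
  have "(?h has_derivative (\<lambda>_. 0)) (at x within ball (chart_map c p) r)" if x: "x \<in> ball (chart_map c p) r" for x
  proof -
    obtain q where q: "q \<in> ?W" "x = chart_map c q" using r(2) x by blast
    have "frechet_derivative ?h (at x) = (\<lambda>_. 0)"
      using X.frechet_eq_sum_D[OF loc(1)[OF c(1)] q(1)] loc(2)[OF c(1)] q by auto
    then show ?thesis
      using X.pullback_has_derivative[OF loc(1)[OF c(1)] q(1)] q(2) by (simp add: has_derivative_at_withinI)
  qed
  then obtain C where C: "\<And>x. x \<in> ball (chart_map c p) r \<Longrightarrow> ?h x = C"
    using has_derivative_zero_constant[OF convex_ball] by metis
  let ?N = "chart_map c -` ball (chart_map c p) r \<inter> ?W"
  have "continuous_on ?W (chart_map c)"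
    using X.chart by (auto simp: is_chart_def homeomorphism_def intro: continuous_on_subset)
  then have "open ?N"
    using continuous_on_open_vimage[OF X.open_region] open_ball by blast
  moreover have "p \<in> ?N" using pW r(1) by simp
  moreover have "h p = h q" if "q \<in> ?N" for q
    using C[of "chart_map c q"] C[of "chart_map c p"] that pW r(1) X.inv_map[of q] X.inv_map[of p] by auto
  ultimately show "\<forall>\<^sub>F q in at p within U. h p = h q"
    unfolding eventually_at_topological by blast
qed

text \<open>The scalars \<open>Y - Q \<alpha>\<close> and \<open>- (Q \<alpha>' + 2 \<sigma>)\<close> behave like a function of \<open>\<tau>\<close> and its derivative
  although the level sets of \<open>\<tau>\<close> need not be connected.\<close>

lemma ricci_hessian_scalars:
  fixes A :: "('m::{t2_space, second_countable_topology}, 4) chart set"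
    and g J :: "('m, 4) tensor2"
  assumes kaehler: "kaehler_manifold A g J"
    and tau: "smooth_fun A \<tau>"
    and alpha: "open I" "\<tau> ` carrier_of A \<subseteq> I" "smooth_on I \<alpha>"
    and eq: "\<forall>c\<in>A. \<forall>p\<in>chart_dom c.
          \<alpha> (\<tau> p) *\<^sub>R hessian g \<tau> c p + ricci g c p = \<sigma> p *\<^sub>R g c p"
    and dense: "carrier_of A \<subseteq>
          closure {p \<in> carrier_of A. nonzero_at A (\<lambda>c q. \<alpha> (\<tau> q) *\<^sub>R hessian g \<tau> c q) p}"
    and U: "open U" "U \<subseteq> carrier_of A"
  defines "Q \<equiv> grad_norm_sq A g \<tau>" and "Y \<equiv> laplacian A g \<tau>"
  assumes dQ_dtau: "\<forall>p\<in>U. nonzero_at A (wedge_differentials Q \<tau>) p"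
  defines "F \<equiv> \<lambda>p. Y p - \<alpha> (\<tau> p) * Q p" and "F' \<equiv> \<lambda>p. - (2 * \<sigma> p + Q p * deriv \<alpha> (\<tau> p))"
  shows "c \<in> A \<Longrightarrow> chart_region.sm c (U \<inter> chart_dom c) \<tau>"
    and "c \<in> A \<Longrightarrow> chart_region.sm c (U \<inter> chart_dom c) F"
    and "c \<in> A \<Longrightarrow> chart_region.sm c (U \<inter> chart_dom c) F'"
    and "p \<in> U \<Longrightarrow> deriv (deriv \<alpha>) (\<tau> p) + \<alpha> (\<tau> p) * deriv \<alpha> (\<tau> p) = 0"
    and "c \<in> A \<Longrightarrow> p \<in> U \<Longrightarrow> p \<in> chart_dom c \<Longrightarrow> coord_deriv c i F p = F' p * coord_deriv c i \<tau> p"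
    and "c \<in> A \<Longrightarrow> p \<in> U \<Longrightarrow> p \<in> chart_dom c \<Longrightarrow>
      coord_deriv c i F' p = - deriv \<alpha> (\<tau> p) * F p * coord_deriv c i \<tau> p"
    and "p \<in> U \<Longrightarrow> scalar_curvature A g p = 4 * \<sigma> p - \<alpha> (\<tau> p) * Y p"
    and "p \<in> U \<Longrightarrow> laplacian A g (\<lambda>q. \<alpha> (\<tau> q)) p = deriv \<alpha> (\<tau> p) * Y p + deriv (deriv \<alpha>) (\<tau> p) * Q p"
    and "U \<noteq> {} \<Longrightarrow> \<exists>p\<in>U. \<alpha> (\<tau> p) \<noteq> 0"
proof -
  have man: "smooth_manifold A" and met: "riemannian_metric A g"
    using kaehler by (simp_all add: kaehler_manifold_def)
  \<comment> \<open>Density passes to open subsets, and where \<alpha> times the Hessian is nonzero,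
    so is \<alpha>.\<close>
  have U_dense: "V \<subseteq> closure {p \<in> V. \<alpha> (\<tau> p) \<noteq> 0}" if V: "open V" "V \<subseteq> carrier_of A" for V
  proof -
    let ?N = "{p \<in> carrier_of A. nonzero_at A (\<lambda>c q. \<alpha> (\<tau> q) *\<^sub>R hessian g \<tau> c q) p}"
    have "V \<inter> ?N \<subseteq> {p \<in> V. \<alpha> (\<tau> p) \<noteq> 0}" by (auto simp: nonzero_at_def)
    then have "closure (V \<inter> ?N) \<subseteq> closure {p \<in> V. \<alpha> (\<tau> p) \<noteq> 0}" by (rule closure_mono)
    moreover have "V \<subseteq> V \<inter> closure ?N" using V(2) dense by blast
    ultimately show ?thesis using open_Int_closure_subset[OF V(1)] by blast
  qed
  have loc: "ricci_hessian_region A g c (U \<inter> chart_dom c) J \<tau> \<sigma> \<alpha> I" if c: "c \<in> A" for c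
  proof -
    have o: "open (U \<inter> chart_dom c)"
      using U(1) man c by (auto simp: smooth_manifold_def is_chart_def)
    interpret kaehler_region A g c "U \<inter> chart_dom c" J
      by unfold_locales (use man met c o kaehler in auto)
    show ?thesis
    proof
      show "sm \<tau>" using tau c sm_chart_imp by (simp add: smooth_fun_def)
      show "\<tau> ` (U \<inter> chart_dom c) \<subseteq> I" using alpha(2) U(2) by blast
      show "U \<inter> chart_dom c \<subseteq> closure {p \<in> U \<inter> chart_dom c. \<alpha> (\<tau> p) \<noteq> 0}"
        by (rule U_dense[OF o]) (use U(2) in blast)
    qed (use alpha eq c in \<open>simp_all add: H_def Ric_def G_def\<close>)
  qed
  have QY: "Q p = ricci_hessian_region.Q g c \<tau> p" "Y p = ricci_hessian_region.Y g c \<tau> p"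
    if c: "c \<in> A" and p: "p \<in> U" "p \<in> chart_dom c" for c p
  proof -
    interpret X: ricci_hessian_region A g c "U \<inter> chart_dom c" J \<tau> \<sigma> \<alpha> I by (rule loc[OF c])
    show "Q p = X.Q p" "Y p = X.Y p"
      using X.grad_norm_sq_eq[OF tau, of p] X.laplacian_eq[OF tau, of p] p
      by (simp_all add: Q_def Y_def X.Q_def X.Y_def)
  qed
  have FF: "F p = ricci_hessian_region.F g c \<tau> \<alpha> p" "F' p = ricci_hessian_region.F' g c \<tau> \<sigma> \<alpha> p"
    if c: "c \<in> A" and p: "p \<in> U" "p \<in> chart_dom c" for c p
  proof -
    interpret X: ricci_hessian_region A g c "U \<inter> chart_dom c" J \<tau> \<sigma> \<alpha> I by (rule loc[OF c])
    show "F p = X.F p" "F' p = X.F' p"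
      by (simp_all add: F_def F'_def X.F_def X.F'_def QY[OF c p])
  qed
  show "chart_region.sm c (U \<inter> chart_dom c) \<tau>" "chart_region.sm c (U \<inter> chart_dom c) F"
    "chart_region.sm c (U \<inter> chart_dom c) F'" if c: "c \<in> A" for c
  proof -
    interpret X: ricci_hessian_region A g c "U \<inter> chart_dom c" J \<tau> \<sigma> \<alpha> I by (rule loc[OF c])
    show "X.sm \<tau>" by (rule X.sm_\<tau>)
    have F: "F q = X.F q" "F' q = X.F' q" if "q \<in> U \<inter> chart_dom c" for q
      using FF[OF c] that by auto
    show "X.sm F" using X.sm_cong[OF F(1)] X.sm_F by simp
    show "X.sm F'" using X.sm_cong[OF F(2)] X.sm_F' by simp
  qed
  show al: "deriv (deriv \<alpha>) (\<tau> p) + \<alpha> (\<tau> p) * deriv \<alpha> (\<tau> p) = 0" if p: "p \<in> U" for p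
  proof -
    obtain c where c: "c \<in> A" "p \<in> chart_dom c" "wedge_differentials Q \<tau> c p \<noteq> 0"
      using dQ_dtau p unfolding nonzero_at_def by blast
    interpret X: ricci_hessian_region A g c "U \<inter> chart_dom c" J \<tau> \<sigma> \<alpha> I by (rule loc[OF c(1)])
    have "coord_deriv c i Q p = coord_deriv c i X.Q p" for i
      by (rule X.D_cong) (use QY(1)[OF c(1)] p c(2) in auto)
    with c(3) obtain i j where
      "coord_deriv c i X.Q p * coord_deriv c j \<tau> p - coord_deriv c j X.Q p * coord_deriv c i \<tau> p \<noteq> 0"
      by (auto simp: wedge_differentials_def vec_eq_iff)
    from X.alpha_equation[OF _ this] p c(2) show ?thesis by simp
  qed
  show "coord_deriv c i F p = F' p * coord_deriv c i \<tau> p"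
    "coord_deriv c i F' p = - deriv \<alpha> (\<tau> p) * F p * coord_deriv c i \<tau> p"
    if c: "c \<in> A" and p: "p \<in> U" "p \<in> chart_dom c" for c p i
  proof -
    interpret X: ricci_hessian_region A g c "U \<inter> chart_dom c" J \<tau> \<sigma> \<alpha> I by (rule loc[OF c])
    have "coord_deriv c i F p = coord_deriv c i X.F p" "coord_deriv c i F' p = coord_deriv c i X.F' p"
      by (rule X.D_cong; use FF[OF c] p in auto)+
    then show "coord_deriv c i F p = F' p * coord_deriv c i \<tau> p"
      "coord_deriv c i F' p = - deriv \<alpha> (\<tau> p) * F p * coord_deriv c i \<tau> p"
      using X.D_F[of p i] X.D_F'_alpha[OF _ al[OF p(1)], of i] p by (simp_all add: FF[OF c p])
  qed
  show "scalar_curvature A g p = 4 * \<sigma> p - \<alpha> (\<tau> p) * Y p"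
    "laplacian A g (\<lambda>q. \<alpha> (\<tau> q)) p = deriv \<alpha> (\<tau> p) * Y p + deriv (deriv \<alpha>) (\<tau> p) * Q p" if p: "p \<in> U" for p
  proof -
    obtain c where c: "c \<in> A" "p \<in> chart_dom c" using p U(2) by (auto simp: carrier_of_def)
    \<comment> \<open>Only values at p are needed here, so the computation runs in the very chart
      that the global definition selects at p.\<close>
    obtain d where d: "d \<in> A" "p \<in> chart_dom d" "\<And>S. invariant_value A S p = S d p"
      using invariant_value_chart[OF c] by blast
    interpret X: ricci_hessian_region A g d "U \<inter> chart_dom d" J \<tau> \<sigma> \<alpha> I by (rule loc[OF d(1)])
    show "scalar_curvature A g p = 4 * \<sigma> p - \<alpha> (\<tau> p) * Y p"
      using X.trace_Gi_Ric[of p] p d(2)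
      by (simp add: scalar_curvature_def metric_trace_def d(3) QY[OF d(1) p d(2)] X.Gi_def X.Ric_def)
    show "laplacian A g (\<lambda>q. \<alpha> (\<tau> q)) p = deriv \<alpha> (\<tau> p) * Y p + deriv (deriv \<alpha>) (\<tau> p) * Q p"
      using X.trace_S_compose[OF alpha(3), of p] p d(2)
      by (simp add: laplacian_def metric_trace_def d(3) QY[OF d(1) p d(2)] X.Gi_def X.S_def X.H_def)
  qed
  show "\<exists>p\<in>U. \<alpha> (\<tau> p) \<noteq> 0" if "U \<noteq> {}"
  proof (rule ccontr)
    assume "\<not> (\<exists>p\<in>U. \<alpha> (\<tau> p) \<noteq> 0)"
    then have "{p \<in> U. \<alpha> (\<tau> p) \<noteq> 0} = {}" by blast
    with U_dense[OF U] that show False by simp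
  qed
qed

section \<open>Derivatives of affine modifications and of the explicit F\<close>

lemma deriv_affine_mod:
  assumes "c \<noteq> 0" "(\<alpha> has_real_derivative a) (at t)"
  shows "deriv (affine_mod c b \<alpha>) (b + t / c) = c\<^sup>2 * a"
proof -
  have e: "c * (b + t / c) - c * b = t" using assms(1) by (simp add: distrib_left)
  have "((\<lambda>x. c * \<alpha> (c * x - c * b)) has_real_derivative c * (a * c)) (at (b + t / c))"
  proof (intro DERIV_cmult DERIV_chain2[of \<alpha>])
    show "(\<alpha> has_real_derivative a) (at (c * (b + t / c) - c * b))" by (simp only: e assms(2))
    show "((\<lambda>x. c * x - c * b) has_real_derivative c) (at (b + t / c))"
      by (auto intro!: derivative_eq_intros)
  qed
  then have "(affine_mod c b \<alpha> has_real_derivative c * (a * c)) (at (b + t / c))"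
    by (simp add: affine_mod_def[abs_def])
  then show ?thesis by (simp add: DERIV_imp_deriv power2_eq_square)
qed

text \<open>\<open>F_of\<close> combines two solutions of F'' + \<alpha>'F = 0: \<alpha> with 2 -
  t\<alpha>, or \<alpha> with 1/\<alpha>^2 if \<epsilon> = 0. The equations for \<alpha> are assumed
  at t only, so near t the first derivative is written with \<open>deriv \<alpha>\<close> and
  reduced at t alone.\<close>

lemma F_of_derivs:
  assumes I: "open I" "t \<in> I" and \<alpha>: "smooth_on I \<alpha>" and nz: "\<epsilon> = 0 \<Longrightarrow> \<alpha> t \<noteq> 0"
    and a: "a = \<alpha> t" and a1: "a1 = deriv \<alpha> t" and a2: "deriv (deriv \<alpha>) t = - a * a1"
    and ode: "2 * a1 + a\<^sup>2 = 4 * \<epsilon>"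
  shows "\<epsilon> \<noteq> 0 \<Longrightarrow> deriv (F_of \<epsilon> \<alpha> \<theta> \<kappa>) t = (4 * \<epsilon> * \<kappa> * a1 - \<theta> * (a + t * a1)) / (4 * \<epsilon>)"
    and "\<epsilon> = 0 \<Longrightarrow> deriv (F_of \<epsilon> \<alpha> \<theta> \<kappa>) t = - \<kappa> * a\<^sup>2 / 2 - 2 * \<theta> / (3 * a)"
    and "F_of \<epsilon> \<alpha> \<theta> \<kappa> t * a1 = - deriv (deriv (F_of \<epsilon> \<alpha> \<theta> \<kappa>)) t"
proof -
  note d\<alpha> = DERIV_smooth_on[OF \<alpha>] and d\<alpha>' = DERIV_smooth_on[OF smooth_on_deriv[OF I(1) \<alpha>]]
  have d2: "(deriv \<alpha> has_real_derivative - a * a1) (at t)" using d\<alpha>'[OF I(2)] a2 by simp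
  have d1: "(\<alpha> has_real_derivative a1) (at t)" using d\<alpha>[OF I(2)] a1 by simp
  consider "\<epsilon> \<noteq> 0" | "\<epsilon> = 0" by blast
  then have "(\<epsilon> \<noteq> 0 \<longrightarrow> deriv (F_of \<epsilon> \<alpha> \<theta> \<kappa>) t = (4 * \<epsilon> * \<kappa> * a1 - \<theta> * (a + t * a1)) / (4 * \<epsilon>)) \<and>
    (\<epsilon> = 0 \<longrightarrow> deriv (F_of \<epsilon> \<alpha> \<theta> \<kappa>) t = - \<kappa> * a\<^sup>2 / 2 - 2 * \<theta> / (3 * a)) \<and>
    F_of \<epsilon> \<alpha> \<theta> \<kappa> t * a1 = - deriv (deriv (F_of \<epsilon> \<alpha> \<theta> \<kappa>)) t"
  proof cases
    case 1
    let ?f' = "\<lambda>x. (4 * \<epsilon> * \<kappa> * deriv \<alpha> x - \<theta> * (\<alpha> x + x * deriv \<alpha> x)) / (4 * \<epsilon>)"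
    have 1: "(F_of \<epsilon> \<alpha> \<theta> \<kappa> has_real_derivative ?f' x) (at x)" if "x \<in> I" for x
      using 1 unfolding F_of_def[abs_def]
      by (auto intro!: derivative_eq_intros d\<alpha> that simp: field_simps)
    have 2: "(?f' has_real_derivative
        (4 * \<epsilon> * \<kappa> * (- a * a1) - \<theta> * (a1 + (a1 + t * (- a * a1)))) / (4 * \<epsilon>)) (at t)"
      by (rule DERIV_cdivide) (auto intro!: derivative_eq_intros d1 d2 simp: a1[symmetric] algebra_simps)
    from deriv_deriv_eqI[OF I 1 2] show ?thesis
      using \<open>\<epsilon> \<noteq> 0\<close> by (simp add: F_of_def a a1 field_simps)
  next
    case 2
    \<comment> \<open>For \<epsilon> = 0 the function divides by \<alpha>^2, hence the restriction
      to the open set where \<alpha> is nonzero.\<close>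
    let ?S = "I \<inter> \<alpha> -` (- {0})"
    let ?f' = "\<lambda>x. \<kappa> * deriv \<alpha> x + 4 * \<theta> * deriv \<alpha> x / (3 * (\<alpha> x)^3)"
    have "open ?S"
      using smooth_on_imp_continuous_on[OF \<alpha>] I(1)
      by (metis Int_commute continuous_on_open_vimage open_Compl closed_singleton)
    have S: "t \<in> ?S" using I(2) nz 2 by simp
    have 1: "(F_of \<epsilon> \<alpha> \<theta> \<kappa> has_real_derivative ?f' x) (at x)" if "x \<in> ?S" for x
      using 2 that unfolding F_of_def[abs_def]
      by (auto intro!: derivative_eq_intros d\<alpha> simp: field_simps power2_eq_square power3_eq_cube)
    have a0: "a \<noteq> 0" using nz 2 a by simp
    have a1': "a1 = - a\<^sup>2 / 2" using ode 2 by simp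
    have 3: "(?f' has_real_derivative \<kappa> * (- a * a1) +
        (4 * \<theta> * (- a * a1) * (3 * a^3) - 4 * \<theta> * a1 * (3 * (3 * a\<^sup>2 * a1))) / (3 * a^3 * (3 * a^3))) (at t)"
      using a0 by (auto intro!: derivative_eq_intros d1 d2 simp: a[symmetric] a1[symmetric])
    from deriv_deriv_eqI[OF \<open>open ?S\<close> S 1 3] show ?thesis
      using a0 2 by (simp add: F_of_def a[symmetric] a1[symmetric])
        (simp add: a1' field_simps eval_nat_numeral)
  qed
  then show "\<epsilon> \<noteq> 0 \<Longrightarrow> deriv (F_of \<epsilon> \<alpha> \<theta> \<kappa>) t = (4 * \<epsilon> * \<kappa> * a1 - \<theta> * (a + t * a1)) / (4 * \<epsilon>)"
    and "\<epsilon> = 0 \<Longrightarrow> deriv (F_of \<epsilon> \<alpha> \<theta> \<kappa>) t = - \<kappa> * a\<^sup>2 / 2 - 2 * \<theta> / (3 * a)"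
    and "F_of \<epsilon> \<alpha> \<theta> \<kappa> t * a1 = - deriv (deriv (F_of \<epsilon> \<alpha> \<theta> \<kappa>)) t"
    by blast+
qed

theorem theoremD:
  fixes A :: "('m::{t2_space, second_countable_topology}, 4) chart set"
    and g J :: "('m, 4) tensor2"
    and \<tau> \<sigma> :: "'m \<Rightarrow> real"
    and \<alpha> :: "real \<Rightarrow> real" and I :: "real set"
    and Q Y s :: "'m \<Rightarrow> real"
    and U :: "'m set"
  assumes kaehler: "kaehler_manifold A g J"
    and tau: "smooth_fun A \<tau>"
    and alpha: "open I" "\<tau> ` carrier_of A \<subseteq> I" "smooth_on I \<alpha>"
    and ricci_hessian: "\<forall>c\<in>A. \<forall>p\<in>chart_dom c.
          \<alpha> (\<tau> p) *\<^sub>R hessian g \<tau> c p + ricci g c p = \<sigma> p *\<^sub>R g c p"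
    and dense: "carrier_of A \<subseteq>
          closure {p \<in> carrier_of A. nonzero_at A (\<lambda>c q. \<alpha> (\<tau> q) *\<^sub>R hessian g \<tau> c q) p}"
    and Q: "Q = grad_norm_sq A g \<tau>"
    and Y: "Y = laplacian A g \<tau>"
    and s: "s = scalar_curvature A g"
    and U: "open U" "connected U" "U \<subseteq> carrier_of A"
    and dQ_dtau: "\<forall>p\<in>U. nonzero_at A (wedge_differentials Q \<tau>) p"
  shows "\<exists>\<epsilon>.
      (\<forall>p\<in>U. deriv (deriv \<alpha>) (\<tau> p) + \<alpha> (\<tau> p) * deriv \<alpha> (\<tau> p) = 0 \<and>
             2 * deriv \<alpha> (\<tau> p) + (\<alpha> (\<tau> p))\<^sup>2 = 4 * \<epsilon>) \<and>
      (\<exists>\<theta> \<kappa>.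
         (\<forall>p\<in>U. 2 * \<theta> = \<alpha> (\<tau> p) * s p + 4 * \<epsilon> * Y p) \<and>
         (\<forall>p\<in>U. \<alpha> (\<tau> p) \<noteq> 0 \<longrightarrow> \<kappa> = \<theta> * psi_of \<epsilon> \<alpha> (\<tau> p) + Y p / \<alpha> (\<tau> p) - Q p) \<and>
         (let F = F_of \<epsilon> \<alpha> \<theta> \<kappa> in
           \<forall>p\<in>U.
             Y p - Q p * \<alpha> (\<tau> p) = F (\<tau> p) \<and>
             2 * \<sigma> p = - (Q p * deriv \<alpha> (\<tau> p) + deriv F (\<tau> p)) \<and>
             laplacian A g (\<lambda>q. \<alpha> (\<tau> q)) p = F (\<tau> p) * deriv \<alpha> (\<tau> p) \<and>
             F (\<tau> p) * deriv \<alpha> (\<tau> p) = - deriv (deriv F) (\<tau> p))) \<and>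
      (\<exists>c b \<epsilon>'. c \<noteq> 0 \<and>
         (let \<alpha>' = affine_mod c b \<alpha>; T = (\<lambda>p. b + \<tau> p / c) ` U in
           (\<forall>t\<in>T. 2 * deriv \<alpha>' t + (\<alpha>' t)\<^sup>2 = 4 * \<epsilon>') \<and> normal_form T \<alpha>' \<epsilon>'))"
proof (cases "U = {}")
  case True
  then show ?thesis
    \<comment> \<open>All pointwise claims are vacuous; only a nonzero c and an \<epsilon>' among 1,
      0, -1 must be exhibited.\<close>
    by (intro exI[of _ 0]) (auto simp: normal_form_def Let_def intro!: exI[of _ "1::real"])
next
  case False
  define F where "F = (\<lambda>p. Y p - \<alpha> (\<tau> p) * Q p)"
  define F' where "F' = (\<lambda>p. - (2 * \<sigma> p + Q p * deriv \<alpha> (\<tau> p)))"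
  note S = ricci_hessian_scalars[OF kaehler tau alpha ricci_hessian dense U(1,3) dQ_dtau[unfolded Q],
      folded Q Y, folded F_def F'_def]
  have man: "smooth_manifold A" using kaehler by (simp add: kaehler_manifold_def)
  have tauI: "\<tau> p \<in> I" if "p \<in> U" for p using that alpha(2) U(3) by blast
  have region: "chart_region c (U \<inter> chart_dom c)" if "c \<in> A" for c
    using man that U(1) by unfold_locales (auto simp: smooth_manifold_def is_chart_def)
  have chart: "\<exists>c\<in>A. p \<in> chart_dom c" if "p \<in> U" for p using that U(3) by (auto simp: carrier_of_def)
  define a where "a p = \<alpha> (\<tau> p)" for p
  define a1 where "a1 p = deriv \<alpha> (\<tau> p)" for p
  have DF: "coord_deriv c i F p = F' p * coord_deriv c i \<tau> p"
    "coord_deriv c i F' p = - a1 p * F p * coord_deriv c i \<tau> p"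
    if "c \<in> A" "p \<in> U" "p \<in> chart_dom c" for c p i
    using S(5,6)[OF that, of i] unfolding F_def F'_def a1_def by simp_all
  have sm: "chart_region.sm c (U \<inter> chart_dom c) a" "chart_region.sm c (U \<inter> chart_dom c) a1"
    and D: "\<And>p i. p \<in> U \<Longrightarrow> p \<in> chart_dom c \<Longrightarrow> coord_deriv c i a p = a1 p * coord_deriv c i \<tau> p"
    "\<And>p i. p \<in> U \<Longrightarrow> p \<in> chart_dom c \<Longrightarrow> coord_deriv c i a1 p = - a p * a1 p * coord_deriv c i \<tau> p"
    if c: "c \<in> A" for c
  proof -
    interpret X: chart_region c "U \<inter> chart_dom c" by (rule region[OF c])
    have im: "\<tau> ` (U \<inter> chart_dom c) \<subseteq> I" using tauI by blast
    note s = alpha(3) smooth_on_deriv[OF alpha(1,3)]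
    show "X.sm a" "X.sm a1"
      unfolding a_def[abs_def] a1_def[abs_def] by (rule X.sm_compose[OF _ alpha(1) im S(1)[OF c]], rule s)+
    fix p i assume p: "p \<in> U" "p \<in> chart_dom c"
    then have "p \<in> U \<inter> chart_dom c" by simp
    note d = X.D_compose[OF smooth_on_imp_differentiable[OF _ tauI[OF p(1)]] S(1)[OF c] this, of _ i]
    show "coord_deriv c i a p = a1 p * coord_deriv c i \<tau> p"
      unfolding a_def[abs_def] a1_def by (rule d[OF s(1)])
    have "deriv (deriv \<alpha>) (\<tau> p) = - a p * a1 p" using S(4)[OF p(1)] by (simp add: a_def a1_def)
    then show "coord_deriv c i a1 p = - a p * a1 p * coord_deriv c i \<tau> p"
      using d[OF s(2)] by (simp add: a1_def[abs_def])
  qed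
  \<comment> \<open>The base point at which all constants are read off; \<alpha> is nonzero there so
    that the Riccati lemmas for \<epsilon> = 0 apply.\<close>
  obtain p1 where p1: "p1 \<in> U" "\<alpha> (\<tau> p1) \<noteq> 0" using S(9)[OF False] by blast
  note const = constant_if_coord_derivs_zero[OF man U _ _ _ p1(1)]

  define \<epsilon> where "\<epsilon> = (2 * a1 p1 + a p1 * a p1) / 4"
  have ode: "2 * a1 p + (a p)\<^sup>2 = 4 * \<epsilon>" if p: "p \<in> U" for p
  proof -
    have "2 * a1 p + a p * a p = 2 * a1 p1 + a p1 * a p1"
    proof (rule const[OF _ _ p])
      fix c assume c: "c \<in> A"
      interpret X: chart_region c "U \<inter> chart_dom c" by (rule region[OF c])
      note s = sm[OF c] X.sm_const X.sm_add X.sm_mult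
      show "X.sm (\<lambda>p. 2 * a1 p + a p * a p)" by (intro s)
      show "X.D i (\<lambda>p. 2 * a1 p + a p * a p) p = 0" if "p \<in> U" "p \<in> chart_dom c" for p i
        using that by (simp add: X.D_add X.D_mult X.D_const s D[OF c])
    qed
    then show ?thesis by (simp add: \<epsilon>_def power2_eq_square)
  qed

  \<comment> \<open>The Wronskian of F with the solution \<alpha>.\<close>
  define \<theta> where "\<theta> = a1 p1 * F p1 - a p1 * F' p1"
  have \<theta>: "\<theta> = a1 p * F p - a p * F' p" if p: "p \<in> U" for p
    unfolding \<theta>_def
  proof (rule const[OF _ _ p, symmetric])
    fix c assume c: "c \<in> A"
    interpret X: chart_region c "U \<inter> chart_dom c" by (rule region[OF c])
    note s = sm[OF c] S(2,3)[OF c] X.sm_diff X.sm_mult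
    show "X.sm (\<lambda>p. a1 p * F p - a p * F' p)" by (intro s)
    show "X.D i (\<lambda>p. a1 p * F p - a p * F' p) p = 0" if "p \<in> U" "p \<in> chart_dom c" for p i
      using that by (simp add: X.D_diff X.D_mult s D[OF c] DF[OF c])
  qed

  have T: "connected (\<tau> ` U)"
  proof (rule connected_continuous_image[OF _ U(2)], rule continuous_at_imp_continuous_on, rule ballI)
    fix p assume p: "p \<in> U"
    then obtain c where c: "c \<in> A" "p \<in> chart_dom c" using chart by blast
    interpret X: chart_region c "U \<inter> chart_dom c" by (rule region[OF c(1)])
    show "isCont \<tau> p"
      using X.sm_continuous_on[OF S(1)[OF c(1)]] X.open_region p c(2)
      by (simp add: continuous_on_eq_continuous_at)
  qed
  have riccati: "(\<alpha> has_real_derivative (4 * \<epsilon> - (\<alpha> x)\<^sup>2) / 2) (at x)" if x: "x \<in> \<tau> ` U" for x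
  proof -
    obtain p where p: "p \<in> U" "x = \<tau> p" using x by blast
    have "(4 * \<epsilon> - (\<alpha> x)\<^sup>2) / 2 = deriv \<alpha> x" using ode[OF p(1)] by (simp add: p(2) a_def a1_def)
    then show ?thesis using DERIV_smooth_on[OF alpha(3) tauI[OF p(1)]] p(2) by simp
  qed

  have "\<exists>\<kappa>. \<forall>p\<in>U. F_of \<epsilon> \<alpha> \<theta> \<kappa> (\<tau> p) = F p \<and> deriv (F_of \<epsilon> \<alpha> \<theta> \<kappa>) (\<tau> p) = F' p \<and>
      F p * a1 p = - deriv (deriv (F_of \<epsilon> \<alpha> \<theta> \<kappa>)) (\<tau> p) \<and>
      (a p \<noteq> 0 \<longrightarrow> \<kappa> = \<theta> * psi_of \<epsilon> \<alpha> (\<tau> p) + F p / a p)"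
  proof (cases "\<epsilon> = 0")
    case False
    text \<open>The coefficients are Wronskians with the solutions \<open>\<alpha>\<close> and \<open>2 - \<tau>\<alpha>\<close> of \<open>F'' + \<alpha>' F = 0\<close>.\<close>
    let ?k = "\<lambda>p. F' p * (2 - \<tau> p * a p) + F p * (a p + \<tau> p * a1 p)"
    \<comment> \<open>The divisor is, up to sign, the Wronskian of the two solutions:
      \<alpha>(-\<alpha> - \<tau>\<alpha>') - \<alpha>'(2 - \<tau>\<alpha>) = -(\<alpha>^2 +
      2\<alpha>') = -4\<epsilon>.\<close>
    define \<kappa> where "\<kappa> = ?k p1 / (4 * \<epsilon>)"
    have \<kappa>: "4 * \<epsilon> * \<kappa> = ?k p" if p: "p \<in> U" for p
    proof -
      have "?k p = ?k p1"
      proof (rule const[OF _ _ p])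
        fix c assume c: "c \<in> A"
        interpret X: chart_region c "U \<inter> chart_dom c" by (rule region[OF c])
        note s = sm[OF c] S(1-3)[OF c] X.sm_const X.sm_diff X.sm_add X.sm_mult
        show "X.sm ?k" by (intro s)
        show "X.D i ?k p = 0" if "p \<in> U" "p \<in> chart_dom c" for p i
          using that by (simp add: X.D_diff X.D_add X.D_mult X.D_const s D[OF c] DF[OF c])
            (simp add: algebra_simps)
      qed
      then show ?thesis using False by (simp add: \<kappa>_def)
    qed
    show ?thesis
    proof (intro exI[of _ \<kappa>] ballI)
      fix p assume p: "p \<in> U"
      have a2: "deriv (deriv \<alpha>) (\<tau> p) = - a p * a1 p" using S(4)[OF p] by (simp add: a_def a1_def)
      note d = F_of_derivs[OF alpha(1) tauI[OF p] alpha(3) _ a_def a1_def a2 ode[OF p], of \<theta> \<kappa>]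
      have e: "4 * \<epsilon> = 2 * a1 p + a p * a p" using ode[OF p] by (simp add: power2_eq_square)
      have "\<theta> * (2 - \<tau> p * a p) + 4 * \<epsilon> * \<kappa> * a p = F p * (4 * \<epsilon>)"
        unfolding \<kappa>[OF p] \<theta>[OF p] unfolding e by (simp add: algebra_simps)
      then have 1: "F_of \<epsilon> \<alpha> \<theta> \<kappa> (\<tau> p) = F p"
        using False by (simp add: F_of_def a_def[symmetric] field_simps)
      have "4 * \<epsilon> * \<kappa> * a1 p - \<theta> * (a p + \<tau> p * a1 p) = F' p * (4 * \<epsilon>)"
        unfolding \<kappa>[OF p] \<theta>[OF p] unfolding e by (simp add: algebra_simps)
      then have 2: "deriv (F_of \<epsilon> \<alpha> \<theta> \<kappa>) (\<tau> p) = F' p"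
        using False d(1) by (simp add: field_simps)
      have 3: "\<kappa> = \<theta> * psi_of \<epsilon> \<alpha> (\<tau> p) + F p / a p" if "a p \<noteq> 0"
        using 1 that False by (simp add: psi_of_def F_of_def a_def[symmetric] field_simps)
      show "F_of \<epsilon> \<alpha> \<theta> \<kappa> (\<tau> p) = F p \<and> deriv (F_of \<epsilon> \<alpha> \<theta> \<kappa>) (\<tau> p) = F' p \<and>
        F p * a1 p = - deriv (deriv (F_of \<epsilon> \<alpha> \<theta> \<kappa>)) (\<tau> p) \<and>
        (a p \<noteq> 0 \<longrightarrow> \<kappa> = \<theta> * psi_of \<epsilon> \<alpha> (\<tau> p) + F p / a p)"
        using 1 2 3 d(3) False by simp
    qed
  next
    case True
    have "\<And>x. x \<in> \<tau> ` U \<Longrightarrow> (\<alpha> has_real_derivative - (\<alpha> x)\<^sup>2 / 2) (at x)"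
      using riccati True by simp
    then obtain t1 where t1: "\<And>t. t \<in> \<tau> ` U \<Longrightarrow> \<alpha> t * (t - t1) = 2"
      using riccati_zero[where \<alpha> = \<alpha>, OF T imageI[OF p1(1)] _ p1(2)] by blast
    have v: "a p * (\<tau> p - t1) = 2" "a p \<noteq> 0" "a1 p = - a p * a p / 2" if "p \<in> U" for p
      using t1[of "\<tau> p"] ode[OF that] that True by (auto simp: a_def power2_eq_square)
    \<comment> \<open>For \<epsilon> = 0 one has 2 - \<tau>\<alpha> = -t1 \<alpha>, so another
      solution is needed: (\<tau> - t1)^2, which is 4/\<alpha>^2. The expression is the Wronskian of
      F with it; for F = \<alpha> = 2/(\<tau> - t1) it equals 6, whence the divisor of
      \<kappa>.\<close>
    let ?k = "\<lambda>p. 2 * (\<tau> p - t1) * F p - (\<tau> p - t1) * (\<tau> p - t1) * F' p"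
    define \<kappa> where "\<kappa> = ?k p1 / 6"
    have \<kappa>: "6 * \<kappa> = ?k p" if p: "p \<in> U" for p
    proof -
      have "?k p = ?k p1"
      proof (rule const[OF _ _ p])
        fix c assume c: "c \<in> A"
        interpret X: chart_region c "U \<inter> chart_dom c" by (rule region[OF c])
        note s = sm[OF c] S(1-3)[OF c] X.sm_const X.sm_diff X.sm_add X.sm_mult
        show "X.sm ?k" by (intro s)
        show "X.D i ?k p = 0" if p: "p \<in> U" "p \<in> chart_dom c" for p i
        proof -
          have "X.D i ?k p = (2 + (\<tau> p - t1) * (\<tau> p - t1) * a1 p) * F p * X.D i \<tau> p"
            using p by (simp add: X.D_diff X.D_mult X.D_const s DF[OF c])
              (simp add: algebra_simps)
          moreover have "(\<tau> p - t1) * (\<tau> p - t1) * a1 p = - (a p * (\<tau> p - t1)) * (a p * (\<tau> p - t1)) / 2"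
            by (simp add: v(3)[OF p(1)])
          ultimately show ?thesis by (simp add: v(1)[OF p(1)])
        qed
      qed
      then show ?thesis by (simp add: \<kappa>_def)
    qed
    show ?thesis
    proof (intro exI[of _ \<kappa>] ballI)
      fix p assume p: "p \<in> U"
      have a2: "deriv (deriv \<alpha>) (\<tau> p) = - a p * a1 p" using S(4)[OF p] by (simp add: a_def a1_def)
      note d = F_of_derivs[OF alpha(1) tauI[OF p] alpha(3) _ a_def a1_def a2 ode[OF p], of \<theta> \<kappa>]
      have a0: "a p \<noteq> 0" using v[OF p] by simp
      have "\<tau> p - t1 = 2 / a p" using v(1)[OF p] a0 by (simp add: field_simps)
      then have k: "\<kappa> = (4 * F p / a p - 4 * F' p / (a p * a p)) / 6"
        using \<kappa>[OF p] by simp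
      have th: "\<theta> = - a p * a p / 2 * F p - a p * F' p" using \<theta>[OF p] v(3)[OF p] by simp
      have 1: "F_of \<epsilon> \<alpha> \<theta> \<kappa> (\<tau> p) = F p"
        using a0 True by (simp add: F_of_def a_def[symmetric] k th) (simp add: field_simps power2_eq_square)
      have 2: "deriv (F_of \<epsilon> \<alpha> \<theta> \<kappa>) (\<tau> p) = F' p"
        using d(2) a0 True by (simp add: a_def[symmetric] k th) (simp add: field_simps power2_eq_square)
      have 3: "\<kappa> = \<theta> * psi_of \<epsilon> \<alpha> (\<tau> p) + F p / a p"
        using a0 True by (simp add: psi_of_def a_def[symmetric] k th)
          (simp add: field_simps power2_eq_square power3_eq_cube)
      show "F_of \<epsilon> \<alpha> \<theta> \<kappa> (\<tau> p) = F p \<and> deriv (F_of \<epsilon> \<alpha> \<theta> \<kappa>) (\<tau> p) = F' p \<and>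
        F p * a1 p = - deriv (deriv (F_of \<epsilon> \<alpha> \<theta> \<kappa>)) (\<tau> p) \<and>
        (a p \<noteq> 0 \<longrightarrow> \<kappa> = \<theta> * psi_of \<epsilon> \<alpha> (\<tau> p) + F p / a p)"
        using 1 2 3 d(3) a0 by (simp add: a_def[symmetric])
    qed
  qed
  then obtain \<kappa> where \<kappa>: "\<And>p. p \<in> U \<Longrightarrow> F_of \<epsilon> \<alpha> \<theta> \<kappa> (\<tau> p) = F p"
      "\<And>p. p \<in> U \<Longrightarrow> deriv (F_of \<epsilon> \<alpha> \<theta> \<kappa>) (\<tau> p) = F' p"
      "\<And>p. p \<in> U \<Longrightarrow> F p * a1 p = - deriv (deriv (F_of \<epsilon> \<alpha> \<theta> \<kappa>)) (\<tau> p)"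
      "\<And>p. p \<in> U \<Longrightarrow> a p \<noteq> 0 \<Longrightarrow> \<kappa> = \<theta> * psi_of \<epsilon> \<alpha> (\<tau> p) + F p / a p"
    by metis

  \<comment> \<open>In terms of Y and \<sigma> the Wronskian is \<alpha>'Y + 2\<alpha>\<sigma>; the
    traced equation s = 4\<sigma> - \<alpha>Y eliminates \<sigma>.\<close>
  have scalar: "2 * \<theta> = \<alpha> (\<tau> p) * s p + 4 * \<epsilon> * Y p" if p: "p \<in> U" for p
  proof -
    have sp: "s p = 4 * \<sigma> p - a p * Y p" using S(7)[OF p] s by (simp add: a_def)
    have e: "4 * \<epsilon> = 2 * a1 p + a p * a p" using ode[OF p] by (simp add: power2_eq_square)
    have FF: "F p = Y p - a p * Q p" "F' p = - (2 * \<sigma> p + Q p * a1 p)"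
      by (simp_all add: F_def F'_def a_def a1_def)
    show ?thesis
      unfolding \<theta>[OF p] a_def[of p, symmetric] sp FF e by (simp add: algebra_simps)
  qed
  have kappa: "\<kappa> = \<theta> * psi_of \<epsilon> \<alpha> (\<tau> p) + Y p / \<alpha> (\<tau> p) - Q p" if p: "p \<in> U" "\<alpha> (\<tau> p) \<noteq> 0" for p
    using \<kappa>(4)[OF p(1)] p(2) by (simp add: a_def F_def diff_divide_distrib)
  have abc: "Y p - Q p * \<alpha> (\<tau> p) = F_of \<epsilon> \<alpha> \<theta> \<kappa> (\<tau> p) \<and>
      2 * \<sigma> p = - (Q p * deriv \<alpha> (\<tau> p) + deriv (F_of \<epsilon> \<alpha> \<theta> \<kappa>) (\<tau> p)) \<and>
      laplacian A g (\<lambda>q. \<alpha> (\<tau> q)) p = F_of \<epsilon> \<alpha> \<theta> \<kappa> (\<tau> p) * deriv \<alpha> (\<tau> p) \<and>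
      F_of \<epsilon> \<alpha> \<theta> \<kappa> (\<tau> p) * deriv \<alpha> (\<tau> p) = - deriv (deriv (F_of \<epsilon> \<alpha> \<theta> \<kappa>)) (\<tau> p)" if p: "p \<in> U" for p
  proof -
    have "deriv (deriv \<alpha>) (\<tau> p) = - \<alpha> (\<tau> p) * deriv \<alpha> (\<tau> p)" using S(4)[OF p] by simp
    then show ?thesis
      unfolding \<kappa>(1,2)[OF p] S(8)[OF p] using \<kappa>(3)[OF p]
      by (simp add: F_def F'_def a1_def algebra_simps)
  qed

  \<comment> \<open>The constant becomes c^2 \<epsilon>: \<alpha> is multiplied by c, and
    differentiation in the new variable contributes another c.\<close>
  have "\<exists>c b. c \<noteq> 0 \<and> normal_form ((\<lambda>t. b + t / c) ` \<tau> ` U) (affine_mod c b \<alpha>) (c\<^sup>2 * \<epsilon>)"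
    using riccati_normal_form[where \<alpha> = \<alpha> and \<epsilon> = \<epsilon>, OF T imageI[OF p1(1)] riccati p1(2)] by blast
  then obtain c b where cb: "c \<noteq> 0" "normal_form ((\<lambda>p. b + \<tau> p / c) ` U) (affine_mod c b \<alpha>) (c\<^sup>2 * \<epsilon>)"
    by (auto simp: image_image)
  have ode': "2 * deriv (affine_mod c b \<alpha>) t + (affine_mod c b \<alpha> t)\<^sup>2 = 4 * (c\<^sup>2 * \<epsilon>)"
    if t: "t \<in> (\<lambda>p. b + \<tau> p / c) ` U" for t
  proof -
    obtain p where p: "p \<in> U" "t = b + \<tau> p / c" using t by blast
    have "2 * (c\<^sup>2 * a1 p) + (c * a p)\<^sup>2 = c\<^sup>2 * (2 * a1 p + (a p)\<^sup>2)"
      by (simp add: power_mult_distrib distrib_left)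
    then show ?thesis
      unfolding p(2) deriv_affine_mod[OF cb(1) DERIV_smooth_on[OF alpha(3) tauI[OF p(1)]]]
        affine_mod_apply[OF cb(1)] by (simp add: a_def[symmetric] a1_def[symmetric] ode[OF p(1)])
  qed
  have normal: "\<exists>c b \<epsilon>'. c \<noteq> 0 \<and>
         (let \<alpha>' = affine_mod c b \<alpha>; T = (\<lambda>p. b + \<tau> p / c) ` U in
           (\<forall>t\<in>T. 2 * deriv \<alpha>' t + (\<alpha>' t)\<^sup>2 = 4 * \<epsilon>') \<and> normal_form T \<alpha>' \<epsilon>')"
    unfolding Let_def
    by (rule exI[of _ c], rule exI[of _ b], rule exI[of _ "c\<^sup>2 * \<epsilon>"]) (use cb ode' in simp)
  show ?thesis
  proof (rule exI[of _ \<epsilon>], intro conjI)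
    show "\<forall>p\<in>U. deriv (deriv \<alpha>) (\<tau> p) + \<alpha> (\<tau> p) * deriv \<alpha> (\<tau> p) = 0 \<and>
        2 * deriv \<alpha> (\<tau> p) + (\<alpha> (\<tau> p))\<^sup>2 = 4 * \<epsilon>"
      using S(4) ode by (simp add: a_def a1_def)
    show "\<exists>\<theta> \<kappa>.
         (\<forall>p\<in>U. 2 * \<theta> = \<alpha> (\<tau> p) * s p + 4 * \<epsilon> * Y p) \<and>
         (\<forall>p\<in>U. \<alpha> (\<tau> p) \<noteq> 0 \<longrightarrow> \<kappa> = \<theta> * psi_of \<epsilon> \<alpha> (\<tau> p) + Y p / \<alpha> (\<tau> p) - Q p) \<and>
         (let F = F_of \<epsilon> \<alpha> \<theta> \<kappa> in
           \<forall>p\<in>U.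
             Y p - Q p * \<alpha> (\<tau> p) = F (\<tau> p) \<and>
             2 * \<sigma> p = - (Q p * deriv \<alpha> (\<tau> p) + deriv F (\<tau> p)) \<and>
             laplacian A g (\<lambda>q. \<alpha> (\<tau> q)) p = F (\<tau> p) * deriv \<alpha> (\<tau> p) \<and>
             F (\<tau> p) * deriv \<alpha> (\<tau> p) = - deriv (deriv F) (\<tau> p))"
      unfolding Let_def
      by (rule exI[of _ \<theta>], rule exI[of _ \<kappa>]) (use scalar kappa abc in simp)
    show "\<exists>c b \<epsilon>'. c \<noteq> 0 \<and>
         (let \<alpha>' = affine_mod c b \<alpha>; T = (\<lambda>p. b + \<tau> p / c) ` U in
           (\<forall>t\<in>T. 2 * deriv \<alpha>' t + (\<alpha>' t)\<^sup>2 = 4 * \<epsilon>') \<and> normal_form T \<alpha>' \<epsilon>')"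
      by (rule normal)
  qed
qed

end
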